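(* Let $q$ be a $(0,1)$-valued random variable with probability density $p(x)=x^{-\rho}L(1/x)$, $x\in(0,1)$, where $\rho<1$ and $L$ is slowly varying at infinity. Let $\mathcal X$ be a symmetric real random variable satisfying one of the following two conditions: (i) $\mathbb E\mathcal X^2<\infty$, in which case set $\alpha=2$ and $C_{\mathcal X}:=\mathbb E\mathcal X^2$; (ii) $\mathbb P(|\mathcal X|>x)\sim C_{\mathcal X}x^{-\alpha}$ as $x\to\infty$, for some $\alpha\in(0,2)$ and $C_{\mathcal X}>0$. Let $\alpha'>0$ and assume further that $$\beta:=\gamma-1+\rho\in(0,1)\quad\text{with}\quad \gamma:=\frac{\alpha}{\alpha'}.$$ Let $\{m_n\}_{n\in\mathbb N}$ be an increasing sequence of positive integers satisfying $$\lim_{n\to\infty}\frac{m_nL(n)}{n^{1-\rho}}=\infty,$$ and set $$a_n=\left(C_{\mathcal X}\frac{\Gamma(1-\beta)}{\beta}\, n^\beta m_nL(n)\right)^{1/\alpha}.$$ Let $\widehat S_n(t)$, $t\in[0,1]$, be the partial-sum process of the aggregated model defined in the context. Then, as $n\to\infty$, the finite-dimensional distributions of $\{\widehat S_n(t)/a_n\}_{t\in[0,1]}$ converge to those of the Karlin stable process $\{\zeta_{\alpha,\beta}(t)\}_{t\in[0,1]}$.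
   Context: $\mathbb N=\{1,2,\dots\}$. Aggregated model. Given $q$, let $\{\eta_j^{(q)}\}_{j\in\mathbb N}$ be conditionally i.i.d. Bernoulli random variables with parameter $q$, and let $\tau_j^{(q)}:=\sum_{k=1}^j\eta_k^{(q)}$. The random variable $\mathcal X$ is independent of $(q,\{\eta_j^{(q)}\}_{j\in\mathbb N})$. Let $(\mathcal X_i,q_i,\{\eta_{i,j}^{(q_i)}\}_{j\in\mathbb N},\{\tau_{i,j}^{(q_i)}\}_{j\in\mathbb N})$, $i\in\mathbb N$, be i.i.d. copies of $(\mathcal X,q,\{\eta_j^{(q)}\}_{j\in\mathbb N},\{\tau_j^{(q)}\}_{j\in\mathbb N})$. Define $$\widehat{\mathcal X}_{n,j}:=\sum_{i=1}^{m_n}\frac{\mathcal X_i}{q_i^{1/\alpha'}}(-1)^{\tau_{i,j}^{(q_i)}}\eta_{i,j}^{(q_i)},\quad n\in\mathbb N,\ j=1,\dots,n,\qquad \widehat S_n(t):=\sum_{j=1}^{\lfloor nt\rfloor}\widehat{\mathcal X}_{n,j},\quad t\in[0,1].$$ Karlin stable process. For $\alpha\in(0,2]$ and $\beta\in(0,1)$, $\zeta_{\alpha,\beta}=\{\zeta_{\alpha,\beta}(t)\}_{t\ge0}$ is the symmetric $\alpha$-stable process whose finite-dimensional distributions are given, for all $d\in\mathbb N$, $t_1,\dots,t_d\ge0$ and $\theta_1,\dots,\theta_d\in\mathbb R$, by $$\mathbb E\exp\left(i\sum_{j=1}^d\theta_j\zeta_{\alpha,\beta}(t_j)\right)=\exp\left(-\frac{\beta}{\Gamma(1-\beta)\mathsf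 C_\alpha}\int_0^\infty\mathbb E\left|\sum_{j=1}^d\theta_j\mathbf 1_{\{N(t_jq)\text{ odd}\}}\right|^\alpha q^{-\beta-1}\,dq\right),$$ where on the right-hand side $q$ is a (deterministic) integration variable, $N$ is a standard (unit-rate) Poisson process on $[0,\infty)$, and $\mathsf C_\alpha=\left(\int_0^\infty x^{-\alpha}\sin x\,dx\right)^{-1}$ (improper integral) if $\alpha\in(0,2)$, $\mathsf C_2=2$. *)

theory Defs
  imports "HOL-Probability.Probability" "HOL-Library.Landau_Symbols"
begin

text \<open>Positivity and measurability are required only on a neighbourhood of infinity.\<close>

definition slowly_varying :: "(real \<Rightarrow> real) \<Rightarrow> bool" where
  "slowly_varying L \<longleftrightarrow>
     (\<exists>x0>0. L \<in> borel_measurable (restrict_space borel {x0..}) \<and> (\<forall>x\<ge>x0. L x > 0)) \<and>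
     (\<forall>c>0. ((\<lambda>x. L (c * x) / L x) \<longlongrightarrow> 1) at_top)"

definition symmetric_rv :: "'a measure \<Rightarrow> ('a \<Rightarrow> real) \<Rightarrow> bool" where
  "symmetric_rv M X \<longleftrightarrow>
     X \<in> borel_measurable M \<and> distr M borel (\<lambda>\<omega>. - X \<omega>) = distr M borel X"

text \<open>\<open>Y 1, Y 2, \<dots>\<close> (on \<open>M\<close>) are i.i.d. copies of the \<open>S\<close>-valued random element \<open>Z\<close> (on \<open>N\<close>).
  Joint measurability of each \<open>Y i\<close> is part of \<open>indep_vars\<close>.\<close>

definition iid_copies ::
  "'a measure \<Rightarrow> (nat \<Rightarrow> 'a \<Rightarrow> 'c) \<Rightarrow> 'b measure \<Rightarrow> ('b \<Rightarrow> 'c) \<Rightarrow> 'c measure \<Rightarrow> bool" where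
  "iid_copies M Y N Z S \<longleftrightarrow>
     prob_space.indep_vars M (\<lambda>_. S) Y {1..} \<and> (\<forall>i\<ge>1. distr M S (Y i) = distr N S Z)"

text \<open>Convergence of finite-dimensional distributions: weak convergence in \<open>\<real>\<^sup>d\<close> of the laws
  of \<open>(Y\<^sub>n(t\<^sub>1), \<dots>, Y\<^sub>n(t\<^sub>d))\<close>. Here \<open>\<real>\<^sup>d\<close> is the product space over the index set \<open>{..<d}\<close>.\<close>

definition fdd_converges ::
  "'a measure \<Rightarrow> (nat \<Rightarrow> real \<Rightarrow> 'a \<Rightarrow> real) \<Rightarrow> 'b measure \<Rightarrow> (real \<Rightarrow> 'b \<Rightarrow> real) \<Rightarrow> real set \<Rightarrow> bool"
  where
  "fdd_converges M Y P Z T \<longleftrightarrow>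
     (\<forall>(d::nat) (t :: nat \<Rightarrow> real) (f :: (nat \<Rightarrow> real) \<Rightarrow> real).
        (\<forall>k<d. t k \<in> T) \<longrightarrow>
        continuous_map (product_topology (\<lambda>_. euclideanreal) {..<d}) euclideanreal f \<longrightarrow>
        bounded (f ` (\<Pi>\<^sub>E k\<in>{..<d}. UNIV)) \<longrightarrow>
        (\<lambda>n. \<integral>\<omega>. f (\<lambda>k\<in>{..<d}. Y n (t k) \<omega>) \<partial>M)
          \<longlonglongrightarrow> (\<integral>\<omega>. f (\<lambda>k\<in>{..<d}. Z (t k) \<omega>) \<partial>P))"

definition cond_iid_bernoulli ::
  "'a measure \<Rightarrow> ('a \<Rightarrow> real) \<Rightarrow> (nat \<Rightarrow> 'a \<Rightarrow> nat) \<Rightarrow> bool" where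
  "cond_iid_bernoulli M q \<eta> \<longleftrightarrow>
     (\<forall>j\<ge>1. \<eta> j \<in> M \<rightarrow>\<^sub>M count_space UNIV \<and> (\<forall>\<omega>\<in>space M. \<eta> j \<omega> \<in> {0, 1})) \<and>
     (\<forall>J b. finite J \<longrightarrow> J \<subseteq> {1..} \<longrightarrow> (\<forall>j\<in>J. b j \<in> {0, 1}) \<longrightarrow>
        (AE \<omega> in M.
           real_cond_exp M (vimage_algebra (space M) q borel)
             (indicator {\<omega>\<in>space M. \<forall>j\<in>J. \<eta> j \<omega> = b j}) \<omega>
           = (\<Prod>j\<in>J. q \<omega> ^ b j * (1 - q \<omega>) ^ (1 - b j))))"

abbreviation eta_space :: "(nat \<Rightarrow> nat) measure" where
  "eta_space \<equiv> PiM {1..} (\<lambda>_. count_space UNIV)"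

text \<open>Independence of \<open>X\<close> and \<open>(q, \<eta>)\<close> is stated through the generated \<open>\<sigma>\<close>-algebras because
  \<open>indep_var\<close> requires both random elements to have values in the same type.\<close>

definition single_model ::
  "'a measure \<Rightarrow> ('a \<Rightarrow> real) \<Rightarrow> ('a \<Rightarrow> real) \<Rightarrow> (nat \<Rightarrow> 'a \<Rightarrow> nat) \<Rightarrow> bool" where
  "single_model M X q \<eta> \<longleftrightarrow>
     prob_space M \<and> X \<in> borel_measurable M \<and> q \<in> borel_measurable M \<and>
     cond_iid_bernoulli M q \<eta> \<and>
     prob_space.indep_set M
       (sets (vimage_algebra (space M) X borel))
       (sets (vimage_algebra (space M) (\<lambda>\<omega>. (q \<omega>, \<lambda>j\<in>{1..}. \<eta> j \<omega>))
          (borel \<Otimes>\<^sub>M eta_space)))"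

text \<open>The sequence \<open>\<tau>\<close> is a function of \<open>\<eta>\<close>, so it need not be listed among the copied data.\<close>

definition model_copies ::
  "'a measure \<Rightarrow> (nat \<Rightarrow> 'a \<Rightarrow> real) \<Rightarrow> (nat \<Rightarrow> 'a \<Rightarrow> real) \<Rightarrow> (nat \<Rightarrow> nat \<Rightarrow> 'a \<Rightarrow> nat) \<Rightarrow>
   'b measure \<Rightarrow> ('b \<Rightarrow> real) \<Rightarrow> ('b \<Rightarrow> real) \<Rightarrow> (nat \<Rightarrow> 'b \<Rightarrow> nat) \<Rightarrow> bool" where
  "model_copies M Xs qs \<eta>s N X q \<eta> \<longleftrightarrow>
     iid_copies M (\<lambda>i \<omega>. (Xs i \<omega>, qs i \<omega>, \<lambda>j\<in>{1..}. \<eta>s i j \<omega>))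
                N (\<lambda>\<omega>. (X \<omega>, q \<omega>, \<lambda>j\<in>{1..}. \<eta> j \<omega>))
                (borel \<Otimes>\<^sub>M borel \<Otimes>\<^sub>M eta_space)"

definition tau :: "(nat \<Rightarrow> 'a \<Rightarrow> nat) \<Rightarrow> nat \<Rightarrow> 'a \<Rightarrow> nat" where
  "tau \<eta> j \<omega> = (\<Sum>k=1..j. \<eta> k \<omega>)"

definition aggregated ::
  "real \<Rightarrow> (nat \<Rightarrow> nat) \<Rightarrow> (nat \<Rightarrow> 'a \<Rightarrow> real) \<Rightarrow> (nat \<Rightarrow> 'a \<Rightarrow> real) \<Rightarrow> (nat \<Rightarrow> nat \<Rightarrow> 'a \<Rightarrow> nat) \<Rightarrow>
   nat \<Rightarrow> nat \<Rightarrow> 'a \<Rightarrow> real" where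
  "aggregated \<alpha>' m Xs qs \<eta>s n j \<omega> =
     (\<Sum>i=1..m n. Xs i \<omega> / qs i \<omega> powr (1 / \<alpha>') * (-1) ^ tau (\<eta>s i) j \<omega> * real (\<eta>s i j \<omega>))"

definition aggregated_sum ::
  "real \<Rightarrow> (nat \<Rightarrow> nat) \<Rightarrow> (nat \<Rightarrow> 'a \<Rightarrow> real) \<Rightarrow> (nat \<Rightarrow> 'a \<Rightarrow> real) \<Rightarrow> (nat \<Rightarrow> nat \<Rightarrow> 'a \<Rightarrow> nat) \<Rightarrow>
   nat \<Rightarrow> real \<Rightarrow> 'a \<Rightarrow> real" where
  "aggregated_sum \<alpha>' m Xs qs \<eta>s n t \<omega> =
     (\<Sum>j=1..nat \<lfloor>real n * t\<rfloor>. aggregated \<alpha>' m Xs qs \<eta>s n j \<omega>)"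

definition std_poisson_process :: "'w measure \<Rightarrow> (real \<Rightarrow> 'w \<Rightarrow> nat) \<Rightarrow> bool" where
  "std_poisson_process W N \<longleftrightarrow>
     prob_space W \<and>
     (\<forall>t\<ge>0. N t \<in> W \<rightarrow>\<^sub>M count_space UNIV) \<and>
     (\<forall>\<omega>\<in>space W. N 0 \<omega> = 0 \<and> mono_on {0..} (\<lambda>t. N t \<omega>) \<and>
        (\<forall>t\<ge>0. continuous (at_right t) (\<lambda>s. N s \<omega>))) \<and>
     (\<forall>s t. 0 \<le> s \<longrightarrow> s < t \<longrightarrow>
        distr W (count_space UNIV) (\<lambda>\<omega>. N t \<omega> - N s \<omega>) = measure_pmf (poisson_pmf (t - s))) \<and>
     (\<forall>(k::nat) t. 0 \<le> t 0 \<longrightarrow> (\<forall>i<k. t i \<le> t (Suc i)) \<longrightarrow>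
        prob_space.indep_vars W (\<lambda>_. count_space UNIV)
          (\<lambda>i \<omega>. N (t (Suc i)) \<omega> - N (t i) \<omega>) {..<k})"

text \<open>For \<open>\<alpha> < 2\<close> the integral is improper at infinity (only conditionally convergent for
  \<open>\<alpha> \<le> 1\<close>).\<close>

definition C_stable :: "real \<Rightarrow> real" where
  "C_stable \<alpha> =
     (if \<alpha> = 2 then 2
      else inverse (Lim at_top (\<lambda>R. LBINT x:{0<..R}. x powr (-\<alpha>) * sin x)))"

text \<open>\<open>\<zeta>\<close> is a process on \<open>P\<close>; the Poisson process \<open>N\<close> on \<open>W\<close> only serves to express the
  characteristic functions.\<close>

definition karlin_stable_process ::
  "'w measure \<Rightarrow> (real \<Rightarrow> 'w \<Rightarrow> nat) \<Rightarrow> real \<Rightarrow> real \<Rightarrow> 'z measure \<Rightarrow> (real \<Rightarrow> 'z \<Rightarrow> real) \<Rightarrow> bool"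
  where
  "karlin_stable_process W N \<alpha> \<beta> P \<zeta> \<longleftrightarrow>
     prob_space P \<and>
     (\<forall>t\<ge>0. \<zeta> t \<in> borel_measurable P) \<and>
     (\<forall>(d::nat) (t :: nat \<Rightarrow> real) (\<theta> :: nat \<Rightarrow> real). (\<forall>k<d. 0 \<le> t k) \<longrightarrow>
        (\<integral>\<omega>. exp (\<i> * complex_of_real (\<Sum>k<d. \<theta> k * \<zeta> (t k) \<omega>)) \<partial>P) =
        complex_of_real (exp (- (\<beta> / (Gamma (1 - \<beta>) * C_stable \<alpha>)) *
          (LBINT q:{0<..}.
             (\<integral>\<omega>. \<bar>\<Sum>k<d. \<theta> k * of_bool (odd (N (t k * q) \<omega>))\<bar> powr \<alpha> \<partial>W)
               * q powr (-\<beta> - 1)))))"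

end

theory Submission
  imports Defs "HOL-Real_Asymp.Real_Asymp"
begin

text \<open>Within one copy the nonzero terms \<open>(-1) ^ \<tau>\<^sub>j * \<eta>\<^sub>j\<close> alternate \<open>-1, +1, -1, \<dots>\<close>, so their partial sum up
  to \<open>j\<close> is \<open>-1\<close> if \<open>\<tau>\<^sub>j\<close> is odd and \<open>0\<close> otherwise. A copy therefore contributes
  \<open>- X q powr (-1/\<alpha>') Y\<^sub>n\<close> to \<open>\<Sum>\<^sub>k \<theta>\<^sub>k S\<^sub>n(t\<^sub>k)\<close>, where \<open>Y\<^sub>n\<close> is the sum of those \<open>\<theta>\<^sub>k\<close> for which the Bernoulli
  sum at time \<open>\<lfloor>n t\<^sub>k\<rfloor>\<close> is odd (lemmas \<open>signed_partial_sum\<close>, \<open>aggregated_sum_eq_sum_contributions\<close>).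
  With \<open>\<Psi> s = 1 - E cos (s X)\<close>, independence and symmetry make the characteristic function of the
  normalised sum equal to \<open>(1 - D\<^sub>n) ^ m\<^sub>n\<close>, where \<open>D\<^sub>n = E \<Psi> (q powr (-1/\<alpha>') Y\<^sub>n / a\<^sub>n)\<close>. Everything
  reduces to the limit of \<open>m\<^sub>n D\<^sub>n\<close>.

  Both conditions on \<open>X\<close> say the same thing about \<open>\<Psi>\<close>, namely
  \<open>\<Psi> s \<sim> (CX / C_stable \<alpha>) \<bar>s\<bar> powr \<alpha>\<close> at the origin. Conditioning on \<open>q\<close> writes \<open>D\<^sub>n\<close> as an integral of
  the density of \<open>q\<close> against parity probabilities of Bernoulli sums with parameter \<open>x\<close>. After the
  substitution \<open>x = u / n\<close> these converge to parity probabilities of a Poisson process at the times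
  \<open>t\<^sub>k u\<close> (lemma \<open>bernoulli_parity_tendsto\<close>), the density becomes \<open>u powr (-\<rho>)\<close> up to the factor
  \<open>L (n / u) / L n\<close>, which tends to 1, and the powers of \<open>n\<close> cancel against \<open>a\<^sub>n\<close>; the growth condition on
  \<open>m\<^sub>n\<close> is what sends the argument of \<open>\<Psi>\<close> to 0 for fixed \<open>u\<close>. Domination comes from Potter's bound for
  \<open>L (n / u) / L n\<close> and from the fact that a nonempty parity pattern requires at least one success, hence
  has probability at most \<open>min 1 u\<close>; the two together leave
  \<open>u powr (-\<beta> - 1) min 1 u (u powr \<delta> + u powr (-\<delta>))\<close>, integrable because \<open>0 < \<beta> < 1\<close>. This is lemma
  \<open>mixture_integral_tendsto\<close>, and the limit is the exponent of the Karlin stable process.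

  Convergence of the characteristic functions of all linear combinations is turned into weak
  convergence in \<open>\<real>\<^sup>d\<close> by a multivariate continuity theorem, \<open>levy_continuity_multivariate\<close>.\<close>

section \<open>Potter bounds for slowly varying functions\<close>

text \<open>For fixed \<open>x\<close> the set of shifts \<open>l \<in> [0,2]\<close> along which \<open>h\<close> moves by at least \<open>1/2\<close> has small measure
  once \<open>x\<close> is large, by dominated convergence. The bad sets seen from \<open>x\<close> and from \<open>x + u\<close> together
  cannot cover \<open>[1,2]\<close>, so some point \<open>x + l\<close> is close in value to both \<open>h x\<close> and \<open>h (x + u)\<close>.\<close>

lemma additive_slow_variation_locally_bounded:
  fixes h :: "real \<Rightarrow> real"
  assumes [measurable]: "h \<in> borel_measurable borel"
    and slow: "\<And>u. ((\<lambda>x. h (x + u) - h x) \<longlongrightarrow> 0) at_top"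
  shows "\<exists>X. \<forall>x\<ge>X. \<forall>u\<in>{0..1}. \<bar>h (x + u) - h x\<bar> \<le> 1"
proof -
  define A where "A = (\<lambda>x. {l \<in> {0..2}. \<bar>h (x + l) - h x\<bar> \<ge> 1/2})"
  have A_meas [measurable]: "A x \<in> sets lborel" for x
    unfolding A_def by measurable
  have A_sub: "A x \<subseteq> {0..2}" for x
    by (auto simp: A_def)
  have "((\<lambda>x. \<integral>l. indicator (A x) l \<partial>lborel) \<longlongrightarrow> (\<integral>l. (0::real) \<partial>(lborel :: real measure))) at_top"
  proof (rule integral_dominated_convergence_at_top)
    show "integrable lborel (indicator {0..2::real} :: real \<Rightarrow> real)"
      by simp
    show "AE l in lborel. ((\<lambda>x. indicator (A x) l :: real) \<longlongrightarrow> 0) at_top"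
    proof (rule AE_I2)
      fix l :: real
      have "eventually (\<lambda>x. \<bar>h (x + l) - h x\<bar> < 1/2) at_top"
        using tendstoD[OF slow[of l], of "1/2"] by (simp add: dist_real_def)
      then have "eventually (\<lambda>x. indicator (A x) l = (0::real)) at_top"
        by eventually_elim (auto simp: A_def)
      then show "((\<lambda>x. indicator (A x) l :: real) \<longlongrightarrow> 0) at_top"
        by (rule tendsto_eventually)
    qed
    show "\<forall>\<^sub>F x in at_top. AE l in lborel. norm (indicator (A x) l :: real) \<le> indicator {0..2} l"
      by (auto simp: A_def split: split_indicator)
  qed measurable
  then have "((\<lambda>x. measure lborel (A x)) \<longlongrightarrow> 0) at_top"
    by simp
  then have "eventually (\<lambda>x. measure lborel (A x) < 1/3) at_top"
    by (rule order_tendstoD(2)) simp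
  then obtain X where X: "\<And>x. x \<ge> X \<Longrightarrow> measure lborel (A x) < 1/3"
    by (auto simp: eventually_at_top_linorder)
  have "\<bar>h (x + u) - h x\<bar> \<le> 1" if x: "x \<ge> X" and u: "u \<in> {0..1}" for x u
  proof -
    define B where "B = (\<lambda>l. u + l) ` A (x + u)"
    have B: "B = (\<lambda>l. u + l) ` A (x + u)" by (simp add: B_def)
    have B_alt: "B = (\<lambda>l. l - u) -` A (x + u)"
      unfolding B by (force simp: image_iff)
    have B_meas [measurable]: "B \<in> sets lborel"
      unfolding B_alt using measurable_sets_borel[of "\<lambda>l. l - u" borel "A (x + u)"] A_meas[of "x + u"]
      by simp
    have "measure lborel B = measure lborel (A (x + u))"
    proof -
      have "measure lebesgue B = measure lebesgue (A (x+u))"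
        unfolding B by (rule measure_translation)
      then show ?thesis
        using measure_completion[of B lborel] measure_completion[of "A (x + u)" lborel] B_meas A_meas[of "x + u"] by simp
    qed
    then have mB: "measure lborel B < 1/3"
      using X[of "x + u"] x u by simp
    have "\<not> {1..2} \<subseteq> A x \<union> B"
    proof
      assume sub: "{1..2} \<subseteq> A x \<union> B"
      have Bsub: "B \<subseteq> {0..3}" using u A_sub[of "x+u"] unfolding B by force
      have finAB: "A x \<union> B \<in> fmeasurable lborel"
        by (rule fmeasurableI2[of "{0..3}"]) (use A_sub[of x] Bsub A_meas[of x] B_meas in \<open>auto simp: fmeasurable_def\<close>)
      have "1 = measure lborel {1..2::real}" by simp
      also have "\<dots> \<le> measure lborel (A x \<union> B)"
        by (rule measure_mono_fmeasurable[OF sub]) (use finAB in auto)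
      also have "\<dots> \<le> measure lborel (A x) + measure lborel B"
        by (rule measure_Un_le) measurable
      also have "\<dots> < 1" using X[OF x] mB by simp
      finally show False by simp
    qed
    then obtain l where l: "l \<in> {1..2}" "l \<notin> A x" "l \<notin> B" by blast
    have "\<bar>h (x + l) - h x\<bar> < 1/2" using l by (auto simp: A_def)
    moreover
    have "\<bar>h (x + u + (l - u)) - h (x + u)\<bar> < 1/2"
      using l u unfolding B_alt by (auto simp: A_def)
    then have "\<bar>h (x + l) - h (x + u)\<bar> < 1/2" by simp
    ultimately show ?thesis by linarith
  qed
  then show ?thesis by blast
qed

lemma additive_slow_variation_linear_bound:
  fixes h :: "real \<Rightarrow> real"
  assumes "h \<in> borel_measurable borel"
    and slow: "\<And>u. ((\<lambda>x. h (x + u) - h x) \<longlongrightarrow> 0) at_top"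
    and "\<epsilon> > 0"
  shows "\<exists>X. \<forall>x\<ge>X. \<forall>v\<ge>0. \<bar>h (x + v) - h x\<bar> \<le> 1 + \<epsilon> * v"
proof -
  obtain X1 where X1: "\<And>x u. x \<ge> X1 \<Longrightarrow> u \<in> {0..1} \<Longrightarrow> \<bar>h (x + u) - h x\<bar> \<le> 1"
    using additive_slow_variation_locally_bounded[OF assms(1,2)] by blast
  have "eventually (\<lambda>x. \<bar>h (x + 1) - h x\<bar> < \<epsilon>) at_top"
    using tendstoD[OF slow[of 1] \<open>\<epsilon> > 0\<close>] by (simp add: dist_real_def)
  then obtain X2 where X2: "\<And>x. x \<ge> X2 \<Longrightarrow> \<bar>h (x + 1) - h x\<bar> < \<epsilon>"
    by (auto simp: eventually_at_top_linorder)
  have step: "\<bar>h (x + real k) - h x\<bar> \<le> \<epsilon> * real k" if "x \<ge> X2" for x k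
  proof (induction k)
    case (Suc k)
    have "\<bar>h (x + real k + 1) - h (x + real k)\<bar> < \<epsilon>" using that X2[of "x + real k"] by simp
    with Suc show ?case by (simp add: algebra_simps)
  qed simp
  have "\<bar>h (x + v) - h x\<bar> \<le> 1 + \<epsilon> * v" if x: "x \<ge> max X1 X2" and v: "v \<ge> 0" for x v
  proof -
    define k where "k = nat \<lfloor>v\<rfloor>"
    have k: "real k \<le> v" "v - real k \<in> {0..1}" using v unfolding k_def by (auto; linarith)+
    have "\<bar>h (x + real k + (v - real k)) - h (x + real k)\<bar> \<le> 1"
      by (rule X1) (use x k in auto)
    moreover have "\<bar>h (x + real k) - h x\<bar> \<le> \<epsilon> * real k" using step x by simp
    moreover have "\<epsilon> * real k \<le> \<epsilon> * v" using k \<open>\<epsilon> > 0\<close> by simp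
    ultimately show ?thesis by (simp add: algebra_simps)
  qed
  then show ?thesis by blast
qed

text \<open>The function \<open>h x = ln (L (exp x))\<close> turns multiplicative slow variation into the additive one. Bounding its
  increments by \<open>1 + \<epsilon> v\<close> is Potter's inequality with the constant \<open>exp 1\<close>, which is all that a
  dominating function needs.\<close>

lemma potter_bound:
  assumes L: "slowly_varying L" and \<epsilon>: "\<epsilon> > 0"
  shows "\<exists>x1>0. \<forall>x\<ge>x1. \<forall>y\<ge>x1. 0 < L x \<and>
    L y \<le> L x * (exp 1 * ((y / x) powr \<epsilon> + (x / y) powr \<epsilon>))"
proof -
  obtain x0 where x0: "x0 > 0" "L \<in> borel_measurable (restrict_space borel {x0..})"
    "\<And>x. x \<ge> x0 \<Longrightarrow> L x > 0" and lim: "\<And>c. c > 0 \<Longrightarrow> ((\<lambda>x. L (c * x) / L x) \<longlongrightarrow> 1) at_top"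
    using L unfolding slowly_varying_def by blast
  \<comment> \<open>Only the behaviour at infinity counts, so \<open>L\<close> may be replaced below \<open>x0\<close> by a
    value that makes it measurable everywhere.\<close>
  define L' where "L' = (\<lambda>x. if x \<in> {x0..} then L x else 1)"
  have L'_meas [measurable]: "L' \<in> borel_measurable borel"
    unfolding L'_def by (rule measurable_restrict_space_iff[THEN iffD1, rotated 2]) (use x0 in auto)
  define h where "h = (\<lambda>x. ln (L' (exp x)))"
  have [measurable]: "h \<in> borel_measurable borel" unfolding h_def by measurable
  have slow: "((\<lambda>x. h (x + u) - h x) \<longlongrightarrow> 0) at_top" for u
  proof -
    have "((\<lambda>x. L (exp u * x) / L x) \<longlongrightarrow> 1) at_top" by (rule lim) simp
    then have "((\<lambda>x. L (exp u * exp x) / L (exp x)) \<longlongrightarrow> 1) at_top"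
      by (rule filterlim_compose[OF _ exp_at_top])
    then have "((\<lambda>x. ln (L (exp u * exp x) / L (exp x))) \<longlongrightarrow> ln 1) at_top"
      by (rule tendsto_ln) simp
    moreover have "eventually (\<lambda>x. ln (L (exp u * exp x) / L (exp x)) = h (x + u) - h x) at_top"
      using eventually_ge_at_top[of "ln x0"] eventually_ge_at_top[of "ln x0 - u"]
    proof eventually_elim
      case (elim x)
      have e: "exp x \<ge> x0" "exp (x + u) \<ge> x0" using elim x0(1) by (metis exp_le_cancel_iff exp_ln, smt (verit) exp_le_cancel_iff exp_ln)
      then show ?case using x0(3)[OF e(1)] x0(3)[OF e(2)]
        by (simp add: h_def L'_def ln_div exp_add mult.commute)
    qed
    ultimately show ?thesis by (simp add: filterlim_cong)
  qed
  obtain X where X: "\<And>x v. x \<ge> X \<Longrightarrow> v \<ge> 0 \<Longrightarrow> \<bar>h (x + v) - h x\<bar> \<le> 1 + \<epsilon> * v"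
    using additive_slow_variation_linear_bound[OF _ slow \<epsilon>] by auto
  define x1 where "x1 = max x0 (exp X)"
  have hL: "h (ln x) = ln (L x)" if "x \<ge> x1" for x
    using that x0 by (auto simp: h_def L'_def x1_def)
  have "0 < L x \<and> L y \<le> L x * (exp 1 * ((y / x) powr \<epsilon> + (x / y) powr \<epsilon>))"
    if x: "x \<ge> x1" and y: "y \<ge> x1" for x y
  proof
    have pos: "x > 0" "y > 0" "L x > 0" "L y > 0"
      using x y x0 by (auto simp: x1_def intro: less_le_trans)
    show "0 < L x" by fact
    have ge: "ln x \<ge> X" "ln y \<ge> X" using x y pos by (auto simp: x1_def ln_ge_iff)
    have "\<bar>h (ln y) - h (ln x)\<bar> \<le> 1 + \<epsilon> * \<bar>ln (y / x)\<bar>"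
    proof (cases "x \<le> y")
      case True
      then have "ln x \<le> ln y" using pos by simp
      then show ?thesis using X[of "ln x" "ln y - ln x"] ge pos by (simp add: ln_div)
    next
      case False
      then have "ln y \<le> ln x" using pos by simp
      then show ?thesis using X[of "ln y" "ln x - ln y"] ge pos by (simp add: ln_div abs_minus_commute)
    qed
    then have "ln (L y) \<le> ln (L x) + (1 + \<epsilon> * \<bar>ln (y / x)\<bar>)"
      using hL x y by auto
    then have "exp (ln (L y)) \<le> exp (ln (L x) + (1 + \<epsilon> * \<bar>ln (y / x)\<bar>))" by simp
    then have "L y \<le> L x * (exp 1 * exp (\<epsilon> * \<bar>ln (y / x)\<bar>))" using pos by (simp add: exp_add)
    also have "exp (\<epsilon> * \<bar>ln (y / x)\<bar>) \<le> (y / x) powr \<epsilon> + (x / y) powr \<epsilon>"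
      using pos by (cases "x \<le> y") (simp_all add: powr_def ln_div abs_if)
    finally show "L y \<le> L x * (exp 1 * ((y / x) powr \<epsilon> + (x / y) powr \<epsilon>))"
      using pos by simp
  qed
  moreover have "x1 > 0" using x0 by (simp add: x1_def)
  ultimately show ?thesis by blast
qed

text \<open>Potter's bound with exponent \<open>\<delta> / 2\<close> against the fixed base point \<open>x1\<close>, in both directions.\<close>

lemma slowly_varying_powr_limits:
  assumes L: "slowly_varying L" and d: "\<delta> > 0"
  shows "((\<lambda>x. L x * x powr (-\<delta>)) \<longlongrightarrow> 0) at_top"
    and "filterlim (\<lambda>x. x powr \<delta> * L x) at_top at_top"
proof -
  obtain x1 where x1: "x1 > 0" and P: "\<And>x y. x \<ge> x1 \<Longrightarrow> y \<ge> x1 \<Longrightarrow> 0 < L x \<and>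
    L y \<le> L x * (exp 1 * ((y / x) powr (\<delta>/2) + (x / y) powr (\<delta>/2)))"
    using potter_bound[OF L, of "\<delta>/2"] d by auto
  define C where "C = L x1 * exp 1"
  have Lx1: "L x1 > 0" using P[of x1 x1] by simp
  have C: "C > 0" using Lx1 by (simp add: C_def)
  show "((\<lambda>x. L x * x powr (-\<delta>)) \<longlongrightarrow> 0) at_top"
  proof (rule Lim_null_comparison)
    show "\<forall>\<^sub>F x in at_top. norm (L x * x powr - \<delta>) \<le>
        C * ((x / x1) powr (\<delta>/2) + (x1 / x) powr (\<delta>/2)) * x powr - \<delta>"
      using eventually_ge_at_top[of x1]
    proof eventually_elim
      case (elim x)
      then show ?case using P[of x1 x] P[of x x1] by (auto simp: C_def abs_mult mult.assoc[symmetric] intro!: mult_right_mono)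
    qed
    have e: "\<forall>\<^sub>F x in at_top. C * (x1 powr (-\<delta>/2) * x powr (-\<delta>/2) + x1 powr (\<delta>/2) * x powr (-3*\<delta>/2)) =
        C * ((x / x1) powr (\<delta>/2) + (x1 / x) powr (\<delta>/2)) * x powr - \<delta>"
      using eventually_gt_at_top[of 0]
    proof eventually_elim
      case (elim x)
      have "(x powr (\<delta>/2)) ^ 3 = x powr (3*\<delta>/2)" "(x powr (\<delta>/2)) ^ 2 = x powr \<delta>"
        using elim by (simp_all add: power3_eq_cube power2_eq_square flip: powr_add)
      then have r: "x powr (-3*\<delta>/2) = inverse ((x powr (\<delta>/2)) ^ 3)" "x powr (-\<delta>) = inverse ((x powr (\<delta>/2)) ^ 2)"
        "x powr (-\<delta>/2) = inverse (x powr (\<delta>/2))" "x1 powr (-\<delta>/2) = inverse (x1 powr (\<delta>/2))"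
        using elim x1 by (simp_all flip: powr_minus)
      show ?case unfolding r using x1 elim
        by (simp add: powr_divide field_simps power2_eq_square power3_eq_cube)
    qed
    have "((\<lambda>x. C * (x1 powr (-\<delta>/2) * x powr (-\<delta>/2) + x1 powr (\<delta>/2) * x powr (-3*\<delta>/2))) \<longlongrightarrow>
       C * (x1 powr (-\<delta>/2) * 0 + x1 powr (\<delta>/2) * 0)) at_top"
      using d by (intro tendsto_intros tendsto_neg_powr filterlim_ident) auto
    then show "((\<lambda>x. C * ((x / x1) powr (\<delta>/2) + (x1 / x) powr (\<delta>/2)) * x powr - \<delta>) \<longlongrightarrow> 0) at_top"
      using filterlim_cong[OF refl refl e] by simp
  qed
  show "filterlim (\<lambda>x. x powr \<delta> * L x) at_top at_top"
  proof (rule filterlim_at_top_mono)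
    have "filterlim (\<lambda>x::real. (x powr (\<delta>/2))) at_top at_top"
      using d by real_asymp
    moreover have "C / (2 * (exp 1)\<^sup>2) * x1 powr (\<delta>/2) > 0" using C x1 by simp
    ultimately show "filterlim (\<lambda>x. C / (2 * (exp 1)\<^sup>2) * x1 powr (\<delta>/2) * x powr (\<delta>/2)) at_top at_top"
      by (intro filterlim_tendsto_pos_mult_at_top[OF tendsto_const])
    show "\<forall>\<^sub>F x in at_top. C / (2 * (exp 1)\<^sup>2) * x1 powr (\<delta>/2) * x powr (\<delta>/2) \<le> x powr \<delta> * L x"
      using eventually_ge_at_top[of x1]
    proof eventually_elim
      case (elim x)
      have Lx: "L x > 0" and "L x1 \<le> L x * (exp 1 * ((x1 / x) powr (\<delta>/2) + (x / x1) powr (\<delta>/2)))"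
        using P[of x x1] elim by auto
      note this(2)
      also have "(x1 / x) powr (\<delta>/2) \<le> (x / x1) powr (\<delta>/2)"
        using elim x1 d mult_mono[of x1 x x1 x] by (intro powr_mono2) (auto simp: field_simps)
      finally have "L x1 \<le> L x * (exp 1 * ((x / x1) powr (\<delta>/2) + (x / x1) powr (\<delta>/2)))"
        using Lx by simp
      then have "L x1 * x1 powr (\<delta>/2) \<le> 2 * exp 1 * (L x * x powr (\<delta>/2))"
        using x1 elim by (simp add: powr_divide field_simps)
      then have "L x1 * x1 powr (\<delta>/2) * x powr (\<delta>/2) \<le> 2 * exp 1 * (L x * x powr (\<delta>/2)) * x powr (\<delta>/2)"
        by (intro mult_right_mono) auto
      also have "\<dots> = 2 * exp 1 * (L x * x powr \<delta>)" using elim x1 by (simp flip: powr_add)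
      finally show ?case
        by (simp add: C_def field_simps power2_eq_square)
    qed
  qed
qed

section \<open>The characteristic function of a symmetric variable at the origin\<close>

text \<open>For symmetric \<open>X\<close> this is one minus the characteristic function.\<close>

definition char_defect :: "'a measure \<Rightarrow> ('a \<Rightarrow> real) \<Rightarrow> real \<Rightarrow> real" where
  "char_defect M X s = (\<integral>\<omega>. 1 - cos (s * X \<omega>) \<partial>M)"

lemma char_defect_minus [simp]: "char_defect M X (- s) = char_defect M X s"
  by (simp add: char_defect_def)

lemma char_defect_abs: "char_defect M X \<bar>s\<bar> = char_defect M X s"
  by (simp add: abs_if)

context prob_space
begin

lemma
  assumes [measurable]: "X \<in> borel_measurable M"
  shows char_defect_nonneg: "0 \<le> char_defect M X s"
    and char_defect_le_2: "char_defect M X s \<le> 2"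
    and char_defect_eq: "char_defect M X s = 1 - (\<integral>\<omega>. cos (s * X \<omega>) \<partial>M)"
    and isCont_char_defect: "isCont (char_defect M X) s"
proof -
  have int: "integrable M (\<lambda>\<omega>. cos (s * X \<omega>))" for s
    by (rule integrable_const_bound[where B = 1]) auto
  show "0 \<le> char_defect M X s"
    unfolding char_defect_def by (rule integral_nonneg_AE) auto
  have "char_defect M X s \<le> (\<integral>\<omega>. 2 \<partial>M)"
    unfolding char_defect_def
  proof (rule integral_mono)
    show "1 - cos (s * X \<omega>) \<le> 2" for \<omega> using cos_ge_minus_one[of "s * X \<omega>"] by linarith
  qed (use int in auto)
  then show "char_defect M X s \<le> 2" by (simp add: prob_space)
  show "char_defect M X s = 1 - (\<integral>\<omega>. cos (s * X \<omega>) \<partial>M)"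
    unfolding char_defect_def using int by (simp add: prob_space)
  show "isCont (char_defect M X) s"
    unfolding continuous_at_sequentially
  proof safe
    fix u :: "nat \<Rightarrow> real" assume u: "u \<longlonglongrightarrow> s"
    show "(char_defect M X \<circ> u) \<longlonglongrightarrow> char_defect M X s"
      unfolding char_defect_def o_def
    proof (rule integral_dominated_convergence[where w = "\<lambda>_. 2"])
      show "AE \<omega> in M. (\<lambda>n. 1 - cos (u n * X \<omega>)) \<longlonglongrightarrow> 1 - cos (s * X \<omega>)"
        by (intro AE_I2 tendsto_intros u)
      show "AE \<omega> in M. norm (1 - cos (u n * X \<omega>)) \<le> 2" for n
        using abs_triangle_ineq4[of 1 "cos (u n * X _)"] abs_cos_le_one[of "u n * X _"]
        by (intro AE_I2) (smt (verit) real_norm_def)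
    qed auto
  qed
qed

lemma borel_measurable_char_defect [measurable]:
  assumes "X \<in> borel_measurable M"
  shows "char_defect M X \<in> borel_measurable borel"
  using isCont_char_defect[OF assms]
  by (intro borel_measurable_continuous_onI continuous_at_imp_continuous_on) auto

lemma char_symmetric_eq:
  assumes X: "symmetric_rv M X"
  shows "(\<integral>\<omega>. iexp (s * X \<omega>) \<partial>M) = complex_of_real (1 - char_defect M X s)"
proof -
  have [measurable]: "X \<in> borel_measurable M" and eq: "distr M borel (\<lambda>\<omega>. - X \<omega>) = distr M borel X"
    using X by (auto simp: symmetric_rv_def)
  have "(\<integral>\<omega>. sin (s * X \<omega>) \<partial>M) = (\<integral>x. sin (s * x) \<partial>distr M borel X)"
    by (subst integral_distr) auto
  also have "\<dots> = (\<integral>x. sin (s * x) \<partial>distr M borel (\<lambda>\<omega>. - X \<omega>))"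
    by (simp add: eq)
  also have "\<dots> = (\<integral>\<omega>. sin (s * - X \<omega>) \<partial>M)"
    by (subst integral_distr) auto
  finally have sin0: "(\<integral>\<omega>. sin (s * X \<omega>) \<partial>M) = 0" by simp
  have c: "integrable M (\<lambda>\<omega>. cos (s * X \<omega>))"
    by (rule integrable_const_bound[where B = 1]) auto
  have s: "integrable M (\<lambda>\<omega>. sin (s * X \<omega>))"
    by (rule integrable_const_bound[where B = 1]) auto
  have "(\<integral>\<omega>. iexp (s * X \<omega>) \<partial>M) =
    (\<integral>\<omega>. complex_of_real (cos (s * X \<omega>)) + \<i> * complex_of_real (sin (s * X \<omega>)) \<partial>M)"
    unfolding cis_conv_exp[symmetric] by (intro Bochner_Integration.integral_cong refl) (simp add: complex_eq_iff)
  also have "\<dots> = complex_of_real (\<integral>\<omega>. cos (s * X \<omega>) \<partial>M) + \<i> * complex_of_real (\<integral>\<omega>. sin (s * X \<omega>) \<partial>M)"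
    using c s by (subst Bochner_Integration.integral_add) (auto simp: integral_complex_of_real complex_of_real_integrable_eq)
  finally show ?thesis by (simp add: sin0 char_defect_eq)
qed

text \<open>\<open>(1 - cos (s X)) / s\<^sup>2\<close> converges to \<open>X\<^sup>2 / 2\<close> and never exceeds it.\<close>

lemma char_defect_asymp_finite_variance:
  assumes X [measurable]: "X \<in> borel_measurable M" and var: "integrable M (\<lambda>\<omega>. (X \<omega>)\<^sup>2)"
  shows "((\<lambda>s. char_defect M X s / s\<^sup>2) \<longlongrightarrow> expectation (\<lambda>\<omega>. (X \<omega>)\<^sup>2) / 2) (at 0)"
  unfolding tendsto_at_iff_sequentially
proof safe
  fix u :: "nat \<Rightarrow> real" assume u0: "\<forall>i. u i \<in> UNIV - {0}" and u: "u \<longlonglongrightarrow> 0"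
  have half: "1 - cos y = 2 * (sin (y/2))\<^sup>2" for y :: real
    using cos_double_sin[of "y/2"] by simp
  have "(\<lambda>n. \<integral>\<omega>. (1 - cos (u n * X \<omega>)) / (u n)\<^sup>2 \<partial>M) \<longlonglongrightarrow> (\<integral>\<omega>. (X \<omega>)\<^sup>2 / 2 \<partial>M)"
  proof (rule integral_dominated_convergence[where w = "\<lambda>\<omega>. (X \<omega>)\<^sup>2 / 2"])
    show "AE \<omega> in M. (\<lambda>n. (1 - cos (u n * X \<omega>)) / (u n)\<^sup>2) \<longlonglongrightarrow> (X \<omega>)\<^sup>2 / 2"
    proof (rule AE_I2)
      fix \<omega>
      define x where "x = X \<omega>"
      have "((\<lambda>s. sin (s * x / 2)) has_real_derivative x / 2) (at 0)"
        by (auto intro!: derivative_eq_intros)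
      then have "((\<lambda>s. sin (s * x / 2) / s) \<longlongrightarrow> x / 2) (at 0)"
        by (simp only: DERIV_def) simp
      then have "(\<lambda>n. sin (u n * x / 2) / u n) \<longlonglongrightarrow> x / 2"
        using u0 u unfolding tendsto_at_iff_sequentially by (auto simp: o_def)
      then have "(\<lambda>n. 2 * (sin (u n * x / 2) / u n)\<^sup>2) \<longlonglongrightarrow> 2 * (x / 2)\<^sup>2"
        by (intro tendsto_mult tendsto_power tendsto_const)
      then show "(\<lambda>n. (1 - cos (u n * X \<omega>)) / (u n)\<^sup>2) \<longlonglongrightarrow> (X \<omega>)\<^sup>2 / 2"
        by (simp add: half power_divide x_def)
    qed
    show "AE \<omega> in M. norm ((1 - cos (u n * X \<omega>)) / (u n)\<^sup>2) \<le> (X \<omega>)\<^sup>2 / 2" for n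
    proof (rule AE_I2)
      fix \<omega>
      have "(sin (u n * X \<omega> / 2))\<^sup>2 \<le> (u n * X \<omega> / 2)\<^sup>2"
        using abs_sin_x_le_abs_x[of "u n * X \<omega> / 2"] by (simp only: abs_le_square_iff)
      then show "norm ((1 - cos (u n * X \<omega>)) / (u n)\<^sup>2) \<le> (X \<omega>)\<^sup>2 / 2"
        using u0 by (simp add: half divide_simps power_mult_distrib mult.commute)
    qed
  qed (use var in auto)
  then show "((\<lambda>s. char_defect M X s / s\<^sup>2) \<circ> u) \<longlonglongrightarrow> expectation (\<lambda>\<omega>. (X \<omega>)\<^sup>2) / 2"
    by (simp add: char_defect_def o_def)
qed

end

lemma set_integrable_powr_Ioc_0:
  fixes a R :: real
  assumes "a > -1" "R \<ge> 0"
  shows "set_integrable lborel {0<..R} (\<lambda>x. x powr a)"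
proof -
  have "(\<lambda>x. x powr a) absolutely_integrable_on {0..R}"
    by (rule nonnegative_absolutely_integrable_1)
      (use has_integral_powr_from_0[OF assms] in \<open>auto simp: integrable_on_def\<close>)
  then have "set_integrable lebesgue {0<..R} (\<lambda>x. x powr a)"
    by (rule set_integrable_subset) auto
  then show ?thesis
    unfolding set_integrable_def by (subst (asm) integrable_completion) auto
qed

lemma set_integrable_powr_Ioi:
  fixes a R :: real
  assumes "a < -1" "R > 0"
  shows "set_integrable lborel {R<..} (\<lambda>x. x powr a)"
proof -
  have "(\<lambda>x. x powr a) absolutely_integrable_on {R..}"
    by (rule nonnegative_absolutely_integrable_1)
      (use has_integral_powr_to_inf[OF assms] in \<open>auto simp: integrable_on_def\<close>)
  then have "set_integrable lebesgue {R<..} (\<lambda>x. x powr a)"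
    by (rule set_integrable_subset) auto
  then show ?thesis
    unfolding set_integrable_def by (subst (asm) integrable_completion) auto
qed

text \<open>An interchange of limits in which the existence of the outer limit of \<open>v\<close> is part of the
  conclusion: two approximations \<open>V R\<close> and \<open>V R'\<close> are both close to \<open>U\<close>, hence to each other, which makes
  \<open>v\<close> Cauchy. It yields the convergence of the improper integral in \<open>C_stable\<close> without
  integrating by parts.\<close>

lemma limits_of_uniform_approximation:
  fixes U :: "'a \<Rightarrow> real" and V :: "real \<Rightarrow> 'a \<Rightarrow> real"
  assumes F: "F \<noteq> bot" and b: "(b \<longlongrightarrow> 0) at_top"
    and V: "\<And>R. R > 0 \<Longrightarrow> (V R \<longlongrightarrow> v R) F"
    and UV: "\<And>R. R > 0 \<Longrightarrow> eventually (\<lambda>s. \<bar>U s - V R s\<bar> \<le> b R) F"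
  shows "\<exists>l. (v \<longlongrightarrow> l) at_top \<and> (U \<longlongrightarrow> l) F"
proof -
  have vv: "\<bar>v R - v R'\<bar> \<le> b R + b R'" if R: "R > 0" "R' > 0" for R R'
  proof (rule tendsto_upperbound[OF _ _ F])
    show "((\<lambda>s. \<bar>V R s - V R' s\<bar>) \<longlongrightarrow> \<bar>v R - v R'\<bar>) F"
      using V R by (intro tendsto_intros) auto
    show "eventually (\<lambda>s. \<bar>V R s - V R' s\<bar> \<le> b R + b R') F"
      using UV[OF R(1)] UV[OF R(2)] by eventually_elim linarith
  qed
  have bn: "(\<lambda>n. b (real (Suc n))) \<longlonglongrightarrow> 0"
    by (rule filterlim_compose[OF b filterlim_compose[OF filterlim_real_sequentially filterlim_Suc]])
  have "Cauchy (\<lambda>n. v (real (Suc n)))"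
  proof (rule metric_CauchyI)
    fix e :: real assume e: "e > 0"
    have "eventually (\<lambda>n. b (real (Suc n)) < e/2) sequentially"
      using bn e by (intro order_tendstoD(2)) auto
    then obtain n0 where "\<And>n. n \<ge> n0 \<Longrightarrow> b (real (Suc n)) < e/2"
      by (auto simp: eventually_sequentially)
    then show "\<exists>n0. \<forall>m\<ge>n0. \<forall>n\<ge>n0. dist (v (real (Suc m))) (v (real (Suc n))) < e"
      using vv by (intro exI[of _ n0]) (auto simp: dist_real_def, smt (verit) of_nat_0_le_iff field_sum_of_halves)
  qed
  then obtain l where l: "(\<lambda>n. v (real (Suc n))) \<longlonglongrightarrow> l"
    by (auto simp: Cauchy_convergent_iff convergent_def)
  have vl: "\<bar>v R - l\<bar> \<le> b R" if R: "R > 0" for R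
  proof (rule tendsto_le[OF sequentially_bot])
    show "(\<lambda>n. b R + b (real (Suc n))) \<longlonglongrightarrow> b R"
      using tendsto_add[OF tendsto_const[of "b R"] bn] by simp
    show "(\<lambda>n. \<bar>v R - v (real (Suc n))\<bar>) \<longlonglongrightarrow> \<bar>v R - l\<bar>"
      by (intro tendsto_intros l)
    show "eventually (\<lambda>n. \<bar>v R - v (real (Suc n))\<bar> \<le> b R + b (real (Suc n))) sequentially"
      using vv[OF R] by auto
  qed
  have "(v \<longlongrightarrow> l) at_top"
  proof (rule Lim_null[THEN iffD2], rule Lim_null_comparison[OF _ b])
    show "eventually (\<lambda>R. norm (v R - l) \<le> b R) at_top"
      using eventually_gt_at_top[of 0] by eventually_elim (use vl in auto)
  qed
  moreover have "(U \<longlongrightarrow> l) F"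
  proof (rule tendstoI)
    fix e :: real assume e: "e > 0"
    have "eventually (\<lambda>R. b R < e/3 \<and> R > 0) at_top"
      using e by (intro eventually_conj order_tendstoD(2)[OF b] eventually_gt_at_top) auto
    then obtain R where R: "b R < e/3" "R > 0" using eventually_happens'[OF trivial_limit_at_top_linorder, of "\<lambda>R. b R < e/3 \<and> R > 0"] by auto
    have "eventually (\<lambda>s. dist (V R s) (v R) < e/3) F"
      using V[OF R(2)] e by (intro tendstoD) auto
    with UV[OF R(2)] show "eventually (\<lambda>s. dist (U s) l < e) F"
    proof eventually_elim
      case (elim s)
      have "U s - l = (U s - V R s) + (V R s - v R) + (v R - l)" by simp
      then show ?case using elim vl[OF R(2)] R(1) unfolding dist_real_def by linarith
    qed
  qed
  ultimately show ?thesis by blast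
qed

context prob_space
begin

lemma heavy_tail_bound:
  assumes [measurable]: "X \<in> borel_measurable M"
    and tail: "(\<lambda>x. prob {\<omega> \<in> space M. \<bar>X \<omega>\<bar> > x}) \<sim>[at_top] (\<lambda>x. c * x powr (-\<alpha>))"
    and \<alpha>: "\<alpha> > 0" and c: "c > 0"
  shows "\<exists>K>0. \<forall>x>0. prob {\<omega> \<in> space M. \<bar>X \<omega>\<bar> > x} \<le> K * x powr (-\<alpha>)"
proof -
  define G where "G = (\<lambda>x. prob {\<omega> \<in> space M. \<bar>X \<omega>\<bar> > x})"
  have "eventually (\<lambda>x. c * x powr (-\<alpha>) \<noteq> 0) at_top"
    using eventually_gt_at_top[of 0] by eventually_elim (use c in auto)
  then have "((\<lambda>x. G x / (c * x powr (-\<alpha>))) \<longlongrightarrow> 1) at_top"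
    using tail unfolding G_def by (intro asymp_equivD_strong) (auto elim: eventually_mono)
  then have "eventually (\<lambda>x. G x / (c * x powr (-\<alpha>)) < 2) at_top"
    by (rule order_tendstoD) simp
  then have "eventually (\<lambda>x. G x / (c * x powr (-\<alpha>)) < 2 \<and> x > 0) at_top"
    using eventually_gt_at_top[of 0] by eventually_elim auto
  then obtain x0' where x0': "\<And>x. x \<ge> x0' \<Longrightarrow> G x / (c * x powr (-\<alpha>)) < 2 \<and> x > 0"
    by (auto simp: eventually_at_top_linorder)
  define x0 where "x0 = max x0' 1"
  define K where "K = max (2 * c) (x0 powr \<alpha>)"
  have "G x \<le> K * x powr (-\<alpha>)" if x: "x > 0" for x
  proof (cases "x \<ge> x0")
    case True
    then have "G x / (c * x powr (-\<alpha>)) < 2" using x0' by (simp add: x0_def)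
    then have "G x \<le> 2 * c * x powr (-\<alpha>)" using x c by (simp add: divide_simps split: if_splits)
    also have "\<dots> \<le> K * x powr (-\<alpha>)" by (intro mult_right_mono) (auto simp: K_def)
    finally show ?thesis .
  next
    case False
    have "G x \<le> 1" by (simp add: G_def)
    also have "1 \<le> x0 powr \<alpha> * x powr (-\<alpha>)"
      using x False \<alpha> by (simp add: powr_minus field_simps powr_mono2)
    also have "\<dots> \<le> K * x powr (-\<alpha>)" by (intro mult_right_mono) (auto simp: K_def)
    finally show ?thesis .
  qed
  moreover have "K > 0" using c by (simp add: K_def)
  ultimately show ?thesis unfolding G_def by blast
qed

text \<open>Fubini applied to \<open>1 - cos (min z R) = \<integral> sin y dy\<close> over \<open>0 < y < min z R\<close>. Truncating at \<open>R\<close> keeps the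
  integral absolutely convergent for every tail exponent.\<close>

lemma expectation_truncated_cos:
  assumes X [measurable]: "X \<in> borel_measurable M" and R: "R > 0" and s: "s > 0"
  shows "(\<integral>\<omega>. 1 - cos (min (s * \<bar>X \<omega>\<bar>) R) \<partial>M) =
    (LBINT y:{0<..R}. sin y * prob {\<omega> \<in> space M. \<bar>X \<omega>\<bar> > y / s})"
proof -
  interpret pair_sigma_finite M lborel ..
  have eq: "(\<integral>y. indicator {0<..R} y * (sin y * indicator {..<z} y) \<partial>lborel) = 1 - cos (min z R)"
    if z: "z \<ge> 0" for z :: real
  proof -
    have "has_bochner_integral lborel (\<lambda>x. sin x * indicator {0..min z R} x) (- cos (min z R) - (- cos 0))"
      by (rule has_bochner_integral_FTC_Icc_real) (use z R in \<open>auto intro!: derivative_eq_intros continuous_intros\<close>)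
    then have "(\<integral>x. sin x * indicator {0..min z R} x \<partial>lborel) = 1 - cos (min z R)"
      by (simp add: has_bochner_integral_iff)
    also have "(\<integral>x. sin x * indicator {0..min z R} x \<partial>lborel) =
       (\<integral>y. indicator {0<..R} y * (sin y * indicator {..<z} y) \<partial>lborel)"
    proof (rule integral_cong_AE)
      have "AE x in lborel. x \<noteq> (0::real)" "AE x in lborel. x \<noteq> z" by (rule AE_lborel_singleton)+
      then show "AE x in lborel. sin x * indicator {0..min z R} x = indicator {0<..R} x * (sin x * indicator {..<z} x)"
        by eventually_elim (auto split: split_indicator)
    qed auto
    finally show ?thesis by simp
  qed
  have [measurable]: "(\<lambda>x. indicator {..<s * \<bar>X (fst x)\<bar>} (snd x) :: real) \<in> borel_measurable (M \<Otimes>\<^sub>M lborel)"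
    unfolding indicator_def lessThan_iff by measurable
  have int: "integrable (M \<Otimes>\<^sub>M lborel) (\<lambda>(\<omega>, y). indicator {0<..R} y * (sin y * indicator {..<s * \<bar>X \<omega>\<bar>} y))"
  proof (rule Bochner_Integration.integrable_bound)
    have "emeasure (M \<Otimes>\<^sub>M lborel) (space M \<times> {0<..R}) = ennreal R"
      using R by (subst lborel.emeasure_pair_measure_Times) (auto simp: emeasure_space_1)
    then show "integrable (M \<Otimes>\<^sub>M lborel) (indicator (space M \<times> {0<..R}) :: _ \<Rightarrow> real)"
      by (intro integrable_real_indicator) auto
    show "AE x in M \<Otimes>\<^sub>M lborel. norm (case x of (\<omega>, y) \<Rightarrow> indicator {0<..R} y * (sin y * indicator {..<s * \<bar>X \<omega>\<bar>} y))
       \<le> norm (indicator (space M \<times> {0<..R}) x :: real)"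
      by (intro AE_I2) (auto simp: space_pair_measure indicator_def)
  qed measurable
  have "(\<integral>\<omega>. 1 - cos (min (s * \<bar>X \<omega>\<bar>) R) \<partial>M) =
     (\<integral>\<omega>. (\<integral>y. indicator {0<..R} y * (sin y * indicator {..<s * \<bar>X \<omega>\<bar>} y) \<partial>lborel) \<partial>M)"
    using s by (subst eq) auto
  also have "\<dots> = (\<integral>y. (\<integral>\<omega>. indicator {0<..R} y * (sin y * indicator {..<s * \<bar>X \<omega>\<bar>} y) \<partial>M) \<partial>lborel)"
    by (rule Fubini_integral[OF int, symmetric])
  also have "\<dots> = (LBINT y:{0<..R}. sin y * prob {\<omega> \<in> space M. \<bar>X \<omega>\<bar> > y / s})"
    unfolding set_lebesgue_integral_def
  proof (intro Bochner_Integration.integral_cong refl)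
    fix y
    have "(\<integral>\<omega>. indicator {..<s * \<bar>X \<omega>\<bar>} y \<partial>M :: real) = (\<integral>\<omega>. indicator {\<omega> \<in> space M. \<bar>X \<omega>\<bar> > y / s} \<omega> \<partial>M)"
      using s by (intro Bochner_Integration.integral_cong refl) (auto split: split_indicator simp: field_simps)
    then show "(\<integral>\<omega>. indicator {0<..R} y * (sin y * indicator {..<s * \<bar>X \<omega>\<bar>} y) \<partial>M) =
      indicator {0<..R} y *\<^sub>R (sin y * prob {\<omega> \<in> space M. \<bar>X \<omega>\<bar> > y / s})"
      by simp
  qed
  finally show ?thesis .
qed

text \<open>Truncate the cosine at level \<open>R\<close>. For fixed \<open>R\<close> the truncated expectation, divided by \<open>s powr \<alpha>\<close>, converges
  to \<open>c\<close> times the integral of \<open>y powr (-\<alpha>) sin y\<close> over \<open>(0, R]\<close> by dominated convergence; \<open>\<alpha> < 2\<close> makes the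
  majorant \<open>y powr (1 - \<alpha>)\<close> integrable at 0. The truncation error is at most twice the probability of
  \<open>s \<bar>X\<bar> > R\<close>, that is, of order \<open>R powr (-\<alpha>)\<close> uniformly in \<open>s\<close>.\<close>

lemma char_defect_asymp_heavy_tail:
  assumes X [measurable]: "X \<in> borel_measurable M"
    and tail: "(\<lambda>x. prob {\<omega> \<in> space M. \<bar>X \<omega>\<bar> > x}) \<sim>[at_top] (\<lambda>x. c * x powr (-\<alpha>))"
    and \<alpha>: "0 < \<alpha>" "\<alpha> < 2" and c: "c > 0"
  shows "((\<lambda>s. char_defect M X s / \<bar>s\<bar> powr \<alpha>) \<longlongrightarrow> c / C_stable \<alpha>) (at 0)"
proof -
  define G where "G = (\<lambda>x. prob {\<omega> \<in> space M. \<bar>X \<omega>\<bar> > x})"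
  have [measurable]: "G \<in> borel_measurable borel"
  proof -
    have "(\<lambda>y. \<integral>\<omega>. (if \<bar>X \<omega>\<bar> > y then 1 else 0 :: real) \<partial>M) \<in> borel_measurable (borel :: real measure)"
      by (rule borel_measurable_lebesgue_integral) measurable
    also have "(\<lambda>y. \<integral>\<omega>. (if \<bar>X \<omega>\<bar> > y then 1 else 0 :: real) \<partial>M) = (\<lambda>y. \<integral>\<omega>. indicator {\<omega> \<in> space M. \<bar>X \<omega>\<bar> > y} \<omega> \<partial>M)"
      by (intro ext Bochner_Integration.integral_cong refl) auto
    also have "\<dots> = G" unfolding G_def by auto
    finally show ?thesis .
  qed
  obtain K where K: "K > 0" "\<And>x. x > 0 \<Longrightarrow> G x \<le> K * x powr (-\<alpha>)"
    using heavy_tail_bound[OF X tail \<alpha>(1) c] unfolding G_def by blast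
  have G_nonneg: "G x \<ge> 0" for x by (simp add: G_def)
  define J where "J = (\<lambda>R. LBINT x:{0<..R}. x powr (-\<alpha>) * sin x)"
  define U where "U = (\<lambda>s. char_defect M X s / \<bar>s\<bar> powr \<alpha>)"
  define V where "V = (\<lambda>R s. (\<integral>\<omega>. 1 - cos (min (s * \<bar>X \<omega>\<bar>) R) \<partial>M) / \<bar>s\<bar> powr \<alpha>)"
  have G_scaled: "((\<lambda>s. G (y / s) / s powr \<alpha>) \<longlongrightarrow> c * y powr (-\<alpha>)) (at_right 0)" if y: "y > 0" for y
  proof -
    have "eventually (\<lambda>x. c * x powr (-\<alpha>) \<noteq> 0) at_top"
      using eventually_gt_at_top[of 0] by eventually_elim (use c in auto)
    then have "((\<lambda>x. G x / (c * x powr (-\<alpha>))) \<longlongrightarrow> 1) at_top"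
      using tail unfolding G_def by (intro asymp_equivD_strong) (auto elim: eventually_mono)
    moreover have "filterlim (\<lambda>s. y / s) at_top (at_right 0)"
      using filterlim_tendsto_pos_mult_at_top[OF tendsto_const y filterlim_inverse_at_top_right]
      by (simp add: divide_inverse)
    ultimately have "((\<lambda>s. G (y / s) / (c * (y / s) powr (-\<alpha>))) \<longlongrightarrow> 1) (at_right 0)"
      by (rule filterlim_compose)
    from tendsto_mult[OF this tendsto_const[of "c * y powr (-\<alpha>)"]]
    have *: "((\<lambda>s. G (y / s) / (c * (y / s) powr (-\<alpha>)) * (c * y powr (-\<alpha>))) \<longlongrightarrow> c * y powr (-\<alpha>)) (at_right 0)"
      by simp
    have "eventually (\<lambda>s. s > (0::real)) (at_right 0)" by (simp add: eventually_at_right_less)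
    then have cong: "eventually (\<lambda>s. G (y / s) / (c * (y / s) powr (-\<alpha>)) * (c * y powr (-\<alpha>)) = G (y / s) / s powr \<alpha>) (at_right 0)"
      by eventually_elim (use y c in \<open>simp add: powr_divide powr_minus field_simps\<close>)
    show ?thesis using * filterlim_cong[OF refl refl cong] by blast
  qed
  have V_lim: "(V R \<longlongrightarrow> c * J R) (at_right 0)" if R: "R > 0" for R
    unfolding tendsto_at_iff_sequentially
  proof safe
    fix u :: "nat \<Rightarrow> real" assume u0: "\<forall>i. u i \<in> {0<..} - {0}" and u: "u \<longlonglongrightarrow> 0"
    have upos: "u n > 0" for n using u0 by auto
    have "(\<lambda>n. \<integral>y. indicator {0<..R} y * (sin y * (G (y / u n) / u n powr \<alpha>)) \<partial>lborel) \<longlonglongrightarrow>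
       (\<integral>y. indicator {0<..R} y * (sin y * (c * y powr (-\<alpha>))) \<partial>lborel)"
    proof (rule integral_dominated_convergence[where w = "\<lambda>y. K * (indicator {0<..R} y *\<^sub>R y powr (1 - \<alpha>))"])
      show "integrable lborel (\<lambda>y. K * (indicator {0<..R} y *\<^sub>R y powr (1 - \<alpha>)))"
        using set_integrable_powr_Ioc_0[of "1 - \<alpha>" R] \<alpha> R by (simp add: set_integrable_def)
      show "AE y in lborel. (\<lambda>n. indicator {0<..R} y * (sin y * (G (y / u n) / u n powr \<alpha>))) \<longlonglongrightarrow>
         indicator {0<..R} y * (sin y * (c * y powr (-\<alpha>)))"
      proof (rule AE_I2)
        fix y :: real
        show "(\<lambda>n. indicator {0<..R} y * (sin y * (G (y / u n) / u n powr \<alpha>))) \<longlonglongrightarrow>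
         indicator {0<..R} y * (sin y * (c * y powr (-\<alpha>)))"
        proof (cases "y > 0")
          case True
          have "(\<lambda>n. G (y / u n) / u n powr \<alpha>) \<longlonglongrightarrow> c * y powr (-\<alpha>)"
            using G_scaled[OF True] u0 u unfolding tendsto_at_iff_sequentially by (auto simp: o_def)
          then show ?thesis by (intro tendsto_intros)
        qed auto
      qed
      show "AE y in lborel. norm (indicator {0<..R} y * (sin y * (G (y / u n) / u n powr \<alpha>))) \<le>
         K * (indicator {0<..R} y *\<^sub>R y powr (1 - \<alpha>))" for n
      proof (rule AE_I2)
        fix y :: real
        show "norm (indicator {0<..R} y * (sin y * (G (y / u n) / u n powr \<alpha>))) \<le>
         K * (indicator {0<..R} y *\<^sub>R y powr (1 - \<alpha>))"
        proof (cases "y > 0")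
          case True
          have "G (y / u n) / u n powr \<alpha> \<le> K * (y / u n) powr (-\<alpha>) / u n powr \<alpha>"
            using K(2)[of "y / u n"] True upos[of n] by (intro divide_right_mono) auto
          also have "\<dots> = K * y powr (-\<alpha>)"
            using True upos[of n] by (simp add: powr_divide powr_minus field_simps)
          finally have 1: "G (y / u n) / u n powr \<alpha> \<le> K * y powr (-\<alpha>)" .
          have "\<bar>sin y\<bar> \<le> y" using abs_sin_x_le_abs_x[of y] True by simp
          then have "\<bar>sin y\<bar> * (G (y / u n) / u n powr \<alpha>) \<le> y * (K * y powr (-\<alpha>))"
            using 1 G_nonneg True by (intro mult_mono) auto
          also have "\<dots> = K * y powr (1 - \<alpha>)"
            using True by (simp add: powr_diff powr_minus field_simps)
          finally show ?thesis using G_nonneg by (auto simp: abs_mult split: split_indicator)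
        qed auto
      qed
    qed measurable
    moreover have "(\<integral>y. indicator {0<..R} y * (sin y * (c * y powr (-\<alpha>))) \<partial>lborel) = c * J R"
      unfolding J_def set_lebesgue_integral_def integral_mult_right_zero[symmetric]
      by (intro Bochner_Integration.integral_cong) (auto simp: mult_ac)
    moreover have "(\<integral>y. indicator {0<..R} y * (sin y * (G (y / u n) / u n powr \<alpha>)) \<partial>lborel) = V R (u n)" for n
    proof -
      have "V R (u n) = (LBINT y:{0<..R}. sin y * G (y / u n)) / u n powr \<alpha>"
        unfolding V_def G_def using expectation_truncated_cos[OF X R upos[of n]] upos[of n] by simp
      also have "\<dots> = (\<integral>y. indicator {0<..R} y * (sin y * (G (y / u n) / u n powr \<alpha>)) \<partial>lborel)"
        unfolding set_lebesgue_integral_def integral_divide_zero[symmetric]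
        by (intro Bochner_Integration.integral_cong) auto
      finally show ?thesis ..
    qed
    ultimately show "(V R \<circ> u) \<longlonglongrightarrow> c * J R" by (simp add: o_def)
  qed
  have UV: "\<bar>U s - V R s\<bar> \<le> 2 * K * R powr (-\<alpha>)" if R: "R > 0" and s: "s > 0" for R s
  proof -
    let ?c = "\<lambda>\<omega>. cos (min (s * \<bar>X \<omega>\<bar>) R)"
    let ?T = "\<integral>\<omega>. 1 - ?c \<omega> \<partial>M"
    have i1: "integrable M (\<lambda>\<omega>. cos (s * X \<omega>))"
      by (rule integrable_const_bound[where B = 1]) auto
    have i2: "integrable M (\<lambda>\<omega>. ?c \<omega>)"
      by (rule integrable_const_bound[where B = 1]) auto
    have "\<bar>char_defect M X s - ?T\<bar> =
       \<bar>\<integral>\<omega>. ?c \<omega> - cos (s * X \<omega>) \<partial>M\<bar>"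
      unfolding char_defect_def using i1 i2 by simp
    also have "\<dots> \<le> (\<integral>\<omega>. \<bar>?c \<omega> - cos (s * X \<omega>)\<bar> \<partial>M)"
      by (rule integral_abs_bound)
    also have "\<dots> \<le> (\<integral>\<omega>. 2 * indicator {\<omega> \<in> space M. \<bar>X \<omega>\<bar> > R / s} \<omega> \<partial>M)"
    proof (rule integral_mono)
      show "integrable M (\<lambda>\<omega>. \<bar>?c \<omega> - cos (s * X \<omega>)\<bar>)" using i1 i2 by auto
      show "integrable M (\<lambda>\<omega>. 2 * indicator {\<omega> \<in> space M. \<bar>X \<omega>\<bar> > R / s} \<omega> :: real)"
        by (intro integrable_mult_right integrable_const_bound[where B = 1]) (auto split: split_indicator)
      fix \<omega> assume w: "\<omega> \<in> space M"
      show "\<bar>?c \<omega> - cos (s * X \<omega>)\<bar> \<le> 2 * indicator {\<omega> \<in> space M. \<bar>X \<omega>\<bar> > R / s} \<omega>"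
      proof (cases "\<bar>X \<omega>\<bar> > R / s")
        case True
        have "\<bar>?c \<omega> - cos (s * X \<omega>)\<bar> \<le> \<bar>?c \<omega>\<bar> + \<bar>cos (s * X \<omega>)\<bar>"
          by (rule abs_triangle_ineq4)
        also have "\<dots> \<le> 1 + 1" by (intro add_mono abs_cos_le_one)
        finally show ?thesis using True w by simp
      next
        case False
        then have "min (s * \<bar>X \<omega>\<bar>) R = s * \<bar>X \<omega>\<bar>" using s by (simp add: field_simps min_def)
        also have "cos (s * \<bar>X \<omega>\<bar>) = cos (s * X \<omega>)" by (simp add: abs_if)
        finally show ?thesis using \<open>min _ _ = _\<close> by (simp add: abs_if)
      qed
    qed
    also have "\<dots> = 2 * G (R / s)"
      by (simp add: G_def)
    also have "\<dots> \<le> 2 * (K * (R / s) powr (-\<alpha>))"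
      using K(2)[of "R / s"] R s by simp
    also have "\<dots> = 2 * K * R powr (-\<alpha>) * s powr \<alpha>"
      using R s by (simp add: powr_divide powr_minus field_simps)
    finally have "\<bar>char_defect M X s - ?T\<bar> \<le> 2 * K * R powr (-\<alpha>) * s powr \<alpha>" .
    then have "\<bar>char_defect M X s - ?T\<bar> / s powr \<alpha> \<le> 2 * K * R powr (-\<alpha>)"
      using s by (simp add: pos_divide_le_eq)
    also have "\<bar>char_defect M X s - ?T\<bar> / s powr \<alpha> = \<bar>U s - V R s\<bar>"
      using s by (simp add: U_def V_def diff_divide_distrib[symmetric] abs_divide)
    finally show ?thesis .
  qed
  have "\<exists>l. ((\<lambda>R. c * J R) \<longlongrightarrow> l) at_top \<and> (U \<longlongrightarrow> l) (at_right 0)"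
  proof (rule limits_of_uniform_approximation[where V = V])
    show "((\<lambda>R. 2 * K * R powr (-\<alpha>)) \<longlongrightarrow> 0) at_top"
      by (rule tendsto_eq_intros tendsto_neg_powr filterlim_ident refl | use \<alpha> in simp)+
    show "eventually (\<lambda>s. \<bar>U s - V R s\<bar> \<le> 2 * K * R powr (-\<alpha>)) (at_right 0)" if "R > 0" for R
      using eventually_at_right_less[of 0] by eventually_elim (use UV that in auto)
  qed (use V_lim in auto)
  then obtain l where l: "((\<lambda>R. c * J R) \<longlongrightarrow> l) at_top" "(U \<longlongrightarrow> l) (at_right 0)" by blast
  have "((\<lambda>R. inverse c * (c * J R)) \<longlongrightarrow> inverse c * l) at_top"
    by (intro tendsto_intros l)
  moreover have "(\<lambda>R. inverse c * (c * J R)) = J"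
    using c by (intro ext) (simp flip: mult.assoc)
  ultimately have "(J \<longlongrightarrow> inverse c * l) at_top" by simp
  then have "Lim at_top J = inverse c * l" by (intro tendsto_Lim) auto
  then have "c / C_stable \<alpha> = l"
    using c \<alpha> unfolding C_stable_def J_def by (simp add: divide_inverse)
  moreover have "(U \<longlongrightarrow> l) (at 0)"
  proof -
    have "filterlim (\<lambda>s::real. \<bar>s\<bar>) (at_right 0) (at 0)"
      unfolding filterlim_at by (auto simp: eventually_at_filter intro!: tendsto_eq_intros)
    from filterlim_compose[OF l(2) this] show ?thesis
      by (simp add: U_def char_defect_abs)
  qed
  ultimately show ?thesis by (simp add: U_def)
qed

text \<open>Near the origin this is the asymptotics; away from it \<open>\<bar>s\<bar> powr \<alpha>\<close> is bounded below and the defect is at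
  most 2.\<close>

lemma char_defect_le_powr:
  assumes X: "X \<in> borel_measurable M" and \<alpha>: "\<alpha> > 0"
    and lim: "((\<lambda>s. char_defect M X s / \<bar>s\<bar> powr \<alpha>) \<longlongrightarrow> l) (at 0)"
  shows "\<exists>K>0. \<forall>s. char_defect M X s \<le> K * \<bar>s\<bar> powr \<alpha>"
proof -
  have "eventually (\<lambda>s. char_defect M X s / \<bar>s\<bar> powr \<alpha> < \<bar>l\<bar> + 1) (at 0)"
    using lim by (rule order_tendstoD) simp
  then obtain \<delta> where \<delta>: "\<delta> > 0" "\<And>s. s \<noteq> 0 \<Longrightarrow> \<bar>s\<bar> < \<delta> \<Longrightarrow> char_defect M X s / \<bar>s\<bar> powr \<alpha> < \<bar>l\<bar> + 1"
    by (auto simp: eventually_at dist_real_def)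
  define K where "K = max (\<bar>l\<bar> + 1) (2 / \<delta> powr \<alpha>)"
  have "char_defect M X s \<le> K * \<bar>s\<bar> powr \<alpha>" for s
  proof (cases "s = 0")
    case True
    then show ?thesis by (simp add: char_defect_def)
  next
    case s: False
    show ?thesis
    proof (cases "\<bar>s\<bar> < \<delta>")
      case True
      have "char_defect M X s \<le> (\<bar>l\<bar> + 1) * \<bar>s\<bar> powr \<alpha>"
        using \<delta>(2)[OF s True] s by (simp add: pos_divide_less_eq)
      also have "\<dots> \<le> K * \<bar>s\<bar> powr \<alpha>" by (intro mult_right_mono) (auto simp: K_def)
      finally show ?thesis .
    next
      case False
      have "char_defect M X s \<le> 2" by (rule char_defect_le_2[OF X])
      also have "2 \<le> 2 / \<delta> powr \<alpha> * \<bar>s\<bar> powr \<alpha>"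
        using False \<delta>(1) \<alpha> by (simp add: field_simps powr_mono2)
      also have "\<dots> \<le> K * \<bar>s\<bar> powr \<alpha>" by (intro mult_right_mono) (auto simp: K_def)
      finally show ?thesis .
    qed
  qed
  moreover have "K > 0" by (simp add: K_def less_max_iff_disj add_nonneg_pos)
  ultimately show ?thesis by blast
qed

end

section \<open>Parities of Bernoulli sums and of the Poisson process\<close>

text \<open>Among ordered times \<open>T 1 \<le> \<dots> \<le> T r\<close>, the increment of a counting process over \<open>(T l, T (l + 1)]\<close> enters
  the counts at the \<open>r - l\<close> times \<open>T (l + 1), \<dots>, T r\<close>. In the product of the signs of all \<open>r\<close> counts, exactly the
  increments with \<open>r - l\<close> odd survive.\<close>

definition odd_gaps :: "nat \<Rightarrow> nat set" where
  "odd_gaps r = {l. l < r \<and> odd (r - l)}"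

lemma finite_odd_gaps [simp]: "finite (odd_gaps r)"
  by (simp add: odd_gaps_def)

text \<open>The two largest times pair up to the sign of the last increment, and the other times are handled by
  induction.\<close>

lemma alternating_sign_prod:
  fixes T :: "nat \<Rightarrow> nat"
  assumes "T 0 = 0" and mono: "\<And>l. l < r \<Longrightarrow> T l \<le> T (Suc l)"
  shows "(\<Prod>i<r. (-1::real) ^ T (Suc i)) = (\<Prod>l\<in>odd_gaps r. (-1) ^ (T (Suc l) - T l))"
  using mono
proof (induction r rule: induct_nat_012)
  case 0
  then show ?case by (simp add: odd_gaps_def)
next
  case 1
  have "odd_gaps (Suc 0) = {0}" by (auto simp: odd_gaps_def)
  then show ?case using \<open>T 0 = 0\<close> by simp
next
  case (ge2 r)
  have "odd_gaps (Suc (Suc r)) = insert (Suc r) (odd_gaps r)"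
    by (auto simp: odd_gaps_def less_Suc_eq Suc_diff_le)
  moreover have "Suc r \<notin> odd_gaps r" by (simp add: odd_gaps_def)
  moreover have "(-1::real) ^ T (Suc r) * (-1) ^ T (Suc (Suc r)) = (-1) ^ (T (Suc (Suc r)) - T (Suc r))"
  proof -
    have "T (Suc (Suc r)) = T (Suc r) + (T (Suc (Suc r)) - T (Suc r))" using ge2.prems[of "Suc r"] by simp
    then have "(-1::real) ^ T (Suc (Suc r)) = (-1) ^ T (Suc r) * (-1) ^ (T (Suc (Suc r)) - T (Suc r))"
      by (metis power_add)
    then show ?thesis by (simp flip: mult.assoc power_mult_distrib)
  qed
  ultimately show ?case
    using ge2.IH(1) ge2.prems by (simp add: mult.assoc mult.commute)
qed

definition grid :: "('i \<Rightarrow> 'n::zero) \<Rightarrow> 'i list \<Rightarrow> nat \<Rightarrow> 'n" where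
  "grid v ks i = (case i of 0 \<Rightarrow> 0 | Suc j \<Rightarrow> v (ks ! j))"

lemma grid_simps [simp]: "grid v ks 0 = 0" "grid v ks (Suc j) = v (ks ! j)"
  by (simp_all add: grid_def)

lemma prod_set_list_eq:
  assumes "distinct ks"
  shows "(\<Prod>k\<in>set ks. f k) = (\<Prod>i<length ks. f (ks ! i))"
  using prod.reindex_bij_betw[OF bij_betw_nth[OF assms refl refl]] by (metis (no_types))

lemma grid_mono:
  fixes v :: "'i \<Rightarrow> 'n::{linorder, zero}"
  assumes "sorted (map v ks)" "\<And>k. k \<in> set ks \<Longrightarrow> 0 \<le> v k" "i \<le> j" "j \<le> length ks"
  shows "grid v ks i \<le> grid v ks j"
proof (cases i)
  case 0
  then show ?thesis using assms by (cases j) auto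
next
  case (Suc i')
  then obtain j' where "j = Suc j'" using assms by (cases j) auto
  then show ?thesis using sorted_nth_mono[OF assms(1), of i' j'] assms Suc by simp
qed

text \<open>The expectation of \<open>F\<close> under the law of \<open>n\<close> independent Bernoulli variables with parameter \<open>x\<close>, as a
  finite sum and therefore a polynomial in \<open>x\<close>.\<close>

definition bernoulli_mean :: "nat \<Rightarrow> real \<Rightarrow> ((nat \<Rightarrow> nat) \<Rightarrow> real) \<Rightarrow> real" where
  "bernoulli_mean n x F =
     (\<Sum>b\<in>(\<Pi>\<^sub>E j\<in>{1..n}. {0, 1}). (\<Prod>j\<in>{1..n}. x ^ b j * (1 - x) ^ (1 - b j)) * F b)"

lemma bernoulli_mean_sum:
  "bernoulli_mean n x (\<lambda>b. \<Sum>i\<in>I. c i * F i b) = (\<Sum>i\<in>I. c i * bernoulli_mean n x (F i))"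
proof -
  have "bernoulli_mean n x (\<lambda>b. \<Sum>i\<in>I. c i * F i b) =
    (\<Sum>b\<in>(\<Pi>\<^sub>E j\<in>{1..n}. {0, 1}). \<Sum>i\<in>I. c i * ((\<Prod>j\<in>{1..n}. x ^ b j * (1 - x) ^ (1 - b j)) * F i b))"
    unfolding bernoulli_mean_def by (intro sum.cong refl) (simp add: sum_distrib_left mult.left_commute)
  also have "\<dots> = (\<Sum>i\<in>I. c i * bernoulli_mean n x (F i))"
    unfolding bernoulli_mean_def by (subst sum.swap) (simp only: sum_distrib_left)
  finally show ?thesis .
qed

lemma bernoulli_mean_prod:
  "bernoulli_mean n x (\<lambda>b. \<Prod>j\<in>{1..n}. f j (b j)) = (\<Prod>j\<in>{1..n}. (1 - x) * f j 0 + x * f j 1)"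
proof -
  have "bernoulli_mean n x (\<lambda>b. \<Prod>j\<in>{1..n}. f j (b j)) =
    (\<Sum>b\<in>(\<Pi>\<^sub>E j\<in>{1..n}. {0, 1}). \<Prod>j\<in>{1..n}. x ^ b j * (1 - x) ^ (1 - b j) * f j (b j))"
    unfolding bernoulli_mean_def by (simp only: prod.distrib)
  also have "\<dots> = (\<Prod>j\<in>{1..n}. \<Sum>v\<in>{0, 1}. x ^ v * (1 - x) ^ (1 - v) * f j v)"
    by (subst prod_sum_PiE) auto
  finally show ?thesis by simp
qed

lemma bernoulli_mean_mono:
  assumes "0 \<le> x" "x \<le> 1" "\<And>b. F b \<le> G b"
  shows "bernoulli_mean n x F \<le> bernoulli_mean n x G"
  unfolding bernoulli_mean_def
  using assms by (intro sum_mono mult_left_mono prod_nonneg) auto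

lemma bernoulli_mean_diff:
  "bernoulli_mean n x (\<lambda>b. F b - G b) = bernoulli_mean n x F - bernoulli_mean n x G"
  by (simp add: bernoulli_mean_def right_diff_distrib sum_subtractf)

lemma bernoulli_mean_const: "bernoulli_mean n x (\<lambda>_. c) = c"
proof -
  have "bernoulli_mean n x (\<lambda>_. c) = bernoulli_mean n x (\<lambda>_. 1) * c"
    by (simp add: bernoulli_mean_def sum_distrib_right)
  also have "bernoulli_mean n x (\<lambda>_. 1) = 1"
    using bernoulli_mean_prod[of n x "\<lambda>_ _. 1"] by simp
  finally show ?thesis by simp
qed

lemma bernoulli_mean_sign:
  assumes "U \<subseteq> {1..n}"
  shows "bernoulli_mean n x (\<lambda>b. \<Prod>j\<in>U. (-1) ^ b j) = (1 - 2 * x) ^ card U"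
proof -
  have U: "{1..n} \<inter> U = U" "{1..n} \<inter> - U = {1..n} - U" using assms by auto
  have "(\<Prod>j\<in>U. (-1) ^ b j) = (\<Prod>j\<in>{1..n}. if j \<in> U then (-1::real) ^ b j else 1)" for b :: "nat \<Rightarrow> nat"
    by (subst prod.If_cases) (simp_all add: U[simplified])
  then have "bernoulli_mean n x (\<lambda>b. \<Prod>j\<in>U. (-1) ^ b j) =
    (\<Prod>j\<in>{1..n}. (1 - x) * (if j \<in> U then (-1) ^ 0 else 1) + x * (if j \<in> U then (-1) ^ 1 else 1))"
    by (simp only: bernoulli_mean_prod[of n x "\<lambda>j v. if j \<in> U then (-1) ^ v else 1"])
  also have "\<dots> = (\<Prod>j\<in>{1..n}. if j \<in> U then 1 - 2 * x else 1)"
    by (intro prod.cong) auto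
  also have "\<dots> = (1 - 2 * x) ^ card U"
    by (subst prod.If_cases) (simp_all add: U[simplified])
  finally show ?thesis .
qed

text \<open>The surviving increments run over disjoint blocks of indices, and each index in them contributes the
  factor \<open>E (-1)\<^sup>b = 1 - 2 x\<close>.\<close>

lemma bernoulli_mean_partial_sum_signs:
  fixes \<kappa> :: "'i \<Rightarrow> nat"
  assumes ks: "distinct ks" "sorted (map \<kappa> ks)" and le: "\<And>k. k \<in> set ks \<Longrightarrow> \<kappa> k \<le> n"
  shows "bernoulli_mean n x (\<lambda>b. \<Prod>k\<in>set ks. (-1) ^ (\<Sum>j=1..\<kappa> k. b j)) =
    (\<Prod>l\<in>odd_gaps (length ks). (1 - 2 * x) ^ (grid \<kappa> ks (Suc l) - grid \<kappa> ks l))"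
proof -
  let ?r = "length ks"
  define T where "T = grid \<kappa> ks"
  have mono: "T i \<le> T j" if "i \<le> j" "j \<le> ?r" for i j
    unfolding T_def using ks(2) that by (intro grid_mono) auto
  have Tn: "T i \<le> n" if "i \<le> ?r" for i
    using that le by (cases i) (auto simp: T_def)
  define U where "U = (\<Union>l\<in>odd_gaps ?r. {T l<..T (Suc l)})"
  have disj: "\<forall>i\<in>odd_gaps ?r. \<forall>j\<in>odd_gaps ?r. i \<noteq> j \<longrightarrow> {T i<..T (Suc i)} \<inter> {T j<..T (Suc j)} = {}"
  proof (intro ballI impI)
    have *: "{T i<..T (Suc i)} \<inter> {T j<..T (Suc j)} = {}" if "i < j" "j < ?r" for i j
      using mono[of "Suc i" j] that by auto
    fix i j assume "i \<in> odd_gaps ?r" "j \<in> odd_gaps ?r" "i \<noteq> j"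
    then show "{T i<..T (Suc i)} \<inter> {T j<..T (Suc j)} = {}"
      using *[of i j] *[of j i] by (cases "i < j") (auto simp: odd_gaps_def)
  qed
  have "(\<Prod>k\<in>set ks. (-1::real) ^ (\<Sum>j=1..\<kappa> k. b j)) = (\<Prod>j\<in>U. (-1) ^ b j)" for b :: "nat \<Rightarrow> nat"
  proof -
    define S where "S = (\<lambda>i. \<Sum>j=1..T i. b j)"
    have S_diff: "S (Suc l) - S l = (\<Sum>j\<in>{T l<..T (Suc l)}. b j)" if "l < ?r" for l
    proof -
      have "{1..T (Suc l)} = {1..T l} \<union> {T l<..T (Suc l)}" using mono[of l "Suc l"] that by auto
      then have "S (Suc l) = S l + (\<Sum>j\<in>{T l<..T (Suc l)}. b j)"
        unfolding S_def by (simp only:) (subst sum.union_disjoint, auto)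
      then show ?thesis by simp
    qed
    have S_mono: "S l \<le> S (Suc l)" if "l < ?r" for l
      unfolding S_def using mono[of l "Suc l"] that by (intro sum_mono2) auto
    have "(\<Prod>k\<in>set ks. (-1::real) ^ (\<Sum>j=1..\<kappa> k. b j)) = (\<Prod>i<?r. (-1) ^ S (Suc i))"
      unfolding prod_set_list_eq[OF ks(1)] by (simp add: S_def T_def)
    also have "\<dots> = (\<Prod>l\<in>odd_gaps ?r. (-1) ^ (S (Suc l) - S l))"
      by (rule alternating_sign_prod) (use S_mono in \<open>auto simp: S_def T_def\<close>)
    also have "\<dots> = (\<Prod>l\<in>odd_gaps ?r. \<Prod>j\<in>{T l<..T (Suc l)}. (-1) ^ b j)"
      by (intro prod.cong refl) (simp add: S_diff odd_gaps_def power_sum)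
    also have "\<dots> = (\<Prod>j\<in>U. (-1) ^ b j)"
      unfolding U_def by (rule prod.UNION_disjoint[symmetric]) (use disj in auto)
    finally show ?thesis .
  qed
  moreover have "U \<subseteq> {1..n}" unfolding U_def
  proof safe
    fix l j assume "l \<in> odd_gaps ?r" "j \<in> {T l<..T (Suc l)}"
    then show "j \<in> {1..n}" using Tn[of "Suc l"] by (auto simp: odd_gaps_def)
  qed
  ultimately have "bernoulli_mean n x (\<lambda>b. \<Prod>k\<in>set ks. (-1) ^ (\<Sum>j=1..\<kappa> k. b j)) = (1 - 2 * x) ^ card U"
    by (simp add: bernoulli_mean_sign)
  also have "card U = (\<Sum>l\<in>odd_gaps ?r. card {T l<..T (Suc l)})"
    unfolding U_def by (rule card_UN_disjoint) (use disj in auto)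
  finally show ?thesis by (simp add: power_sum T_def)
qed

lemma poisson_sign_mean:
  assumes "\<mu> > 0"
  shows "(\<integral>k. (-1) ^ k \<partial>measure_pmf (poisson_pmf \<mu>)) = (exp (- 2 * \<mu>) :: real)"
proof -
  define f where "f = (\<lambda>k. pmf (poisson_pmf \<mu>) k * (-1) ^ k)"
  have feq: "f k = exp (-\<mu>) * ((-\<mu>) ^ k /\<^sub>R fact k)" for k
    using assms by (simp add: f_def pmf_poisson power_minus[of \<mu>] divide_inverse)
  have "(\<integral>k. (-1) ^ k \<partial>measure_pmf (poisson_pmf \<mu>)) = (\<integral>k. f k \<partial>count_space UNIV)"
    unfolding measure_pmf_eq_density f_def by (subst integral_density) auto
  moreover have "f sums (\<integral>k. f k \<partial>count_space UNIV)"
  proof (rule sums_integral_count_space_nat)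
    have "summable (\<lambda>k. exp (-\<mu>) * (norm ((-\<mu>) ^ k /\<^sub>R fact k)))"
      by (intro summable_mult summable_norm_exp)
    then show "integrable (count_space UNIV) f"
      unfolding integrable_count_space_nat_iff feq by (simp add: abs_mult)
  qed
  moreover have "f sums (exp (-\<mu>) * exp (-\<mu>))"
    unfolding feq by (intro sums_mult exp_converges)
  ultimately have "(\<integral>k. (-1) ^ k \<partial>measure_pmf (poisson_pmf \<mu>)) = exp (-\<mu>) * exp (-\<mu>)"
    using sums_unique2 by metis
  then show ?thesis by (simp flip: exp_add)
qed

lemma std_poisson_increment_sign_mean:
  assumes N: "std_poisson_process W N" and s: "0 \<le> s" "s \<le> t"
  shows "(\<integral>\<omega>. (-1) ^ (N t \<omega> - N s \<omega>) \<partial>W) = (exp (- 2 * (t - s)) :: real)"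
proof (cases "s = t")
  case True
  interpret prob_space W using N by (simp add: std_poisson_process_def)
  show ?thesis using True by (simp add: prob_space)
next
  case False
  have [measurable]: "N t \<in> W \<rightarrow>\<^sub>M count_space UNIV" "N s \<in> W \<rightarrow>\<^sub>M count_space UNIV"
    and d: "distr W (count_space UNIV) (\<lambda>\<omega>. N t \<omega> - N s \<omega>) = measure_pmf (poisson_pmf (t - s))"
    using N False s by (auto simp: std_poisson_process_def)
  have "(\<integral>\<omega>. (-1) ^ (N t \<omega> - N s \<omega>) \<partial>W) = (\<integral>k. (-1::real) ^ k \<partial>distr W (count_space UNIV) (\<lambda>\<omega>. N t \<omega> - N s \<omega>))"
    by (subst integral_distr) auto
  also have "\<dots> = exp (- 2 * (t - s))"
    unfolding d using s False by (intro poisson_sign_mean) simp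
  finally show ?thesis .
qed

text \<open>The Poisson counterpart: a surviving increment over a time span \<open>s\<close> contributes \<open>exp (-2 s)\<close>.\<close>

lemma poisson_partial_sum_signs:
  assumes N: "std_poisson_process W N" and u: "u \<ge> 0"
    and ks: "distinct ks" "sorted (map t ks)" and t: "\<And>k. k \<in> set ks \<Longrightarrow> 0 \<le> t k"
  shows "(\<integral>\<omega>. (\<Prod>k\<in>set ks. (-1) ^ N (t k * u) \<omega>) \<partial>W) =
    (\<Prod>l\<in>odd_gaps (length ks). exp (- 2 * u * (grid t ks (Suc l) - grid t ks l)))"
proof -
  interpret prob_space W using N by (simp add: std_poisson_process_def)
  let ?r = "length ks"
  \<comment> \<open>The grid is continued as a constant beyond its last point, so that it is monotone everywhere.\<close>
  define g where "g = (\<lambda>i. grid t ks (min i ?r) * u)"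
  have g_mono: "g i \<le> g (Suc i)" for i
    unfolding g_def using ks(2) t u by (intro mult_right_mono grid_mono) auto
  have g0: "g 0 = 0" by (simp add: g_def)
  have g_nonneg: "0 \<le> g i" for i
    using lift_Suc_mono_le[of g 0 i] g_mono g0 by simp
  have mono: "N (g l) \<omega> \<le> N (g (Suc l)) \<omega>" if "\<omega> \<in> space W" for l \<omega>
  proof -
    have "mono_on {0..} (\<lambda>t. N t \<omega>)" using N that by (simp add: std_poisson_process_def)
    from mono_onD[OF this _ _ g_mono[of l]] show ?thesis using g_nonneg by simp
  qed
  have N0: "N 0 \<omega> = 0" if "\<omega> \<in> space W" for \<omega>
    using N that by (simp add: std_poisson_process_def)
  have indep: "indep_vars (\<lambda>_. count_space UNIV) (\<lambda>i \<omega>. N (g (Suc i)) \<omega> - N (g i) \<omega>) {..<?r}"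
    using N g0 g_mono unfolding std_poisson_process_def by auto
  have "(\<integral>\<omega>. (\<Prod>k\<in>set ks. (-1::real) ^ N (t k * u) \<omega>) \<partial>W) =
    (\<integral>\<omega>. (\<Prod>l\<in>odd_gaps ?r. (-1) ^ (N (g (Suc l)) \<omega> - N (g l) \<omega>)) \<partial>W)"
  proof (intro Bochner_Integration.integral_cong refl)
    fix \<omega> assume w: "\<omega> \<in> space W"
    have "(\<Prod>k\<in>set ks. (-1::real) ^ N (t k * u) \<omega>) = (\<Prod>i<?r. (-1) ^ N (g (Suc i)) \<omega>)"
      unfolding prod_set_list_eq[OF ks(1)] by (intro prod.cong) (auto simp: g_def min_def)
    also have "\<dots> = (\<Prod>l\<in>odd_gaps ?r. (-1) ^ (N (g (Suc l)) \<omega> - N (g l) \<omega>))"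
      by (rule alternating_sign_prod[where T = "\<lambda>i. N (g i) \<omega>"]) (use mono N0 w in \<open>auto simp: g0\<close>)
    finally show "(\<Prod>k\<in>set ks. (-1::real) ^ N (t k * u) \<omega>) =
      (\<Prod>l\<in>odd_gaps ?r. (-1) ^ (N (g (Suc l)) \<omega> - N (g l) \<omega>))" .
  qed
  also have "\<dots> = (\<Prod>l\<in>odd_gaps ?r. \<integral>\<omega>. (-1) ^ (N (g (Suc l)) \<omega> - N (g l) \<omega>) \<partial>W)"
  proof (rule indep_vars_lebesgue_integral)
    show ind: "indep_vars (\<lambda>_. borel) (\<lambda>l \<omega>. (-1::real) ^ (N (g (Suc l)) \<omega> - N (g l) \<omega>)) (odd_gaps ?r)"
      by (rule indep_vars_compose2[where Y = "\<lambda>_ k. (-1) ^ k" and X = "\<lambda>l \<omega>. N (g (Suc l)) \<omega> - N (g l) \<omega>" and M' = "\<lambda>_. count_space UNIV"])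
        (auto intro: indep_vars_subset[OF indep] simp: odd_gaps_def)
    show "integrable W (\<lambda>\<omega>. (-1::real) ^ (N (g (Suc l)) \<omega> - N (g l) \<omega>))" if "l \<in> odd_gaps ?r" for l
      by (rule integrable_const_bound[where B = 1])
        (use ind that in \<open>auto simp: indep_vars_def power_abs\<close>)
  qed auto
  also have "\<dots> = (\<Prod>l\<in>odd_gaps ?r. exp (- 2 * u * (grid t ks (Suc l) - grid t ks l)))"
  proof (intro prod.cong refl)
    fix l assume l: "l \<in> odd_gaps ?r"
    have "(\<integral>\<omega>. (-1::real) ^ (N (g (Suc l)) \<omega> - N (g l) \<omega>) \<partial>W) = exp (- 2 * (g (Suc l) - g l))"
      by (rule std_poisson_increment_sign_mean[OF N g_nonneg g_mono])
    also have "g (Suc l) - g l = u * (grid t ks (Suc l) - grid t ks l)"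
      using l by (simp add: g_def odd_gaps_def min_def algebra_simps)
    finally show "(\<integral>\<omega>. (-1::real) ^ (N (g (Suc l)) \<omega> - N (g l) \<omega>) \<partial>W) = exp (- 2 * u * (grid t ks (Suc l) - grid t ks l))"
      by (simp add: mult.assoc)
  qed
  finally show ?thesis .
qed

lemma nat_floor_over_n_tendsto:
  assumes "t \<ge> 0"
  shows "(\<lambda>n. real (nat \<lfloor>real n * t\<rfloor>) / real n) \<longlonglongrightarrow> t"
proof (rule tendsto_sandwich)
  show "eventually (\<lambda>n. t - 1 / real n \<le> real (nat \<lfloor>real n * t\<rfloor>) / real n) sequentially"
    using eventually_gt_at_top[of 0]
  proof eventually_elim
    case (elim n)
    have "t - 1 / real n = (real n * t - 1) / real n" using elim by (simp add: diff_divide_distrib)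
    also have "\<dots> \<le> real (nat \<lfloor>real n * t\<rfloor>) / real n" by (intro divide_right_mono) linarith+
    finally show ?case .
  qed
  show "eventually (\<lambda>n. real (nat \<lfloor>real n * t\<rfloor>) / real n \<le> t) sequentially"
    using eventually_gt_at_top[of 0]
  proof eventually_elim
    case (elim n)
    have "real (nat \<lfloor>real n * t\<rfloor>) \<le> real n * t" using assms by simp
    then show ?case using elim by (simp add: field_simps)
  qed
  show "(\<lambda>n. t - 1 / real n) \<longlonglongrightarrow> t"
    using tendsto_diff[OF tendsto_const[of t] lim_const_over_n[of 1]] by simp
qed simp

lemma tendsto_power_exp:
  fixes k :: "nat \<Rightarrow> nat"
  assumes k: "(\<lambda>n. real (k n) / real n) \<longlonglongrightarrow> c"
  shows "(\<lambda>n. (1 - 2 * (u / real n)) ^ k n) \<longlonglongrightarrow> exp (- 2 * u * c)"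
proof -
  have "(\<lambda>n. real n * ln (1 - 2 * (u / real n))) \<longlonglongrightarrow> - 2 * u"
    by real_asymp
  then have "(\<lambda>n. exp ((real (k n) / real n) * (real n * ln (1 - 2 * (u / real n))))) \<longlonglongrightarrow> exp (c * (- 2 * u))"
    by (intro tendsto_exp tendsto_mult[OF k])
  moreover have "eventually (\<lambda>n. exp ((real (k n) / real n) * (real n * ln (1 - 2 * (u / real n)))) =
     (1 - 2 * (u / real n)) ^ k n) sequentially"
  proof -
    have "eventually (\<lambda>n. 1 - 2 * (u / real n) > 0) sequentially" by real_asymp
    then show ?thesis
      using eventually_gt_at_top[of 0]
    proof eventually_elim
      case (elim n)
      then show ?case by (simp add: exp_of_nat_mult)
    qed
  qed
  ultimately have "(\<lambda>n. (1 - 2 * (u / real n)) ^ k n) \<longlonglongrightarrow> exp (c * (- 2 * u))"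
    by (rule Lim_transform_eventually)
  then show ?thesis by (simp add: mult_ac)
qed

text \<open>Sorting the times makes both sides products over the same gaps, and each factor converges by
  \<open>(1 - 2 u / n) ^ k\<^sub>n \<longlonglongrightarrow> exp (-2 u c)\<close> when \<open>k\<^sub>n / n \<longlonglongrightarrow> c\<close>.\<close>

lemma signs_mean_tendsto:
  assumes N: "std_poisson_process W N" and u: "u \<ge> 0"
    and A: "finite A" and t: "\<And>k. k \<in> A \<Longrightarrow> 0 \<le> t k \<and> t k \<le> 1"
  shows "(\<lambda>n. bernoulli_mean n (u / real n) (\<lambda>b. \<Prod>k\<in>A. (-1) ^ (\<Sum>j=1..nat \<lfloor>real n * t k\<rfloor>. b j)))
    \<longlonglongrightarrow> (\<integral>\<omega>. (\<Prod>k\<in>A. (-1) ^ N (t k * u) \<omega>) \<partial>W)"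
proof -
  obtain xs where xs: "set xs = A" "distinct xs" using finite_distinct_list[OF A] by blast
  define ks where "ks = sort_key t xs"
  have ks: "set ks = A" "distinct ks" "sorted (map t ks)" using xs by (simp_all add: ks_def)
  define \<kappa> where "\<kappa> = (\<lambda>n k. nat \<lfloor>real n * t k\<rfloor>)"
  have \<kappa>_sorted: "sorted (map (\<kappa> n) ks)" for n
    unfolding sorted_iff_nth_mono
  proof safe
    fix i j assume ij: "i \<le> j" "j < length (map (\<kappa> n) ks)"
    then have "t (ks ! i) \<le> t (ks ! j)" using sorted_nth_mono[OF ks(3) ij(1)] by simp
    then show "map (\<kappa> n) ks ! i \<le> map (\<kappa> n) ks ! j"
      using ij by (simp add: \<kappa>_def nat_mono floor_mono mult_left_mono)
  qed
  have \<kappa>_le: "\<kappa> n k \<le> n" if "k \<in> set ks" for n k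
  proof -
    have "real n * t k \<le> real n * 1" using t[of k] that ks(1) by (intro mult_left_mono) auto
    then show ?thesis unfolding \<kappa>_def by linarith
  qed
  have grid_lim: "(\<lambda>n. real (grid (\<kappa> n) ks i) / real n) \<longlonglongrightarrow> grid t ks i" if "i \<le> length ks" for i
  proof (cases i)
    case (Suc j)
    then have "0 \<le> t (ks ! j)" using that t ks(1) nth_mem[of j ks] by auto
    from nat_floor_over_n_tendsto[OF this] show ?thesis using Suc by (simp add: \<kappa>_def)
  qed simp
  have "(\<lambda>n. \<Prod>l\<in>odd_gaps (length ks). (1 - 2 * (u / real n)) ^ (grid (\<kappa> n) ks (Suc l) - grid (\<kappa> n) ks l))
     \<longlonglongrightarrow> (\<Prod>l\<in>odd_gaps (length ks). exp (- 2 * u * (grid t ks (Suc l) - grid t ks l)))"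
  proof (intro tendsto_prod tendsto_power_exp)
    fix l assume l: "l \<in> odd_gaps (length ks)"
    have "(\<lambda>n. real (grid (\<kappa> n) ks (Suc l)) / real n - real (grid (\<kappa> n) ks l) / real n) \<longlonglongrightarrow> grid t ks (Suc l) - grid t ks l"
      using l by (intro tendsto_diff grid_lim) (auto simp: odd_gaps_def)
    moreover have "grid (\<kappa> n) ks l \<le> grid (\<kappa> n) ks (Suc l)" for n
      using l \<kappa>_sorted by (intro grid_mono) (auto simp: odd_gaps_def)
    ultimately show "(\<lambda>n. real (grid (\<kappa> n) ks (Suc l) - grid (\<kappa> n) ks l) / real n) \<longlonglongrightarrow> grid t ks (Suc l) - grid t ks l"
      by (simp add: of_nat_diff diff_divide_distrib)
  qed
  then show ?thesis
    unfolding ks(1)[symmetric]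
    by (subst poisson_partial_sum_signs[OF N u ks(2,3)])
      (use t ks(1) bernoulli_mean_partial_sum_signs[OF ks(2) \<kappa>_sorted \<kappa>_le] in \<open>auto simp: \<kappa>_def\<close>)
qed

text \<open>Fourier expansion on the cube: the indicator of a parity pattern is a fixed linear combination of
  products of signs, obtained by multiplying out \<open>\<Prod>\<^sub>k (1 \<plusminus> (-1) ^ c k) / 2\<close>.\<close>

lemma of_bool_parity_set_eq:
  fixes c :: "nat \<Rightarrow> nat"
  assumes e: "e \<subseteq> I" and I: "finite I"
  shows "of_bool ({k \<in> I. odd (c k)} = e) =
    (\<Sum>A\<in>Pow I. (\<Prod>k\<in>A. if k \<in> e then -1 else 1) / 2 ^ card I * (\<Prod>k\<in>A. (-1::real) ^ c k))"
proof -
  define s where "s = (\<lambda>k. if k \<in> e then -1 else (1::real))"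
  have "(\<Prod>k\<in>I. (s k * (-1) ^ c k + 1) / 2) = of_bool ({k \<in> I. odd (c k)} = e)"
  proof (cases "{k \<in> I. odd (c k)} = e")
    case True
    then have "(s k * (-1) ^ c k + 1) / 2 = 1" if "k \<in> I" for k using that by (auto simp: s_def)
    then show ?thesis using True by simp
  next
    case False
    then obtain k where k: "k \<in> I" "odd (c k) \<noteq> (k \<in> e)" using e by blast
    then have "(s k * (-1) ^ c k + 1) / 2 = 0" by (auto simp: s_def)
    then show ?thesis using False k(1) I by (simp add: prod_zero_iff) (metis)
  qed
  also have "(\<Prod>k\<in>I. (s k * (-1) ^ c k + 1) / 2) = (\<Prod>k\<in>I. s k * (-1) ^ c k + 1) / 2 ^ card I"
    by (simp add: prod_dividef)
  also have "(\<Prod>k\<in>I. s k * (-1) ^ c k + 1) = (\<Sum>A\<in>Pow I. (\<Prod>k\<in>A. s k) * (\<Prod>k\<in>A. (-1) ^ c k))"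
    by (subst prod_add[OF I]) (simp add: prod.distrib)
  finally show ?thesis by (simp add: s_def sum_divide_distrib)
qed

definition parity_set :: "nat \<Rightarrow> (nat \<Rightarrow> nat) \<Rightarrow> nat set" where
  "parity_set d c = {k \<in> {..<d}. odd (c k)}"

lemma parity_set_subset: "parity_set d c \<subseteq> {..<d}"
  by (auto simp: parity_set_def)

definition bernoulli_parity :: "nat \<Rightarrow> (nat \<Rightarrow> nat) \<Rightarrow> nat \<Rightarrow> real \<Rightarrow> nat set \<Rightarrow> real" where
  "bernoulli_parity d \<kappa> n x e = bernoulli_mean n x (\<lambda>b. of_bool (parity_set d (\<lambda>k. \<Sum>j=1..\<kappa> k. b j) = e))"

definition poisson_parity :: "'w measure \<Rightarrow> (real \<Rightarrow> 'w \<Rightarrow> nat) \<Rightarrow> nat \<Rightarrow> (nat \<Rightarrow> real) \<Rightarrow> nat set \<Rightarrow> real" where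
  "poisson_parity W N d \<tau> e = measure W {\<omega> \<in> space W. parity_set d (\<lambda>k. N (\<tau> k) \<omega>) = e}"

lemma std_poisson_process_measurable:
  assumes "std_poisson_process W N" "t \<ge> 0"
  shows "N t \<in> W \<rightarrow>\<^sub>M count_space UNIV"
  using assms by (simp add: std_poisson_process_def)

lemma sets_parity_set_eq:
  assumes [measurable]: "\<And>k. k < d \<Longrightarrow> V k \<in> W \<rightarrow>\<^sub>M count_space UNIV"
  shows "{\<omega> \<in> space W. parity_set d (\<lambda>k. V k \<omega>) = e} \<in> sets W"
proof (cases "e \<subseteq> {..<d}")
  case True
  then have "{\<omega> \<in> space W. parity_set d (\<lambda>k. V k \<omega>) = e} = {\<omega> \<in> space W. \<forall>k\<in>{..<d}. odd (V k \<omega>) = (k \<in> e)}"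
    by (auto simp: parity_set_def)
  also have "\<dots> \<in> sets W"
    by measurable
  finally show ?thesis .
next
  case False
  then have "{\<omega> \<in> space W. parity_set d (\<lambda>k. V k \<omega>) = e} = {}"
    using parity_set_subset by blast
  then show ?thesis by (simp only: sets.empty_sets)
qed

lemma bernoulli_parity_tendsto:
  assumes N: "std_poisson_process W N" and u: "u \<ge> 0"
    and t: "\<And>k. k < d \<Longrightarrow> 0 \<le> t k \<and> t k \<le> 1" and e: "e \<subseteq> {..<d}"
  shows "(\<lambda>n. bernoulli_parity d (\<lambda>k. nat \<lfloor>real n * t k\<rfloor>) n (u / real n) e)
    \<longlonglongrightarrow> poisson_parity W N d (\<lambda>k. t k * u) e"
proof -
  interpret prob_space W using N by (simp add: std_poisson_process_def)
  define w where "w = (\<lambda>A. (\<Prod>k\<in>A. if k \<in> e then -1 else (1::real)) / 2 ^ card {..<d})"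
  have expand: "of_bool (parity_set d c = e) = (\<Sum>A\<in>Pow {..<d}. w A * (\<Prod>k\<in>A. (-1::real) ^ c k))" for c
    unfolding parity_set_def w_def by (rule of_bool_parity_set_eq[OF e]) simp
  have Nm [measurable]: "N (t k * u) \<in> W \<rightarrow>\<^sub>M count_space UNIV" if "k < d" for k
    using std_poisson_process_measurable[OF N] t[OF that] u by simp
  have int: "integrable W (\<lambda>\<omega>. \<Prod>k\<in>A. (-1::real) ^ N (t k * u) \<omega>)" if "A \<in> Pow {..<d}" for A
  proof (rule integrable_const_bound[where B = 1])
    show "AE \<omega> in W. norm (\<Prod>k\<in>A. (-1::real) ^ N (t k * u) \<omega>) \<le> 1"
      by (simp add: abs_prod power_abs)
    show "(\<lambda>\<omega>. \<Prod>k\<in>A. (-1::real) ^ N (t k * u) \<omega>) \<in> borel_measurable W"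
      using that by (intro borel_measurable_prod measurable_compose[OF Nm]) auto
  qed
  have "{\<omega> \<in> space W. parity_set d (\<lambda>k. N (t k * u) \<omega>) = e} \<in> sets W"
    by (rule sets_parity_set_eq) (rule Nm)
  moreover have "{\<omega> \<in> space W. parity_set d (\<lambda>k. N (t k * u) \<omega>) = e} \<inter> space W =
      {\<omega> \<in> space W. parity_set d (\<lambda>k. N (t k * u) \<omega>) = e}" by auto
  ultimately have "poisson_parity W N d (\<lambda>k. t k * u) e = (\<integral>\<omega>. indicator {\<omega> \<in> space W. parity_set d (\<lambda>k. N (t k * u) \<omega>) = e} \<omega> \<partial>W)"
    by (simp add: poisson_parity_def)
  also have "\<dots> = (\<integral>\<omega>. of_bool (parity_set d (\<lambda>k. N (t k * u) \<omega>) = e) \<partial>W)"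
    by (intro Bochner_Integration.integral_cong refl) (auto simp: indicator_def)
  also have "\<dots> = (\<Sum>A\<in>Pow {..<d}. w A * (\<integral>\<omega>. (\<Prod>k\<in>A. (-1::real) ^ N (t k * u) \<omega>) \<partial>W))"
    unfolding expand using int by (subst Bochner_Integration.integral_sum) auto
  finally have P: "poisson_parity W N d (\<lambda>k. t k * u) e = \<dots>" .
  show ?thesis
    unfolding P bernoulli_parity_def expand bernoulli_mean_sum
    using t by (intro tendsto_sum tendsto_mult tendsto_const signs_mean_tendsto[OF N u]) (auto intro: finite_subset)
qed

lemma
  assumes x: "0 \<le> x" "x \<le> 1"
  shows bernoulli_parity_nonneg: "0 \<le> bernoulli_parity d \<kappa> n x e"
    and bernoulli_parity_le_1: "bernoulli_parity d \<kappa> n x e \<le> 1"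
  using bernoulli_mean_mono[OF x, of "\<lambda>_. 0" "\<lambda>b. of_bool (parity_set d (\<lambda>k. \<Sum>j=1..\<kappa> k. b j) = e)" n]
    bernoulli_mean_mono[OF x, of "\<lambda>b. of_bool (parity_set d (\<lambda>k. \<Sum>j=1..\<kappa> k. b j) = e)" "\<lambda>_. 1" n]
  by (simp_all add: bernoulli_parity_def bernoulli_mean_const)

text \<open>A nonempty set of odd sums requires a success among the \<open>n\<close> trials, which has probability
  \<open>1 - (1 - x) ^ n\<close>. This linear bound is what controls the singularity at \<open>x = 0\<close> later on.\<close>

lemma bernoulli_parity_le:
  assumes x: "0 \<le> x" "x \<le> 1" and e: "e \<noteq> {}" and \<kappa>: "\<And>k. k < d \<Longrightarrow> \<kappa> k \<le> n"
  shows "bernoulli_parity d \<kappa> n x e \<le> real n * x"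
proof -
  have "bernoulli_parity d \<kappa> n x e \<le> bernoulli_mean n x (\<lambda>b. 1 - (\<Prod>j\<in>{1..n}. of_bool (b j = 0)))"
    unfolding bernoulli_parity_def
  proof (rule bernoulli_mean_mono[OF x])
    fix b :: "nat \<Rightarrow> nat"
    show "of_bool (parity_set d (\<lambda>k. \<Sum>j=1..\<kappa> k. b j) = e) \<le> (1 - (\<Prod>j\<in>{1..n}. of_bool (b j = 0)) :: real)"
    proof (cases "\<forall>j\<in>{1..n}. b j = 0")
      case True
      have "(\<Sum>j=1..\<kappa> k. b j) = 0" if "k < d" for k
        using True \<kappa>[OF that] by auto
      then have "parity_set d (\<lambda>k. \<Sum>j=1..\<kappa> k. b j) = {}"
        unfolding parity_set_def by (metis (mono_tags, lifting) Collect_empty_eq even_zero lessThan_iff)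
      then show ?thesis using True e by simp
    next
      case False
      then have prod0: "(\<Prod>j\<in>{1..n}. of_bool (b j = 0)) = (0::real)" by (auto simp: prod_zero_iff)
      show ?thesis unfolding prod0 by simp
    qed
  qed
  also have "\<dots> = 1 - (1 - x) ^ n"
    using bernoulli_mean_prod[of n x "\<lambda>j v. of_bool (v = 0)"]
    by (simp add: bernoulli_mean_diff bernoulli_mean_const)
  also have "\<dots> \<le> real n * x"
    using Bernoulli_inequality[of "- x" n] x by simp
  finally show ?thesis .
qed

lemma continuous_on_bernoulli_mean [continuous_intros]:
  "continuous_on S (\<lambda>x. bernoulli_mean n x F)"
  unfolding bernoulli_mean_def by (intro continuous_intros)

section \<open>The characteristic function of the contribution of one copy\<close>

text \<open>\<open>F\<close> depends on finitely many of the \<open>\<eta>\<^sub>j\<close>, so it is a combination of indicators of cylinder events, whose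
  conditional probabilities given \<open>q\<close> are the Bernoulli weights.\<close>

lemma (in prob_space) conditionally_bernoulli_expectation:
  assumes q [measurable]: "q \<in> borel_measurable M" and q01: "\<And>\<omega>. \<omega> \<in> space M \<Longrightarrow> q \<omega> \<in> {0<..<1}"
    and \<eta>: "cond_iid_bernoulli M q \<eta>"
    and h [measurable]: "h \<in> borel_measurable borel" and h_bd: "\<And>x. \<bar>h x\<bar> \<le> B"
    and F: "\<And>b b'. (\<And>j. j \<in> {1..n} \<Longrightarrow> b j = b' j) \<Longrightarrow> F b = F b'"
  shows "(\<integral>\<omega>. h (q \<omega>) * F (\<lambda>j. \<eta> j \<omega>) \<partial>M) = (\<integral>\<omega>. h (q \<omega>) * bernoulli_mean n (q \<omega>) F \<partial>M)"
proof -
  define G where "G = vimage_algebra (space M) q borel"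
  have "subalgebra M G"
    unfolding subalgebra_def G_def
    using measurable_iff_sets[of q M borel] q by (auto simp: space_vimage_algebra)
  then have "finite_measure_subalgebra M G"
    by (intro finite_measure_subalgebra.intro finite_measure_subalgebra_axioms.intro) unfold_locales
  then interpret G: sigma_finite_subalgebra M G
    by (rule finite_measure_subalgebra_is_sigma_finite)
  have \<eta>_meas [measurable]: "\<eta> j \<in> M \<rightarrow>\<^sub>M count_space UNIV" if "j \<ge> 1" for j
    using \<eta> that by (simp add: cond_iid_bernoulli_def)
  have \<eta>01: "\<eta> j \<omega> \<in> {0, 1}" if "j \<ge> 1" "\<omega> \<in> space M" for j \<omega>
    using \<eta> that by (simp add: cond_iid_bernoulli_def)
  define BB where "BB = (\<Pi>\<^sub>E j\<in>{1..n}. {0, 1::nat})"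
  define w where "w = (\<lambda>x b. \<Prod>j\<in>{1..n}. x ^ b j * (1 - x) ^ (1 - b j :: nat) :: real)"
  define E where "E = (\<lambda>b. {\<omega> \<in> space M. \<forall>j\<in>{1..n}. \<eta> j \<omega> = b j})"
  have E [measurable]: "E b \<in> sets M" for b
  proof -
    have "E b = {\<omega> \<in> space M. \<forall>j\<in>{1..n}. \<omega> \<in> {\<omega> \<in> space M. \<eta> j \<omega> = b j}}" by (auto simp: E_def)
    also have "\<dots> \<in> sets M"
      by (intro sets.sets_Collect_finite_All) auto
    finally show ?thesis .
  qed
  have finBB: "finite BB" by (auto simp: BB_def intro: finite_PiE)
  have q_G: "q \<in> borel_measurable G" unfolding G_def by (rule measurable_vimage_algebra1) auto
  have cond: "(\<integral>\<omega>. h (q \<omega>) * indicator (E b) \<omega> \<partial>M) = (\<integral>\<omega>. h (q \<omega>) * w (q \<omega>) b \<partial>M)"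
    if b: "b \<in> BB" for b
  proof -
    have "AE \<omega> in M. real_cond_exp M G (indicator (E b)) \<omega> = w (q \<omega>) b"
    proof -
      have "\<forall>j\<in>{1..n}. b j \<in> {0, 1}" using b by (auto simp: BB_def PiE_iff)
      then show ?thesis
        using \<eta>[unfolded cond_iid_bernoulli_def, THEN conjunct2, rule_format, of "{1..n}" b]
        by (simp add: E_def G_def w_def)
    qed
    then have "(\<integral>\<omega>. h (q \<omega>) * w (q \<omega>) b \<partial>M) = (\<integral>\<omega>. h (q \<omega>) * real_cond_exp M G (indicator (E b)) \<omega> \<partial>M)"
      by (intro integral_cong_AE) (auto simp: w_def)
    also have "\<dots> = (\<integral>\<omega>. h (q \<omega>) * indicator (E b) \<omega> \<partial>M)"
    proof (rule G.real_cond_exp_intg(2))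
      show "integrable M (\<lambda>\<omega>. h (q \<omega>) * indicator (E b) \<omega>)"
        by (rule integrable_const_bound[where B = B])
          (use h_bd order_trans[OF abs_ge_zero h_bd] in \<open>simp_all add: indicator_def\<close>)
      show "(\<lambda>\<omega>. h (q \<omega>)) \<in> borel_measurable G"
        by (rule measurable_compose[OF q_G h])
    qed measurable
    finally show ?thesis ..
  qed
  have w01: "\<bar>w (q \<omega>) b\<bar> \<le> 1" if "\<omega> \<in> space M" for \<omega> b
  proof -
    have "w (q \<omega>) b \<le> 1" "0 \<le> w (q \<omega>) b"
      unfolding w_def using q01[OF that] by (auto intro!: prod_le_1 prod_nonneg mult_le_one power_le_one)
    then show ?thesis by simp
  qed
  have "(\<integral>\<omega>. h (q \<omega>) * F (\<lambda>j. \<eta> j \<omega>) \<partial>M) = (\<integral>\<omega>. (\<Sum>b\<in>BB. F b * (h (q \<omega>) * indicator (E b) \<omega>)) \<partial>M)"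
  proof (intro Bochner_Integration.integral_cong refl)
    fix \<omega> assume w: "\<omega> \<in> space M"
    define c where "c = (\<lambda>j\<in>{1..n}. \<eta> j \<omega>)"
    have c: "c \<in> BB" using \<eta>01[OF _ w] by (auto simp: c_def BB_def)
    have "indicator (E b) \<omega> = (if b = c then 1 else (0::real))" if "b \<in> BB" for b
    proof -
      have "\<omega> \<in> E b \<longleftrightarrow> b = c"
        using that w unfolding BB_def E_def c_def by (auto intro!: PiE_ext[where k = "{1..n}"])
      then show ?thesis by (simp add: indicator_def)
    qed
    then have "(\<Sum>b\<in>BB. F b * (h (q \<omega>) * indicator (E b) \<omega>)) = (\<Sum>b\<in>BB. if b = c then F b * h (q \<omega>) else 0)"
      by (intro sum.cong) auto
    also have "\<dots> = F c * h (q \<omega>)" using finBB c by simp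
    also have "F c = F (\<lambda>j. \<eta> j \<omega>)" by (rule F) (simp add: c_def)
    finally show "h (q \<omega>) * F (\<lambda>j. \<eta> j \<omega>) = (\<Sum>b\<in>BB. F b * (h (q \<omega>) * indicator (E b) \<omega>))" by simp
  qed
  also have "\<dots> = (\<Sum>b\<in>BB. F b * (\<integral>\<omega>. h (q \<omega>) * indicator (E b) \<omega> \<partial>M))"
    by (subst Bochner_Integration.integral_sum)
      (use h_bd order_trans[OF abs_ge_zero h_bd] in \<open>simp_all add: integrable_const_bound[where B = B] indicator_def\<close>)
  also have "\<dots> = (\<Sum>b\<in>BB. F b * (\<integral>\<omega>. h (q \<omega>) * w (q \<omega>) b \<partial>M))"
    using cond by simp
  also have "\<dots> = (\<integral>\<omega>. (\<Sum>b\<in>BB. F b * (h (q \<omega>) * w (q \<omega>) b)) \<partial>M)"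
  proof -
    have "integrable M (\<lambda>\<omega>. h (q \<omega>) * w (q \<omega>) b)" for b
    proof (rule integrable_const_bound[where B = B])
      show "AE \<omega> in M. norm (h (q \<omega>) * w (q \<omega>) b) \<le> B"
      proof (rule AE_I2)
        fix \<omega> assume "\<omega> \<in> space M"
        then have "\<bar>h (q \<omega>)\<bar> * \<bar>w (q \<omega>) b\<bar> \<le> B * 1"
          using h_bd[of "q \<omega>"] w01 by (intro mult_mono) auto
        then show "norm (h (q \<omega>) * w (q \<omega>) b) \<le> B" by (simp add: abs_mult)
      qed
    qed (simp add: w_def)
    then show ?thesis by (subst Bochner_Integration.integral_sum) auto
  qed
  also have "\<dots> = (\<integral>\<omega>. h (q \<omega>) * bernoulli_mean n (q \<omega>) F \<partial>M)"
    unfolding bernoulli_mean_def BB_def w_def by (simp add: sum_distrib_left mult_ac)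
  finally show ?thesis .
qed

text \<open>Only successes contribute, and their signs alternate starting from \<open>-1\<close>.\<close>

lemma signed_partial_sum:
  fixes c :: "nat \<Rightarrow> nat"
  assumes "\<And>j. j \<in> {1..n} \<Longrightarrow> c j \<in> {0, 1}"
  shows "(\<Sum>j=1..n. (-1) ^ (\<Sum>k=1..j. c k) * real (c j)) = - of_bool (odd (\<Sum>k=1..n. c k))"
  using assms
proof (induction n)
  case (Suc n)
  have "(\<Sum>j=1..n. (-1) ^ (\<Sum>k=1..j. c k) * real (c j)) = - of_bool (odd (\<Sum>k=1..n. c k))"
    by (rule Suc.IH) (use Suc.prems in auto)
  moreover have "c (Suc n) = 0 \<or> c (Suc n) = 1" using Suc.prems[of "Suc n"] by auto
  ultimately show ?case by (cases "even (\<Sum>k=1..n. c k)") auto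
qed simp

lemma measurable_sum_nat:
  fixes f :: "'i \<Rightarrow> 'a \<Rightarrow> nat"
  assumes f: "\<And>i. i \<in> I \<Longrightarrow> f i \<in> M \<rightarrow>\<^sub>M count_space UNIV"
  shows "(\<lambda>x. \<Sum>i\<in>I. f i x) \<in> M \<rightarrow>\<^sub>M count_space UNIV"
proof -
  have "(\<lambda>x. \<Sum>i\<in>I. real (f i x)) \<in> borel_measurable M"
    using f by (intro borel_measurable_sum measurable_compose[OF f]) auto
  then have "{x \<in> space M. (\<Sum>i\<in>I. real (f i x)) = real a} \<in> sets M" for a
    by measurable
  then have "(\<lambda>x. \<Sum>i\<in>I. f i x) -` {a} \<inter> space M \<in> sets M" for a
    by (simp add: vimage_def Int_def conj_commute flip: of_nat_sum)
  then show ?thesis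
    by (subst measurable_count_space_eq2_countable) auto
qed

text \<open>The part of \<open>\<Sum>\<^sub>k \<theta>\<^sub>k S\<^sub>n(t\<^sub>k)\<close> due to one copy, with \<open>\<kappa> k\<close> for \<open>\<lfloor>n t\<^sub>k\<rfloor>\<close>; a function of the triple so that it can
  be composed with the i.i.d. triples of the model.\<close>

definition copy_contribution ::
  "real \<Rightarrow> nat \<Rightarrow> (nat \<Rightarrow> real) \<Rightarrow> (nat \<Rightarrow> nat) \<Rightarrow> real \<times> real \<times> (nat \<Rightarrow> nat) \<Rightarrow> real" where
  "copy_contribution \<alpha>' d \<theta> \<kappa> = (\<lambda>(x, q, h). \<Sum>k<d. \<theta> k *
     (\<Sum>j=1..\<kappa> k. x / q powr (1 / \<alpha>') * (-1) ^ (\<Sum>l=1..j. h l) * real (h j)))"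

lemma copy_contribution_measurable [measurable]:
  "copy_contribution \<alpha>' d \<theta> \<kappa> \<in> borel_measurable (borel \<Otimes>\<^sub>M borel \<Otimes>\<^sub>M eta_space)"
proof -
  have h [measurable]: "(\<lambda>y. snd (snd y) j) \<in> (borel :: real measure) \<Otimes>\<^sub>M (borel :: real measure) \<Otimes>\<^sub>M eta_space \<rightarrow>\<^sub>M count_space UNIV"
    if "j \<in> {1..}" for j :: nat
    using that by measurable
  have s [measurable]: "(\<lambda>y. \<Sum>l=1..j. snd (snd y) l) \<in> (borel :: real measure) \<Otimes>\<^sub>M (borel :: real measure) \<Otimes>\<^sub>M eta_space \<rightarrow>\<^sub>M count_space UNIV"
    for j :: nat
    by (rule measurable_sum_nat) (use h in auto)
  show ?thesis
    unfolding copy_contribution_def case_prod_beta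
    by (intro borel_measurable_sum borel_measurable_times borel_measurable_const borel_measurable_divide
        measurable_compose[OF s] measurable_compose[OF h]) auto
qed

lemma aggregated_sum_eq_sum_contributions:
  "(\<Sum>k<d. \<theta> k * (aggregated_sum \<alpha>' m Xs qs \<eta>s n (t k) \<omega> / a)) =
   (\<Sum>i=1..m n. copy_contribution \<alpha>' d \<theta> (\<lambda>k. nat \<lfloor>real n * t k\<rfloor>) (Xs i \<omega>, qs i \<omega>, \<lambda>j\<in>{1..}. \<eta>s i j \<omega>) / a)"
proof -
  have tau: "tau (\<eta>s i) j \<omega> = (\<Sum>l=1..j. (\<lambda>j\<in>{1..}. \<eta>s i j \<omega>) l)" for i j
    unfolding tau_def by (intro sum.cong) auto
  have "(\<Sum>k<d. \<theta> k * (aggregated_sum \<alpha>' m Xs qs \<eta>s n (t k) \<omega> / a)) =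
    (\<Sum>k<d. \<theta> k * aggregated_sum \<alpha>' m Xs qs \<eta>s n (t k) \<omega>) / a"
    by (simp add: sum_divide_distrib)
  also have "(\<Sum>k<d. \<theta> k * aggregated_sum \<alpha>' m Xs qs \<eta>s n (t k) \<omega>) =
    (\<Sum>k<d. \<Sum>i=1..m n. \<theta> k * (\<Sum>j=1..nat \<lfloor>real n * t k\<rfloor>. Xs i \<omega> / qs i \<omega> powr (1 / \<alpha>') *
       (-1) ^ (\<Sum>l=1..j. (\<lambda>j\<in>{1..}. \<eta>s i j \<omega>) l) * real ((\<lambda>j\<in>{1..}. \<eta>s i j \<omega>) j)))"
  proof (intro sum.cong refl)
    fix k
    show "\<theta> k * aggregated_sum \<alpha>' m Xs qs \<eta>s n (t k) \<omega> =
      (\<Sum>i=1..m n. \<theta> k * (\<Sum>j=1..nat \<lfloor>real n * t k\<rfloor>. Xs i \<omega> / qs i \<omega> powr (1 / \<alpha>') *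
       (-1) ^ (\<Sum>l=1..j. (\<lambda>j\<in>{1..}. \<eta>s i j \<omega>) l) * real ((\<lambda>j\<in>{1..}. \<eta>s i j \<omega>) j)))"
      unfolding aggregated_sum_def aggregated_def tau sum_distrib_left[symmetric]
      by (subst sum.swap) (intro arg_cong[where f = "(*) (\<theta> k)"] sum.cong refl, auto)
  qed
  also have "\<dots> = (\<Sum>i=1..m n. copy_contribution \<alpha>' d \<theta> (\<lambda>k. nat \<lfloor>real n * t k\<rfloor>) (Xs i \<omega>, qs i \<omega>, \<lambda>j\<in>{1..}. \<eta>s i j \<omega>))"
    by (subst sum.swap) (simp add: copy_contribution_def)
  finally show ?thesis by (simp add: sum_divide_distrib)
qed

lemma iid_copies_char_sum:
  fixes V :: "'c \<Rightarrow> real"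
  assumes M: "prob_space M" and copies: "iid_copies M Y N Z S"
    and Z: "Z \<in> N \<rightarrow>\<^sub>M S" and V [measurable]: "V \<in> borel_measurable S"
  shows "(\<integral>\<omega>. iexp (\<Sum>i=1..(r::nat). V (Y i \<omega>)) \<partial>M) =
    (\<integral>\<omega>. iexp (V (Z \<omega>)) \<partial>N) ^ r"
proof -
  interpret M: prob_space M by fact
  have indep: "M.indep_vars (\<lambda>_. S) Y {1..}" and law: "\<And>i. i \<ge> 1 \<Longrightarrow> distr M S (Y i) = distr N S Z"
    using copies by (auto simp: iid_copies_def)
  have Y: "Y i \<in> M \<rightarrow>\<^sub>M S" if "i \<ge> 1" for i
    using indep that by (auto simp: M.indep_vars_def)
  have e [measurable]: "(\<lambda>y. iexp (V y)) \<in> borel_measurable S" by measurable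
  have "(\<integral>\<omega>. iexp (\<Sum>i=1..r. V (Y i \<omega>)) \<partial>M) =
    (\<integral>\<omega>. (\<Prod>i=1..r. iexp (V (Y i \<omega>))) \<partial>M)"
    by (simp add: exp_sum sum_distrib_left)
  also have "\<dots> = (\<Prod>i=1..r. \<integral>\<omega>. iexp (V (Y i \<omega>)) \<partial>M)"
  proof (rule M.indep_vars_lebesgue_integral)
    show "M.indep_vars (\<lambda>_. borel) (\<lambda>i \<omega>. iexp (V (Y i \<omega>))) {1..r}"
      by (rule M.indep_vars_compose2[OF M.indep_vars_subset[OF indep]]) auto
    show "integrable M (\<lambda>\<omega>. iexp (V (Y i \<omega>)))" if "i \<in> {1..r}" for i
      by (rule M.integrable_const_bound[where B = 1]) (use that measurable_compose[OF Y e] in auto)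
  qed simp
  also have "\<dots> = (\<Prod>i=1..r. \<integral>\<omega>. iexp (V (Z \<omega>)) \<partial>N)"
  proof (intro prod.cong refl)
    fix i assume "i \<in> {1..r}"
    then have i: "i \<ge> 1" by simp
    have "(\<integral>\<omega>. iexp (V (Y i \<omega>)) \<partial>M) = (\<integral>y. iexp (V y) \<partial>distr M S (Y i))"
      by (rule integral_distr[OF Y[OF i] e, symmetric])
    also have "\<dots> = (\<integral>\<omega>. iexp (V (Z \<omega>)) \<partial>N)"
      unfolding law[OF i] by (rule integral_distr[OF Z e])
    finally show "(\<integral>\<omega>. iexp (V (Y i \<omega>)) \<partial>M) = (\<integral>\<omega>. iexp (V (Z \<omega>)) \<partial>N)" .
  qed
  finally show ?thesis by simp
qed

text \<open>Integrate out \<open>X\<close> first, for a fixed value of \<open>c\<close>.\<close>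

lemma (in prob_space) char_independent_product:
  assumes X: "symmetric_rv M X" and indep: "indep_var borel X borel c"
  shows "(\<integral>\<omega>. iexp (X \<omega> * c \<omega>) \<partial>M) = complex_of_real (1 - (\<integral>\<omega>. char_defect M X (c \<omega>) \<partial>M))"
proof -
  have [measurable]: "X \<in> borel_measurable M" "c \<in> borel_measurable M"
    using indep by (auto dest: indep_var_rv1 indep_var_rv2)
  have joint: "distr M borel X \<Otimes>\<^sub>M distr M borel c = distr M (borel \<Otimes>\<^sub>M borel) (\<lambda>\<omega>. (X \<omega>, c \<omega>))"
    using indep by (simp add: indep_var_distribution_eq)
  have char_X: "(\<integral>\<omega>. iexp (s * X \<omega>) \<partial>M) = complex_of_real (1 - char_defect M X s)" for s
    by (rule char_symmetric_eq[OF X])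
  have defect_int: "integrable M (\<lambda>\<omega>. char_defect M X (c \<omega>))"
    by (rule integrable_const_bound[where B = 2]) (auto simp: char_defect_nonneg char_defect_le_2)
  have prob_M: "measure M (space M) = 1" by (rule prob_space)
  interpret PX: prob_space "distr M borel X" by (rule prob_space_distr) measurable
  interpret Pc: prob_space "distr M borel c" by (rule prob_space_distr) measurable
  interpret pair_prob_space "distr M borel X" "distr M borel c" ..
  have "(\<integral>\<omega>. iexp (X \<omega> * c \<omega>) \<partial>M) =
    (\<integral>z. iexp (fst z * snd z) \<partial>distr M (borel \<Otimes>\<^sub>M borel) (\<lambda>\<omega>. (X \<omega>, c \<omega>)))"
    by (subst integral_distr) auto
  also have "\<dots> = (\<integral>y. \<integral>x. iexp (x * y) \<partial>distr M borel X \<partial>distr M borel c)"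
  proof -
    have "integrable (distr M borel X \<Otimes>\<^sub>M distr M borel c) (\<lambda>(x, y). iexp (x * y))"
      by (rule P.integrable_const_bound[where B = 1]) (auto simp: case_prod_beta)
    from integral_snd[OF this] show ?thesis
      unfolding joint[symmetric] by (simp add: case_prod_unfold)
  qed
  also have "\<dots> = (\<integral>\<omega>. \<integral>x. iexp (x * c \<omega>) \<partial>distr M borel X \<partial>M)"
    by (subst integral_distr) auto
  also have "\<dots> = (\<integral>\<omega>. complex_of_real (1 - char_defect M X (c \<omega>)) \<partial>M)"
  proof (intro Bochner_Integration.integral_cong refl)
    fix \<omega>
    have "(\<integral>x. iexp (x * c \<omega>) \<partial>distr M borel X) = (\<integral>\<omega>'. iexp (c \<omega> * X \<omega>') \<partial>M)"
      by (subst integral_distr) (auto simp: mult.commute)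
    then show "(\<integral>x. iexp (x * c \<omega>) \<partial>distr M borel X) = complex_of_real (1 - char_defect M X (c \<omega>))"
      using char_X by simp
  qed
  also have "\<dots> = complex_of_real (\<integral>\<omega>. 1 - char_defect M X (c \<omega>) \<partial>M)"
    by (rule integral_complex_of_real)
  also have "(\<integral>\<omega>. 1 - char_defect M X (c \<omega>) \<partial>M) = 1 - (\<integral>\<omega>. char_defect M X (c \<omega>) \<partial>M)"
    using defect_int by (simp add: prob_M)
  finally show ?thesis .
qed

text \<open>The contribution equals \<open>X\<close> times a function of \<open>(q, \<eta>)\<close>, which depends on \<open>\<eta>\<close> only through the set \<open>e\<close> of
  odd sums. Split according to \<open>e\<close> and condition on \<open>q\<close>; the empty set contributes \<open>\<Psi> 0 = 0\<close>.\<close>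

lemma single_model_char:
  assumes model: "single_model N X q \<eta>" and q01: "\<And>\<omega>. \<omega> \<in> space N \<Longrightarrow> q \<omega> \<in> {0<..<1}"
    and X: "symmetric_rv N X" and \<kappa>: "\<And>k. k < d \<Longrightarrow> \<kappa> k \<le> n"
  shows "(\<integral>\<omega>. iexp (copy_contribution \<alpha>' d \<theta> \<kappa> (X \<omega>, q \<omega>, \<lambda>j\<in>{1..}. \<eta> j \<omega>) / a) \<partial>N) =
    complex_of_real (1 - (\<Sum>e\<in>Pow {..<d} - {{}}.
      (\<integral>\<omega>. char_defect N X ((\<Sum>k\<in>e. \<theta> k) / (q \<omega> powr (1 / \<alpha>') * a)) * bernoulli_parity d \<kappa> n (q \<omega>) e \<partial>N)))"
proof -
  interpret prob_space N using model by (simp add: single_model_def)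
  have [measurable]: "X \<in> borel_measurable N" and q [measurable]: "q \<in> borel_measurable N"
    and \<eta>: "cond_iid_bernoulli N q \<eta>"
    and ind: "indep_set (sets (vimage_algebra (space N) X borel))
       (sets (vimage_algebra (space N) (\<lambda>\<omega>. (q \<omega>, \<lambda>j\<in>{1..}. \<eta> j \<omega>)) (borel \<Otimes>\<^sub>M eta_space)))"
    using model by (auto simp: single_model_def)
  have \<eta>_meas: "\<eta> j \<in> N \<rightarrow>\<^sub>M count_space UNIV" if "j \<ge> 1" for j
    using \<eta> that by (simp add: cond_iid_bernoulli_def)
  have \<eta>01: "\<eta> j \<omega> \<in> {0, 1}" if "j \<ge> 1" "\<omega> \<in> space N" for j \<omega>
    using \<eta> that by (simp add: cond_iid_bernoulli_def)
  define U where "U = (\<lambda>\<omega>. (q \<omega>, \<lambda>j\<in>{1..}. \<eta> j \<omega>))"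
  have U: "U \<in> N \<rightarrow>\<^sub>M borel \<Otimes>\<^sub>M eta_space"
    unfolding U_def by (intro measurable_Pair q measurable_restrict \<eta>_meas) auto
  define g where "g = (\<lambda>u. copy_contribution \<alpha>' d \<theta> \<kappa> (1, u) / a)"
  have g [measurable]: "g \<in> borel_measurable (borel \<Otimes>\<^sub>M eta_space)"
    unfolding g_def by measurable
  define c where "c = (\<lambda>\<omega>. g (U \<omega>))"
  have c_meas [measurable]: "c \<in> borel_measurable N"
    unfolding c_def by (rule measurable_compose[OF U g])
  have "indep_var borel X borel c"
    unfolding indep_var_eq
  proof (intro conjI)
    show "indep_set (sigma_sets (space N) {X -` A \<inter> space N |A. A \<in> sets borel})
       (sigma_sets (space N) {c -` A \<inter> space N |A. A \<in> sets borel})"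
      using ind unfolding indep_set_def
    proof (rule indep_sets_mono_sets)
      have "sigma_sets (space N) {c -` A \<inter> space N |A. A \<in> sets borel} \<subseteq>
         sets (vimage_algebra (space N) U (borel \<Otimes>\<^sub>M eta_space))"
      proof -
        have "U \<in> vimage_algebra (space N) U (borel \<Otimes>\<^sub>M eta_space) \<rightarrow>\<^sub>M borel \<Otimes>\<^sub>M eta_space"
          by (rule measurable_vimage_algebra1) (use measurable_space[OF U] in auto)
        then have "c \<in> borel_measurable (vimage_algebra (space N) U (borel \<Otimes>\<^sub>M eta_space))"
          unfolding c_def by (rule measurable_compose[OF _ g])
        then have "{c -` A \<inter> space N |A. A \<in> sets borel} \<subseteq> sets (vimage_algebra (space N) U (borel \<Otimes>\<^sub>M eta_space))"
          by (auto dest: measurable_sets simp: space_vimage_algebra)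
        then show ?thesis
          using sets.sigma_sets_subset[of _ "vimage_algebra (space N) U (borel \<Otimes>\<^sub>M eta_space)"]
          by (simp add: space_vimage_algebra)
      qed
      then show "(case i of True \<Rightarrow> sigma_sets (space N) {X -` A \<inter> space N |A. A \<in> sets borel}
           | False \<Rightarrow> sigma_sets (space N) {c -` A \<inter> space N |A. A \<in> sets borel})
         \<subseteq> (case i of True \<Rightarrow> sets (vimage_algebra (space N) X borel)
           | False \<Rightarrow> sets (vimage_algebra (space N) (\<lambda>\<omega>. (q \<omega>, \<lambda>j\<in>{1..}. \<eta> j \<omega>)) (borel \<Otimes>\<^sub>M eta_space)))" for i
        by (cases i) (auto simp: sets_vimage_algebra U_def)
    qed
  qed simp_all
  from char_independent_product[OF X this]
  have 1: "(\<integral>\<omega>. iexp (X \<omega> * c \<omega>) \<partial>N) = complex_of_real (1 - (\<integral>\<omega>. char_defect N X (c \<omega>) \<partial>N))" .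
  have 2: "copy_contribution \<alpha>' d \<theta> \<kappa> (X \<omega>, q \<omega>, \<lambda>j\<in>{1..}. \<eta> j \<omega>) / a = X \<omega> * c \<omega>" for \<omega>
    unfolding c_def g_def U_def copy_contribution_def
    by (simp add: sum_distrib_left sum_divide_distrib mult_ac)
  define p where "p = (\<lambda>\<omega>. parity_set d (\<lambda>k. \<Sum>j=1..\<kappa> k. \<eta> j \<omega>))"
  define h where "h = (\<lambda>e x. char_defect N X ((\<Sum>k\<in>e. \<theta> k) / (x powr (1 / \<alpha>') * a)))"
  have h_meas: "h e \<in> borel_measurable borel" for e
    unfolding h_def by measurable
  have h_bd: "\<bar>h e x\<bar> \<le> 2" for e x
    unfolding h_def by (simp add: char_defect_nonneg char_defect_le_2)
  have cp: "char_defect N X (c \<omega>) = h (p \<omega>) (q \<omega>)" if w: "\<omega> \<in> space N" for \<omega>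
  proof -
    have "(\<Sum>j=1..\<kappa> k. 1 / q \<omega> powr (1 / \<alpha>') * (-1) ^ (\<Sum>l=1..j. (\<lambda>j\<in>{1..}. \<eta> j \<omega>) l) * real ((\<lambda>j\<in>{1..}. \<eta> j \<omega>) j)) =
      - of_bool (odd (\<Sum>j=1..\<kappa> k. \<eta> j \<omega>)) / q \<omega> powr (1 / \<alpha>')" for k
    proof -
      have "(\<Sum>j=1..\<kappa> k. 1 / q \<omega> powr (1 / \<alpha>') * (-1) ^ (\<Sum>l=1..j. (\<lambda>j\<in>{1..}. \<eta> j \<omega>) l) * real ((\<lambda>j\<in>{1..}. \<eta> j \<omega>) j)) =
        (\<Sum>j=1..\<kappa> k. (-1) ^ (\<Sum>l=1..j. \<eta> l \<omega>) * real (\<eta> j \<omega>)) / q \<omega> powr (1 / \<alpha>')"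
        by (simp add: sum_divide_distrib)
      also have "(\<Sum>j=1..\<kappa> k. (-1) ^ (\<Sum>l=1..j. \<eta> l \<omega>) * real (\<eta> j \<omega>)) = - of_bool (odd (\<Sum>j=1..\<kappa> k. \<eta> j \<omega>))"
        by (rule signed_partial_sum) (use \<eta>01[OF _ w] in auto)
      finally show ?thesis .
    qed
    then have "c \<omega> = (\<Sum>k<d. \<theta> k * (- of_bool (odd (\<Sum>j=1..\<kappa> k. \<eta> j \<omega>)) / q \<omega> powr (1 / \<alpha>'))) / a"
      by (simp only: c_def g_def U_def copy_contribution_def prod.case)
    also have "\<dots> = - ((\<Sum>k<d. \<theta> k * of_bool (odd (\<Sum>j=1..\<kappa> k. \<eta> j \<omega>))) / (q \<omega> powr (1 / \<alpha>') * a))"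
      unfolding sum_divide_distrib sum_negf[symmetric] by (intro sum.cong refl) simp
    also have "(\<Sum>k<d. \<theta> k * of_bool (odd (\<Sum>j=1..\<kappa> k. \<eta> j \<omega>))) = (\<Sum>k\<in>p \<omega>. \<theta> k)"
      unfolding p_def parity_set_def sum.inter_filter[OF finite_lessThan] by (intro sum.cong) auto
    finally show ?thesis by (simp only: char_defect_minus h_def)
  qed
  have p_sets: "{\<omega> \<in> space N. p \<omega> = e} \<in> sets N" for e
    unfolding p_def
  proof (rule sets_parity_set_eq)
    fix k
    show "(\<lambda>\<omega>. \<Sum>j=1..\<kappa> k. \<eta> j \<omega>) \<in> N \<rightarrow>\<^sub>M count_space UNIV"
      by (rule measurable_sum_nat) (use \<eta>_meas in auto)
  qed
  have p_meas: "(\<lambda>\<omega>. of_bool (p \<omega> = e) :: real) \<in> borel_measurable N" for e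
  proof -
    have "(\<lambda>\<omega>. indicator {\<omega> \<in> space N. p \<omega> = e} \<omega> :: real) \<in> borel_measurable N"
      using p_sets by measurable
    then show ?thesis by (rule measurable_cong[THEN iffD1, rotated]) (simp add: indicator_def)
  qed
  have "(\<integral>\<omega>. char_defect N X (c \<omega>) \<partial>N) = (\<integral>\<omega>. (\<Sum>e\<in>Pow {..<d}. h e (q \<omega>) * of_bool (p \<omega> = e)) \<partial>N)"
  proof (intro Bochner_Integration.integral_cong refl)
    fix \<omega> assume w: "\<omega> \<in> space N"
    have "(\<Sum>e\<in>Pow {..<d}. h e (q \<omega>) * of_bool (p \<omega> = e)) = (\<Sum>e\<in>Pow {..<d}. if e = p \<omega> then h e (q \<omega>) else 0)"
      by (intro sum.cong) auto
    also have "\<dots> = h (p \<omega>) (q \<omega>)"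
      using parity_set_subset[of d] by (simp add: p_def)
    finally show "char_defect N X (c \<omega>) = (\<Sum>e\<in>Pow {..<d}. h e (q \<omega>) * of_bool (p \<omega> = e))"
      using cp[OF w] by simp
  qed
  also have "\<dots> = (\<Sum>e\<in>Pow {..<d}. \<integral>\<omega>. h e (q \<omega>) * of_bool (p \<omega> = e) \<partial>N)"
  proof (rule Bochner_Integration.integral_sum)
    fix e
    show "integrable N (\<lambda>\<omega>. h e (q \<omega>) * of_bool (p \<omega> = e))"
      by (rule integrable_const_bound[where B = 2])
        (use h_bd[of e] p_meas[of e] measurable_compose[OF q h_meas[of e]] in auto)
  qed
  also have "\<dots> = (\<Sum>e\<in>Pow {..<d}. \<integral>\<omega>. h e (q \<omega>) * bernoulli_parity d \<kappa> n (q \<omega>) e \<partial>N)"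
  proof (intro sum.cong refl)
    fix e
    show "(\<integral>\<omega>. h e (q \<omega>) * of_bool (p \<omega> = e) \<partial>N) = (\<integral>\<omega>. h e (q \<omega>) * bernoulli_parity d \<kappa> n (q \<omega>) e \<partial>N)"
      unfolding p_def bernoulli_parity_def
    proof (rule conditionally_bernoulli_expectation[OF q q01 \<eta> h_meas h_bd])
      fix b b' :: "nat \<Rightarrow> nat" assume bb: "\<And>j. j \<in> {1..n} \<Longrightarrow> b j = b' j"
      have "(\<Sum>j=1..\<kappa> k. b j) = (\<Sum>j=1..\<kappa> k. b' j)" if "k < d" for k
        using \<kappa>[OF that] by (intro sum.cong refl bb) auto
      then have "parity_set d (\<lambda>k. \<Sum>j=1..\<kappa> k. b j) = parity_set d (\<lambda>k. \<Sum>j=1..\<kappa> k. b' j)"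
        unfolding parity_set_def by auto
      then show "of_bool (parity_set d (\<lambda>k. \<Sum>j=1..\<kappa> k. b j) = e) = of_bool (parity_set d (\<lambda>k. \<Sum>j=1..\<kappa> k. b' j) = e)"
        by simp
    qed
  qed
  also have "\<dots> = (\<Sum>e\<in>Pow {..<d} - {{}}. \<integral>\<omega>. h e (q \<omega>) * bernoulli_parity d \<kappa> n (q \<omega>) e \<partial>N)"
    by (rule sum.mono_neutral_right) (auto simp: h_def char_defect_def)
  finally show ?thesis
    using 1 unfolding 2 h_def by simp
qed

section \<open>The scaling limit of the exponent\<close>

definition potter_majorant :: "real \<Rightarrow> real \<Rightarrow> real \<Rightarrow> real" where
  "potter_majorant \<beta> \<delta> u = indicator {0<..1} u *\<^sub>R u powr (- \<beta> - \<delta>) + indicator {1<..} u *\<^sub>R u powr (\<delta> - \<beta> - 1)"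

lemma potter_majorant_nonneg: "0 \<le> potter_majorant \<beta> \<delta> u"
  by (simp add: potter_majorant_def)

lemma integrable_potter_majorant:
  fixes \<beta> \<delta> :: real
  assumes "\<beta> + \<delta> < 1" "\<delta> < \<beta>"
  shows "integrable lborel (potter_majorant \<beta> \<delta>)"
  unfolding potter_majorant_def using set_integrable_powr_Ioc_0[of "- \<beta> - \<delta>" 1] set_integrable_powr_Ioi[of "\<delta> - \<beta> - 1" 1] assms
  unfolding set_integrable_def by (intro Bochner_Integration.integrable_add) auto

text \<open>The left-hand side is what Potter's bound and \<open>bernoulli_parity_le\<close> leave of the integrand: the factor
  \<open>u\<close> rescues integrability at 0, the exponent \<open>- \<beta> - 1\<close> gives it at infinity.\<close>

lemma potter_factor_le_majorant:
  fixes \<beta> \<delta> :: real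
  assumes u: "u > 0" and \<delta>: "\<delta> > 0"
  shows "u powr (- \<beta> - 1) * (u powr \<delta> + u powr (- \<delta>)) * min 1 u \<le>
    2 * potter_majorant \<beta> \<delta> u"
proof (cases "u \<le> 1")
  case True
  have "u powr \<delta> \<le> u powr (- \<delta>)"
    using True u \<delta> by (intro powr_mono') auto
  then have "u powr (- \<beta> - 1) * (u powr \<delta> + u powr (- \<delta>)) * u \<le> u powr (- \<beta> - 1) * (2 * u powr (- \<delta>)) * u"
    using u by (intro mult_right_mono mult_left_mono) auto
  also have "\<dots> = 2 * (u powr (- \<beta> - 1) * u powr (- \<delta>) * u powr 1)" using u by simp
  also have "\<dots> = 2 * u powr (- \<beta> - \<delta>)" by (simp only: powr_add[symmetric]) simp
  finally show ?thesis using True u by (simp add: min_def potter_majorant_def)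
next
  case False
  have "u powr (- \<delta>) \<le> u powr \<delta>"
    using False \<delta> by (intro powr_mono) auto
  then have "u powr (- \<beta> - 1) * (u powr \<delta> + u powr (- \<delta>)) \<le> u powr (- \<beta> - 1) * (2 * u powr \<delta>)"
    by (intro mult_left_mono) auto
  also have "\<dots> = 2 * (u powr (- \<beta> - 1) * u powr \<delta>)" by simp
  also have "\<dots> = 2 * u powr (\<delta> - \<beta> - 1)" by (simp only: powr_add[symmetric]) (simp add: algebra_simps)
  finally show ?thesis using False u by (simp add: min_def potter_majorant_def)
qed

text \<open>The limit inherits \<open>0 \<le> Qlim u \<le> min 1 u\<close>, and \<open>min 1 u\<close> tames the singularity of \<open>u powr (-\<beta> - 1)\<close> at 0.\<close>

lemma mixture_limit_integrable:
  fixes Q :: "nat \<Rightarrow> real \<Rightarrow> real" and \<beta> :: real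
  assumes \<beta>: "0 < \<beta>" "\<beta> < 1"
    and Q [measurable]: "\<And>n. Q n \<in> borel_measurable borel"
    and Q_nonneg: "\<And>n x. 0 \<le> x \<Longrightarrow> x \<le> 1 \<Longrightarrow> 0 \<le> Q n x"
    and Q_le_1: "\<And>n x. 0 \<le> x \<Longrightarrow> x \<le> 1 \<Longrightarrow> Q n x \<le> 1"
    and Q_le: "\<And>n x. 0 \<le> x \<Longrightarrow> x \<le> 1 \<Longrightarrow> Q n x \<le> real n * x"
    and Q_lim: "\<And>u. u > 0 \<Longrightarrow> (\<lambda>n. Q n (u / real n)) \<longlonglongrightarrow> Qlim u"
  shows "set_integrable lborel {0<..} (\<lambda>u. Qlim u * u powr (-\<beta> - 1))"
proof -
  define \<delta> where "\<delta> = min (\<beta> / 2) ((1 - \<beta>) / 2)"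
  have \<delta>: "\<delta> > 0" "\<beta> + \<delta> < 1" "\<delta> < \<beta>" using \<beta> unfolding \<delta>_def min_def by (auto simp: field_simps)
  have bounds: "0 \<le> Qlim u" "Qlim u \<le> min 1 u" if u: "u > 0" for u
  proof -
    have ev: "\<forall>\<^sub>F n in sequentially. real n \<ge> u"
      using filterlim_real_sequentially by (simp add: filterlim_at_top)
    show "0 \<le> Qlim u"
      by (rule tendsto_lowerbound[OF Q_lim[OF u]])
        (use ev in eventually_elim, use u Q_nonneg in \<open>auto simp: divide_le_eq_1\<close>)
    show "Qlim u \<le> min 1 u"
    proof (rule tendsto_upperbound[OF Q_lim[OF u]])
      show "\<forall>\<^sub>F n in sequentially. Q n (u / real n) \<le> min 1 u"
        using ev
      proof eventually_elim
        case (elim n)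
        then have "0 \<le> u / real n" "u / real n \<le> 1" using u by (auto simp: divide_le_eq_1)
        then show ?case using Q_le_1[of "u / real n" n] Q_le[of "u / real n" n] elim u by auto
      qed
    qed simp
  qed
  show ?thesis
    unfolding set_integrable_def
  proof (rule Bochner_Integration.integrable_bound)
    show "integrable lborel (\<lambda>u. 2 * potter_majorant \<beta> \<delta> u)"
      by (intro integrable_mult_right integrable_potter_majorant \<delta>)
    show "(\<lambda>u. indicator {0<..} u *\<^sub>R (Qlim u * u powr (-\<beta> - 1))) \<in> borel_measurable lborel"
    proof (rule borel_measurable_LIMSEQ_real)
      show "(\<lambda>n. indicator {0<..} u *\<^sub>R (Q n (u / real n) * u powr (-\<beta> - 1))) \<longlonglongrightarrow>
          indicator {0<..} u *\<^sub>R (Qlim u * u powr (-\<beta> - 1))" for u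
        using Q_lim[of u] by (cases "u > 0") (auto intro!: tendsto_mult)
    qed measurable
    show "AE u in lborel. norm (indicator {0<..} u *\<^sub>R (Qlim u * u powr (-\<beta> - 1))) \<le>
        norm (2 * potter_majorant \<beta> \<delta> u)"
    proof (rule AE_I2)
      fix u :: real
      let ?w = "2 * potter_majorant \<beta> \<delta> u"
      show "norm (indicator {0<..} u *\<^sub>R (Qlim u * u powr (-\<beta> - 1))) \<le> norm ?w"
      proof (cases "u > 0")
        case True
        have "1 \<le> u powr \<delta> + u powr (-\<delta>)"
        proof (cases "u \<ge> 1")
          case True
          then show ?thesis using ge_one_powr_ge_zero[of u \<delta>] \<delta>(1) by (simp add: add_increasing2)
        next
          case False
          then have "1 \<le> u powr (-\<delta>)" using True \<delta>(1) powr_mono'[of "-\<delta>" 0 u] by simp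
          then show ?thesis by (simp add: add_increasing)
        qed
        then have "u powr (-\<beta> - 1) * 1 * min 1 u \<le> u powr (-\<beta> - 1) * (u powr \<delta> + u powr (-\<delta>)) * min 1 u"
          using True by (intro mult_right_mono mult_left_mono) auto
        also have "\<dots> \<le> ?w" by (rule potter_factor_le_majorant[OF True \<delta>(1)])
        finally have "u powr (-\<beta> - 1) * min 1 u \<le> ?w" by simp
        moreover have "Qlim u * u powr (-\<beta> - 1) \<le> min 1 u * u powr (-\<beta> - 1)"
          using bounds[OF True] by (intro mult_right_mono) auto
        ultimately have "Qlim u * u powr (-\<beta> - 1) \<le> ?w" by (simp only: mult.commute)
        then show ?thesis using True bounds(1)[OF True] by simp
      qed simp
    qed
  qed
qed

text \<open>Here \<open>Q n x\<close> is the probability of a parity pattern given \<open>q = x\<close>, and \<open>p\<close> is the density of \<open>q\<close>. The range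
  \<open>x > 1 / x2\<close>, where \<open>L (1 / x)\<close> is not controlled by Potter's bound, contributes at most
  \<open>O (m\<^sub>n / a\<^sub>n powr \<alpha>) = O (1 / (n powr \<beta> L n))\<close>, which vanishes. On the rest, substitute \<open>x = u / n\<close> and apply
  dominated convergence.\<close>

lemma mixture_integral_tendsto:
  fixes L p \<Psi> Qlim :: "real \<Rightarrow> real" and Q :: "nat \<Rightarrow> real \<Rightarrow> real" and m :: "nat \<Rightarrow> nat" and a :: "nat \<Rightarrow> real"
  assumes L: "slowly_varying L"
    and p_eq: "\<And>x. x \<in> {0<..<1} \<Longrightarrow> p x = x powr (-\<rho>) * L (1 / x)" and p_nonneg: "\<And>x. 0 \<le> p x"
    and p_int: "integrable lborel p" and p0: "\<And>x. x \<notin> {0<..<1} \<Longrightarrow> p x = 0"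
    and \<alpha>: "\<alpha> > 0" and \<alpha>': "\<alpha>' > 0" and \<beta>: "\<beta> = \<alpha> / \<alpha>' - 1 + \<rho>" "0 < \<beta>" "\<beta> < 1"
    and \<Psi> [measurable]: "\<Psi> \<in> borel_measurable borel" and \<Psi>_nonneg: "\<And>s. 0 \<le> \<Psi> s"
    and \<Psi>_bdd: "\<And>s. \<Psi> s \<le> B" and \<Psi>_le: "\<And>s. \<Psi> s \<le> K * \<bar>s\<bar> powr \<alpha>" and K: "K > 0"
    and \<Psi>_lim: "((\<lambda>s. \<Psi> s / \<bar>s\<bar> powr \<alpha>) \<longlongrightarrow> l) (at 0)"
    and Q [measurable]: "\<And>n. Q n \<in> borel_measurable borel"
    and Q_nonneg: "\<And>n x. 0 \<le> x \<Longrightarrow> x \<le> 1 \<Longrightarrow> 0 \<le> Q n x"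
    and Q_le_1: "\<And>n x. 0 \<le> x \<Longrightarrow> x \<le> 1 \<Longrightarrow> Q n x \<le> 1"
    and Q_le: "\<And>n x. 0 \<le> x \<Longrightarrow> x \<le> 1 \<Longrightarrow> Q n x \<le> real n * x"
    and Q_lim: "\<And>u. u > 0 \<Longrightarrow> (\<lambda>n. Q n (u / real n)) \<longlonglongrightarrow> Qlim u"
    and m_pos: "\<And>n. n \<ge> 1 \<Longrightarrow> m n > 0"
    and m_growth: "filterlim (\<lambda>n. real (m n) * L (real n) / real n powr (1 - \<rho>)) at_top sequentially"
    and C: "C > 0" and a_def: "\<And>n. n \<ge> 1 \<Longrightarrow> a n = (C * real n powr \<beta> * real (m n) * L (real n)) powr (1 / \<alpha>)"
    and y: "y \<noteq> 0"
  shows "(\<lambda>n. real (m n) * (\<integral>x. p x * (\<Psi> (y / (x powr (1 / \<alpha>') * a n)) * Q n x) \<partial>lborel)) \<longlonglongrightarrow>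
       \<bar>y\<bar> powr \<alpha> * l / C * (LBINT u:{0<..}. Qlim u * u powr (-\<beta> - 1))"
proof -
  define \<delta> where "\<delta> = min (\<beta> / 2) ((1 - \<beta>) / 2)"
  have \<delta>: "\<delta> > 0" "\<beta> + \<delta> < 1" "\<delta> < \<beta>" using \<beta>(2,3) unfolding \<delta>_def min_def by (auto simp: field_simps)
  obtain x1 where x1: "x1 > 0" and potter: "\<And>x y. x \<ge> x1 \<Longrightarrow> y \<ge> x1 \<Longrightarrow> 0 < L x \<and>
      L y \<le> L x * (exp 1 * ((y / x) powr \<delta> + (x / y) powr \<delta>))"
    using potter_bound[OF L \<delta>(1)] by blast
  define x2 where "x2 = max x1 2"
  have x2: "x2 \<ge> x1" "x2 \<ge> 2" by (auto simp: x2_def)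
  define n0 where "n0 = nat \<lceil>x2\<rceil>"
  have n0: "real n \<ge> x2" "n \<ge> 1" if "n \<ge> n0" for n
  proof -
    show "real n \<ge> x2" using that unfolding n0_def by linarith
    then show "n \<ge> 1" using x2 by linarith
  qed
  have Ln: "L (real n) > 0" if "n \<ge> n0" for n
    using potter[of "real n" "real n"] n0[OF that] x2 by auto
  have mn: "real (m n) > 0" if "n \<ge> n0" for n using m_pos n0[OF that] by simp
  have base_pos: "C * real n powr \<beta> * real (m n) * L (real n) > 0" if "n \<ge> n0" for n
    using C Ln[OF that] mn[OF that] n0[OF that] by simp
  have a_pos: "a n > 0" if "n \<ge> n0" for n
    using base_pos[OF that] a_def[of n] n0[OF that] by (simp only: powr_gt_zero)
  have a_powr: "a n powr \<alpha> = C * real n powr \<beta> * real (m n) * L (real n)" if "n \<ge> n0" for n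
    using base_pos[OF that] a_def[of n] n0[OF that] \<alpha> by (simp add: powr_powr less_imp_le)
  define s where "s = (\<lambda>n u. y / ((u / real n) powr (1 / \<alpha>') * a n))"
  have s_powr: "\<bar>s n u\<bar> powr \<alpha> = \<bar>y\<bar> powr \<alpha> / ((u / real n) powr (\<alpha> / \<alpha>') * a n powr \<alpha>)"
    if "n \<ge> n0" "u > 0" for n u
    using that a_pos[OF that(1)] n0[OF that(1)]
    by (simp add: s_def abs_divide abs_mult powr_divide powr_mult powr_powr)
  have s_nz: "s n u \<noteq> 0" if "n \<ge> n0" "u > 0" for n u
    using that a_pos[OF that(1)] n0[OF that(1)] y by (simp add: s_def)
  \<comment> \<open>The powers of \<open>n\<close> cancel: this identity is where the choice of \<open>a\<^sub>n\<close> and of \<open>\<beta>\<close> enters.\<close>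
  have key: "real (m n) / real n * (u / real n) powr (-\<rho>) * \<bar>s n u\<bar> powr \<alpha> =
      u powr (-\<beta> - 1) * \<bar>y\<bar> powr \<alpha> / (C * L (real n))" if n: "n \<ge> n0" and u: "u > 0" for n u
  proof -
    have npos: "real n > 0" using n0[OF n] by simp
    have g: "\<alpha> / \<alpha>' = \<beta> + 1 - \<rho>" using \<beta>(1) by simp
    have 1: "(u / real n) powr (-\<rho>) / (u / real n) powr (\<alpha> / \<alpha>') = u powr (-\<beta> - 1) * real n powr (\<beta> + 1)"
    proof -
      have "(u / real n) powr (-\<rho>) / (u / real n) powr (\<alpha> / \<alpha>') = (u / real n) powr (-\<beta> - 1)"
        unfolding g by (simp flip: powr_diff)
      also have "\<dots> = u powr (-\<beta> - 1) * real n powr (\<beta> + 1)"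
      proof -
        have "real n powr (-\<beta> - 1) = inverse (real n powr (\<beta> + 1))"
          using powr_minus[of "real n" "\<beta> + 1"] by simp
        then show ?thesis using u npos by (simp add: powr_divide) (simp add: divide_inverse)
      qed
      finally show ?thesis .
    qed
    have "real (m n) / real n * (u / real n) powr (-\<rho>) * \<bar>s n u\<bar> powr \<alpha> =
      real (m n) / real n * ((u / real n) powr (-\<rho>) / (u / real n) powr (\<alpha> / \<alpha>')) * \<bar>y\<bar> powr \<alpha> / a n powr \<alpha>"
      by (simp add: s_powr[OF n u])
    also have "\<dots> = u powr (-\<beta> - 1) * \<bar>y\<bar> powr \<alpha> / (C * L (real n))"
      unfolding 1 a_powr[OF n] using npos mn[OF n] Ln[OF n] C by (simp add: powr_add field_simps)
    finally show ?thesis .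
  qed
  define D where "D = \<bar>y\<bar> powr \<alpha> / C"
  have D: "D > 0" using y C by (simp add: D_def)
  define f where "f = (\<lambda>n u. if n \<ge> n0 \<and> 0 < u \<and> u \<le> real n / x2
     then real (m n) / real n * (p (u / real n) * (\<Psi> (s n u) * Q n (u / real n))) else 0)"
  have p_meas [measurable]: "p \<in> borel_measurable borel" using p_int by simp
  have f_meas [measurable]: "f n \<in> borel_measurable borel" for n
    unfolding f_def s_def by measurable
  have f_eq: "f n u = D * u powr (-\<beta> - 1) * (L (real n / u) / L (real n)) * (\<Psi> (s n u) / \<bar>s n u\<bar> powr \<alpha>) * Q n (u / real n)"
    if n: "n \<ge> n0" and u: "0 < u" "u \<le> real n / x2" for n u
  proof -
    have npos: "real n > 0" using n0[OF n] by simp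
    have "u / real n \<le> 1 / x2" using u npos x2 by (simp add: field_simps)
    also have "\<dots> < 1" using x2 by simp
    finally have "p (u / real n) = (u / real n) powr (-\<rho>) * L (real n / u)"
      using u npos by (subst p_eq) auto
    then have "f n u = (real (m n) / real n * (u / real n) powr (-\<rho>) * \<bar>s n u\<bar> powr \<alpha>) *
        (L (real n / u) * (\<Psi> (s n u) / \<bar>s n u\<bar> powr \<alpha>) * Q n (u / real n))"
      using n u s_nz[OF n u(1)] by (simp add: f_def)
    also have "\<dots> = D * u powr (-\<beta> - 1) * (L (real n / u) / L (real n)) * (\<Psi> (s n u) / \<bar>s n u\<bar> powr \<alpha>) * Q n (u / real n)"
      unfolding key[OF n u(1)] D_def by simp
    finally show ?thesis .
  qed
  \<comment> \<open>The growth condition on \<open>m\<^sub>n\<close> is equivalent to this limit, since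
    \<open>(n powr (1/\<alpha>') / a\<^sub>n) powr \<alpha> = n powr (1 - \<rho>) / (C m\<^sub>n L n)\<close>.\<close>
  have ratio0: "(\<lambda>n. real n powr (1 / \<alpha>') / a n) \<longlonglongrightarrow> 0"
  proof -
    have "(\<lambda>n. inverse (real (m n) * L (real n) / real n powr (1 - \<rho>))) \<longlonglongrightarrow> 0"
      using m_growth by (rule filterlim_compose[OF tendsto_inverse_0_at_top[OF filterlim_ident]])
    then have "(\<lambda>n. (1 / C) * inverse (real (m n) * L (real n) / real n powr (1 - \<rho>))) \<longlonglongrightarrow> (1 / C) * 0"
      by (intro tendsto_mult tendsto_const)
    then have "(\<lambda>n. (1 / C) * inverse (real (m n) * L (real n) / real n powr (1 - \<rho>))) \<longlonglongrightarrow> 0" by simp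
    then have "(\<lambda>n. ((1 / C) * inverse (real (m n) * L (real n) / real n powr (1 - \<rho>))) powr (1 / \<alpha>)) \<longlonglongrightarrow> 0"
    proof (rule tendsto_zero_powrI[OF _ tendsto_const])
      show "\<forall>\<^sub>F n in sequentially. 0 \<le> (1 / C) * inverse (real (m n) * L (real n) / real n powr (1 - \<rho>))"
        using eventually_ge_at_top[of n0]
      proof eventually_elim
        case (elim n)
        then show ?case using C mn[OF elim] Ln[OF elim] by simp
      qed
    qed (use \<alpha> in simp)
    moreover have "\<forall>\<^sub>F n in sequentially. ((1 / C) * inverse (real (m n) * L (real n) / real n powr (1 - \<rho>))) powr (1 / \<alpha>)
       = real n powr (1 / \<alpha>') / a n"
      using eventually_ge_at_top[of n0]
    proof eventually_elim
      case (elim n)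
      have npos: "real n > 0" using n0[OF elim] by simp
      have "real n powr (1 / \<alpha>') / a n = ((real n powr (1 / \<alpha>') / a n) powr \<alpha>) powr (1 / \<alpha>)"
        using \<alpha> a_pos[OF elim] npos by (simp add: powr_powr)
      also have "(real n powr (1 / \<alpha>') / a n) powr \<alpha> = real n powr (\<beta> + (1 - \<rho>)) / (C * real n powr \<beta> * real (m n) * L (real n))"
        using a_pos[OF elim] npos \<beta>(1) by (simp add: powr_divide powr_powr a_powr[OF elim])
      also have "\<dots> = (1 / C) * inverse (real (m n) * L (real n) / real n powr (1 - \<rho>))"
        using npos unfolding powr_add by (simp add: field_simps)
      finally show ?case ..
    qed
    ultimately show ?thesis by (rule Lim_transform_eventually)
  qed
  have s_lim: "filterlim (\<lambda>n. s n u) (at 0) sequentially" if u: "u > 0" for u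
  proof -
    have "(\<lambda>n. y * u powr (- 1 / \<alpha>') * (real n powr (1 / \<alpha>') / a n)) \<longlonglongrightarrow> y * u powr (- 1 / \<alpha>') * 0"
      by (intro tendsto_mult tendsto_const ratio0)
    moreover have "\<forall>\<^sub>F n in sequentially. y * u powr (- 1 / \<alpha>') * (real n powr (1 / \<alpha>') / a n) = s n u"
      using eventually_ge_at_top[of n0]
    proof eventually_elim
      case (elim n)
      have "real n > 0" using n0[OF elim] by simp
      moreover have "u powr (- 1 / \<alpha>') = inverse (u powr (1 / \<alpha>'))"
        using powr_minus[of u "1 / \<alpha>'"] by simp
      ultimately show ?case using u a_pos[OF elim] by (simp add: s_def powr_divide field_simps)
    qed
    ultimately have "(\<lambda>n. s n u) \<longlonglongrightarrow> y * u powr (- 1 / \<alpha>') * 0"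
      by (rule Lim_transform_eventually)
    moreover have "\<forall>\<^sub>F n in sequentially. s n u \<noteq> 0"
      using eventually_ge_at_top[of n0] by eventually_elim (use s_nz u in auto)
    ultimately show ?thesis by (auto simp: filterlim_at elim: eventually_mono)
  qed
  define g where "g = (\<lambda>u. indicator {0<..} u * (D * l * (Qlim u * u powr (-\<beta> - 1))))"
  have f_lim: "(\<lambda>n. f n u) \<longlonglongrightarrow> g u" for u
  proof (cases "u > 0")
    case u: True
    have "((\<lambda>x. L (1 / u * x) / L x) \<longlongrightarrow> 1) at_top"
      using L u unfolding slowly_varying_def by (metis zero_less_divide_1_iff)
    then have "(\<lambda>n. L (1 / u * real n) / L (real n)) \<longlonglongrightarrow> 1"
      by (rule filterlim_compose[OF _ filterlim_real_sequentially])
    then have L_lim: "(\<lambda>n. L (real n / u) / L (real n)) \<longlonglongrightarrow> 1" by simp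
    have "(\<lambda>n. D * u powr (-\<beta> - 1) * (L (real n / u) / L (real n)) * (\<Psi> (s n u) / \<bar>s n u\<bar> powr \<alpha>) * Q n (u / real n))
       \<longlonglongrightarrow> D * u powr (-\<beta> - 1) * 1 * l * Qlim u"
      by (intro tendsto_mult tendsto_const L_lim Q_lim u filterlim_compose[OF \<Psi>_lim s_lim])
    moreover have "\<forall>\<^sub>F n in sequentially. D * u powr (-\<beta> - 1) * (L (real n / u) / L (real n)) * (\<Psi> (s n u) / \<bar>s n u\<bar> powr \<alpha>) * Q n (u / real n) = f n u"
    proof -
      have "\<forall>\<^sub>F n in sequentially. real n \<ge> u * x2"
        using filterlim_real_sequentially by (simp add: filterlim_at_top)
      then show ?thesis using eventually_ge_at_top[of n0]
      proof eventually_elim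
        case (elim n)
        then show ?case using f_eq[OF elim(2) u] x2 by (simp add: field_simps)
      qed
    qed
    ultimately have "(\<lambda>n. f n u) \<longlonglongrightarrow> D * u powr (-\<beta> - 1) * 1 * l * Qlim u"
      by (rule Lim_transform_eventually)
    then show ?thesis using u by (simp add: g_def mult_ac)
  qed (simp add: f_def g_def)
  \<comment> \<open>The factor \<open>exp 1\<close> is the constant in Potter's bound, and \<open>K\<close> bounds \<open>\<Psi> s / \<bar>s\<bar> powr \<alpha>\<close>.\<close>
  define w where "w = (\<lambda>u :: real. (D * exp 1 * K) * (2 * potter_majorant \<beta> \<delta> u))"
  have w_int: "integrable lborel w"
    unfolding w_def by (intro integrable_mult_right integrable_potter_majorant \<delta>)
  have w_nonneg: "0 \<le> w u" for u
    unfolding w_def using D K potter_majorant_nonneg by (intro mult_nonneg_nonneg) auto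
  have f_bound: "norm (f n u) \<le> w u" for n u
  proof (cases "n \<ge> n0 \<and> 0 < u \<and> u \<le> real n / x2")
    case True
    then have n: "n \<ge> n0" and u: "0 < u" "u \<le> real n / x2" by auto
    have npos: "real n > 0" using n0[OF n] by simp
    have x: "0 \<le> u / real n" "u / real n \<le> 1"
      using u npos x2 by (auto simp: field_simps) (smt (verit) mult_le_cancel_left1 mult.commute)
    have Lpos: "L (real n / u) > 0" and Lle: "L (real n / u) \<le> L (real n) * (exp 1 * ((real n / u / real n) powr \<delta> + (real n / (real n / u)) powr \<delta>))"
    proof -
      have "x2 \<le> real n / u" using u x2 by (simp add: field_simps)
      then show "L (real n / u) > 0" "L (real n / u) \<le> L (real n) * (exp 1 * ((real n / u / real n) powr \<delta> + (real n / (real n / u)) powr \<delta>))"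
        using potter[of "real n / u" "real n / u"] potter[of "real n" "real n / u"] n0[OF n] x2 by auto
    qed
    have r: "real n / u / real n = 1 / u" "real n / (real n / u) = u" using npos by auto
    have "(1 / u) powr \<delta> = u powr (-\<delta>)" using u by (simp add: powr_divide powr_minus_divide)
    then have L2: "L (real n / u) / L (real n) \<le> exp 1 * (u powr \<delta> + u powr (-\<delta>))"
      using Lle Ln[OF n] unfolding r by (simp add: pos_divide_le_eq mult_ac add.commute)
    have P: "\<Psi> (s n u) / \<bar>s n u\<bar> powr \<alpha> \<le> K" "0 \<le> \<Psi> (s n u) / \<bar>s n u\<bar> powr \<alpha>"
      using \<Psi>_le[of "s n u"] s_nz[OF n u(1)] \<Psi>_nonneg by (auto simp: pos_divide_le_eq)
    have Q1: "0 \<le> Q n (u / real n)" "Q n (u / real n) \<le> min 1 u"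
      using Q_nonneg[OF x] Q_le_1[OF x, of n] Q_le[OF x, of n] npos by auto
    have "f n u \<le> D * u powr (-\<beta> - 1) * (exp 1 * (u powr \<delta> + u powr (-\<delta>))) * K * min 1 u"
      unfolding f_eq[OF n u] using L2 P Q1 D Lpos Ln[OF n] K
      by (intro mult_mono mult_left_mono mult_nonneg_nonneg) auto
    also have "\<dots> = (D * exp 1 * K) * (u powr (-\<beta> - 1) * (u powr \<delta> + u powr (-\<delta>)) * min 1 u)"
      by simp
    also have "\<dots> \<le> w u"
      unfolding w_def using potter_factor_le_majorant[OF u(1) \<delta>(1), of \<beta>] D K by (intro mult_left_mono) auto
    finally have "f n u \<le> w u" .
    moreover have "0 \<le> f n u"
      unfolding f_eq[OF n u] using D Lpos Ln[OF n] P Q1 by (intro mult_nonneg_nonneg) auto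
    ultimately show ?thesis by simp
  next
    case False
    then show ?thesis using w_nonneg by (auto simp: f_def)
  qed
  have g_meas [measurable]: "g \<in> borel_measurable lborel"
    by (rule borel_measurable_LIMSEQ_real[where u = f]) (use f_lim in auto)
  have lim1: "(\<lambda>n. \<integral>u. f n u \<partial>lborel) \<longlonglongrightarrow> (\<integral>u. g u \<partial>lborel)"
    by (rule integral_dominated_convergence[OF _ _ w_int]) (use f_lim f_bound in auto)
  have "(\<integral>u. g u \<partial>lborel) = (\<integral>u. D * l * (indicator {0<..} u *\<^sub>R (Qlim u * u powr (-\<beta> - 1))) \<partial>lborel)"
    unfolding g_def by (intro Bochner_Integration.integral_cong) auto
  also have "\<dots> = D * l * (LBINT u:{0<..}. Qlim u * u powr (-\<beta> - 1))"
    unfolding set_lebesgue_integral_def by (rule integral_mult_right_zero)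
  finally have g_integral: "(\<integral>u. g u \<partial>lborel) = D * l * (LBINT u:{0<..}. Qlim u * u powr (-\<beta> - 1))" .
  define F where "F = (\<lambda>n x. p x * (\<Psi> (y / (x powr (1 / \<alpha>') * a n)) * Q n x))"
  have [measurable]: "F n \<in> borel_measurable borel" for n
    unfolding F_def by measurable
  have F_bound: "\<bar>F n x\<bar> \<le> (K * \<bar>y / a n\<bar> powr \<alpha>) * x powr (- \<alpha> / \<alpha>') * (p x * Q n x)" and F_nonneg: "0 \<le> F n x"
    for n x
  proof -
    have pQ: "0 \<le> p x * Q n x" using p0[of x] p_nonneg[of x] Q_nonneg[of x n] by (cases "x \<in> {0<..<1}") auto
    have F_eq: "F n x = \<Psi> (y / (x powr (1 / \<alpha>') * a n)) * (p x * Q n x)"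
      by (simp add: F_def)
    show F0: "0 \<le> F n x"
      unfolding F_eq by (rule mult_nonneg_nonneg[OF \<Psi>_nonneg pQ])
    have "F n x \<le> K * \<bar>y / (x powr (1 / \<alpha>') * a n)\<bar> powr \<alpha> * (p x * Q n x)"
      unfolding F_eq by (rule mult_right_mono[OF \<Psi>_le pQ])
    also have "K * \<bar>y / (x powr (1 / \<alpha>') * a n)\<bar> powr \<alpha> = (K * \<bar>y / a n\<bar> powr \<alpha>) * x powr (- \<alpha> / \<alpha>')"
    proof -
      have "x powr (- \<alpha> / \<alpha>') = inverse (x powr (\<alpha> / \<alpha>'))"
        using powr_minus[of x "\<alpha> / \<alpha>'"] by simp
      then show ?thesis
        by (simp add: abs_divide abs_mult powr_divide powr_mult powr_powr field_simps)
    qed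
    finally show "\<bar>F n x\<bar> \<le> (K * \<bar>y / a n\<bar> powr \<alpha>) * x powr (- \<alpha> / \<alpha>') * (p x * Q n x)"
      using F0 by simp
  qed
  have F_int: "integrable lborel (F n)" for n
  proof (rule Bochner_Integration.integrable_bound)
    show "integrable lborel (\<lambda>x. B * p x)"
      using p_int by (rule integrable_mult_right)
    show "AE x in lborel. norm (F n x) \<le> norm (B * p x)"
    proof (rule AE_I2)
      fix x
      have "F n x \<le> B * p x"
      proof (cases "x \<in> {0<..<1}")
        case True
        have "\<Psi> (y / (x powr (1 / \<alpha>') * a n)) * Q n x \<le> B * 1"
          using True \<Psi>_bdd \<Psi>_nonneg Q_nonneg[of x n] Q_le_1[of x n] order_trans[OF \<Psi>_nonneg \<Psi>_bdd]
          by (intro mult_mono) auto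
        then show ?thesis using mult_left_mono[OF _ p_nonneg[of x]] by (fastforce simp: F_def mult.commute)
      qed (simp add: F_def p0)
      then show "norm (F n x) \<le> norm (B * p x)" using F_nonneg[of n x] by simp
    qed
  qed measurable
  define F1 where "F1 = (\<lambda>n x. if x \<le> 1 / x2 then F n x else 0)"
  define F2 where "F2 = (\<lambda>n x. if x \<le> 1 / x2 then 0 else F n x)"
  have F12_meas [measurable]: "F1 n \<in> borel_measurable borel" "F2 n \<in> borel_measurable borel" for n
    unfolding F1_def F2_def by measurable
  have F1_int: "integrable lborel (F1 n)" and F2_int: "integrable lborel (F2 n)" for n
    by (rule Bochner_Integration.integrable_bound[OF F_int]; auto simp: F1_def F2_def)+
  have split: "(\<integral>x. F n x \<partial>lborel) = (\<integral>x. F1 n x \<partial>lborel) + (\<integral>x. F2 n x \<partial>lborel)" for n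
  proof -
    have "(\<integral>x. F n x \<partial>lborel) = (\<integral>x. F1 n x + F2 n x \<partial>lborel)"
      by (intro Bochner_Integration.integral_cong) (auto simp: F1_def F2_def)
    then show ?thesis using F1_int F2_int by simp
  qed
  have F1_eq: "real (m n) * (\<integral>x. F1 n x \<partial>lborel) = (\<integral>u. f n u \<partial>lborel)" if n: "n \<ge> n0" for n
  proof -
    have npos: "real n > 0" using n0[OF n] by simp
    have "(\<integral>x. F1 n x \<partial>lborel) = \<bar>1 / real n\<bar> *\<^sub>R (\<integral>u. F1 n (0 + 1 / real n * u) \<partial>lborel)"
      by (rule lborel_integral_real_affine) (use npos in auto)
    then have "real (m n) * (\<integral>x. F1 n x \<partial>lborel) = (\<integral>u. real (m n) / real n * F1 n (u / real n) \<partial>lborel)"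
      using npos by simp
    also have "\<dots> = (\<integral>u. f n u \<partial>lborel)"
    proof (intro Bochner_Integration.integral_cong refl)
      fix u :: real
      have "u / real n \<le> 1 / x2 \<longleftrightarrow> u \<le> real n / x2" using npos x2 by (simp add: field_simps)
      moreover have "p (u / real n) = 0" if "\<not> 0 < u" using that npos by (intro p0) (auto simp: field_simps)
      ultimately show "real (m n) / real n * F1 n (u / real n) = f n u"
        using n unfolding F1_def F_def f_def s_def by auto
    qed
    finally show ?thesis .
  qed
  have F2_lim: "(\<lambda>n. real (m n) * (\<integral>x. F2 n x \<partial>lborel)) \<longlonglongrightarrow> 0"
  proof (rule Lim_null_comparison)
    define c where "c = K * \<bar>y\<bar> powr \<alpha> * x2 powr (\<alpha> / \<alpha>') / C * (\<integral>x. p x \<partial>lborel)"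
    show "\<forall>\<^sub>F n in sequentially. norm (real (m n) * (\<integral>x. F2 n x \<partial>lborel)) \<le> c * inverse (real n powr \<beta> * L (real n))"
      using eventually_ge_at_top[of n0]
    proof eventually_elim
      case (elim n)
      have "(\<integral>x. F2 n x \<partial>lborel) \<le> (\<integral>x. (K * \<bar>y / a n\<bar> powr \<alpha>) * x2 powr (\<alpha> / \<alpha>') * p x \<partial>lborel)"
      proof (rule integral_mono[OF F2_int])
        show "integrable lborel (\<lambda>x. (K * \<bar>y / a n\<bar> powr \<alpha>) * x2 powr (\<alpha> / \<alpha>') * p x)"
          using p_int by (rule integrable_mult_right)
        fix x
        show "F2 n x \<le> (K * \<bar>y / a n\<bar> powr \<alpha>) * x2 powr (\<alpha> / \<alpha>') * p x"
        proof (cases "x \<le> 1 / x2 \<or> x \<notin> {0<..<1}")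
          case True
          then show ?thesis using p0[of x] p_nonneg[of x] K by (auto simp: F2_def F_def)
        next
          case False
          then have x: "x > 1 / x2" "x \<in> {0<..<1}" by auto
          have "F2 n x \<le> (K * \<bar>y / a n\<bar> powr \<alpha>) * x powr (- \<alpha> / \<alpha>') * (p x * Q n x)"
            using x F_bound[of n x] by (simp add: F2_def)
          also have "\<dots> \<le> (K * \<bar>y / a n\<bar> powr \<alpha>) * x2 powr (\<alpha> / \<alpha>') * (p x * 1)"
          proof (intro mult_mono mult_left_mono)
            have "x powr (- \<alpha> / \<alpha>') = (1 / x) powr (\<alpha> / \<alpha>')"
              using x powr_minus[of x "\<alpha> / \<alpha>'"] powr_divide[of 1 x "\<alpha> / \<alpha>'"] by (simp add: inverse_eq_divide)
            also have "\<dots> \<le> x2 powr (\<alpha> / \<alpha>')"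
              using x x2 \<alpha> \<alpha>' by (intro powr_mono2) (auto simp: field_simps)
            finally show "x powr (- \<alpha> / \<alpha>') \<le> x2 powr (\<alpha> / \<alpha>')" .
          qed (use K p_nonneg x Q_le_1[of x n] Q_nonneg[of x n] in auto)
          finally show ?thesis by simp
        qed
      qed
      also have "\<dots> = (K * \<bar>y / a n\<bar> powr \<alpha>) * x2 powr (\<alpha> / \<alpha>') * (\<integral>x. p x \<partial>lborel)" by simp
      also have "\<bar>y / a n\<bar> powr \<alpha> = \<bar>y\<bar> powr \<alpha> / (C * real n powr \<beta> * real (m n) * L (real n))"
        using a_pos[OF elim] by (simp add: abs_divide powr_divide a_powr[OF elim])
      finally have "real (m n) * (\<integral>x. F2 n x \<partial>lborel) \<le> real (m n) * ((K * (\<bar>y\<bar> powr \<alpha> / (C * real n powr \<beta> * real (m n) * L (real n)))) * x2 powr (\<alpha> / \<alpha>') * (\<integral>x. p x \<partial>lborel))"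
        by (intro mult_left_mono) auto
      also have "\<dots> = c * inverse (real n powr \<beta> * L (real n))"
        using mn[OF elim] by (simp add: c_def field_simps)
      finally have "real (m n) * (\<integral>x. F2 n x \<partial>lborel) \<le> c * inverse (real n powr \<beta> * L (real n))" .
      moreover have "0 \<le> (\<integral>x. F2 n x \<partial>lborel)"
        using F_nonneg by (intro integral_nonneg_AE) (auto simp: F2_def)
      ultimately show ?case by simp
    qed
    have "filterlim (\<lambda>n. real n powr \<beta> * L (real n)) at_top sequentially"
      using slowly_varying_powr_limits(2)[OF L \<beta>(2)] by (rule filterlim_compose[OF _ filterlim_real_sequentially])
    then have "(\<lambda>n. inverse (real n powr \<beta> * L (real n))) \<longlonglongrightarrow> 0"
      by (rule tendsto_inverse_0_at_top)
    then show "(\<lambda>n. c * inverse (real n powr \<beta> * L (real n))) \<longlonglongrightarrow> 0"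
      using tendsto_mult[OF tendsto_const[of c]] by fastforce
  qed
  have "(\<lambda>n. (\<integral>u. f n u \<partial>lborel) + real (m n) * (\<integral>x. F2 n x \<partial>lborel)) \<longlonglongrightarrow>
     D * l * (LBINT u:{0<..}. Qlim u * u powr (-\<beta> - 1)) + 0"
    by (intro tendsto_add F2_lim lim1[unfolded g_integral])
  moreover have "\<forall>\<^sub>F n in sequentially. (\<integral>u. f n u \<partial>lborel) + real (m n) * (\<integral>x. F2 n x \<partial>lborel) = real (m n) * (\<integral>x. F n x \<partial>lborel)"
    using eventually_ge_at_top[of n0]
    by eventually_elim (simp add: split F1_eq[symmetric] distrib_left)
  ultimately have "(\<lambda>n. real (m n) * (\<integral>x. F n x \<partial>lborel)) \<longlonglongrightarrow> D * l * (LBINT u:{0<..}. Qlim u * u powr (-\<beta> - 1)) + 0"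
    by (rule Lim_transform_eventually)
  then show "(\<lambda>n. real (m n) * (\<integral>x. p x * (\<Psi> (y / (x powr (1 / \<alpha>') * a n)) * Q n x) \<partial>lborel)) \<longlonglongrightarrow>
       \<bar>y\<bar> powr \<alpha> * l / C * (LBINT u:{0<..}. Qlim u * u powr (-\<beta> - 1))"
    by (simp add: F_def D_def)
qed

section \<open>The continuity theorem for characteristic functions in several variables\<close>

text \<open>The functions whose expectations are determined by characteristic functions. They form an algebra,
  as the Stone-Weierstrass theorem requires.\<close>

inductive trig_poly :: "nat \<Rightarrow> ((nat \<Rightarrow> real) \<Rightarrow> complex) \<Rightarrow> bool" for d where
  exp: "trig_poly d (\<lambda>x. c * iexp (\<Sum>k<d. \<theta> k * x k))"
| add: "trig_poly d f \<Longrightarrow> trig_poly d g \<Longrightarrow> trig_poly d (\<lambda>x. f x + g x)"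

lemma trig_poly_mult:
  assumes "trig_poly d f" "trig_poly d g"
  shows "trig_poly d (\<lambda>x. f x * g x)"
  using assms(1)
proof induction
  case (exp c \<theta>)
  show ?case
    using assms(2)
  proof induction
    case (exp c' \<theta>')
    have "(\<lambda>x. (c * c') * iexp (\<Sum>k<d. (\<theta> k + \<theta>' k) * x k)) =
      (\<lambda>x. c * iexp (\<Sum>k<d. \<theta> k * x k) *
           (c' * iexp (\<Sum>k<d. \<theta>' k * x k)))"
      by (intro ext) (simp add: distrib_right sum.distrib distrib_left exp_add mult_ac)
    then show ?case using trig_poly.exp[of d "c * c'" "\<lambda>k. \<theta> k + \<theta>' k"] by simp
  next
    case (add f g)
    then show ?case using trig_poly.add by (simp add: distrib_left)
  qed
next
  case (add f g)
  then show ?case using trig_poly.add by (simp add: distrib_right)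
qed

lemma trig_poly_const: "trig_poly d (\<lambda>_. c)"
  using trig_poly.exp[of d c "\<lambda>_. 0"] by simp

lemma sum_single_coordinate:
  fixes x :: "nat \<Rightarrow> real"
  assumes "k < d"
  shows "(\<Sum>j<d. (if j = k then v else 0) * x j) = v * x k"
proof -
  have "(\<Sum>j<d. (if j = k then v else 0) * x j) = (\<Sum>j<d. if j = k then v * x j else 0)"
    by (intro sum.cong) auto
  then show ?thesis using assms by simp
qed

lemma trig_poly_sin:
  assumes "k < d"
  shows "trig_poly d (\<lambda>x. complex_of_real (sin (w * x k)))"
proof -
  note s = sum_single_coordinate[OF assms]
  have "trig_poly d (\<lambda>x. 1 / (2 * \<i>) * iexp (\<Sum>j<d. (if j = k then w else 0) * x j)
     + (- 1 / (2 * \<i>)) * iexp (\<Sum>j<d. (if j = k then - w else 0) * x j))"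
    by (intro trig_poly.intros)
  also have "(\<lambda>x. 1 / (2 * \<i>) * iexp (\<Sum>j<d. (if j = k then w else 0) * x j)
     + (- 1 / (2 * \<i>)) * iexp (\<Sum>j<d. (if j = k then - w else 0) * x j)) =
     (\<lambda>x. complex_of_real (sin (w * x k)))"
    unfolding s by (intro ext) (simp add: sin_of_real[symmetric] sin_exp_eq field_simps)
  finally show ?thesis .
qed

lemma trig_poly_expectation_tendsto:
  fixes M :: "nat \<Rightarrow> 'a measure" and P :: "'b measure"
  assumes "\<And>n. prob_space (M n)" "prob_space P"
    and Y [measurable]: "\<And>n k. k < d \<Longrightarrow> Y n k \<in> borel_measurable (M n)"
    and Z [measurable]: "\<And>k. k < d \<Longrightarrow> Z k \<in> borel_measurable P"
    and char_conv: "\<And>\<theta>. (\<lambda>n. \<integral>\<omega>. iexp (\<Sum>k<d. \<theta> k * Y n k \<omega>) \<partial>M n)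
      \<longlonglongrightarrow> (\<integral>\<omega>. iexp (\<Sum>k<d. \<theta> k * Z k \<omega>) \<partial>P)"
    and g: "trig_poly d g"
  shows "(\<forall>n. integrable (M n) (\<lambda>\<omega>. g (\<lambda>k. Y n k \<omega>))) \<and> integrable P (\<lambda>\<omega>. g (\<lambda>k. Z k \<omega>)) \<and>
    (\<lambda>n. \<integral>\<omega>. g (\<lambda>k. Y n k \<omega>) \<partial>M n) \<longlonglongrightarrow> (\<integral>\<omega>. g (\<lambda>k. Z k \<omega>) \<partial>P)"
  using g
proof induction
  case (exp c \<theta>)
  interpret M: prob_space "M n" for n by fact
  interpret P: prob_space P by fact
  have "integrable (M n) (\<lambda>\<omega>. iexp (\<Sum>k<d. \<theta> k * Y n k \<omega>))" for n
    by (rule M.integrable_const_bound[where B = 1]) (auto intro!: AE_I2)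
  moreover have "integrable P (\<lambda>\<omega>. iexp (\<Sum>k<d. \<theta> k * Z k \<omega>))"
    by (rule P.integrable_const_bound[where B = 1]) (auto intro!: AE_I2)
  ultimately show ?case
    using tendsto_mult[OF tendsto_const[of c] char_conv[of \<theta>]]
    by (simp del: of_real_sum of_real_mult)
next
  case (add f g)
  then show ?case by (simp add: tendsto_add)
qed

text \<open>Take \<open>w = pi / (2 R)\<close>. On the cube \<open>[-R, R]\<^sup>d\<close> one has \<open>x\<^sub>k = arcsin (sin (w x\<^sub>k)) / w\<close>, so there \<open>f\<close> is a
  continuous function \<open>H\<close> of the sines. Approximating \<open>H\<close> by a polynomial on \<open>[-1, 1]\<^sup>d\<close> gives a trigonometric
  polynomial that is close to \<open>f\<close> on the cube and, being a function of sines, bounded on all of \<open>\<real>\<^sup>d\<close>.\<close>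

lemma continuous_map_trig_poly_approx:
  fixes f :: "(nat \<Rightarrow> real) \<Rightarrow> real"
  assumes f: "continuous_map (product_topology (\<lambda>_. euclideanreal) {..<d}) euclideanreal f"
    and R: "R > 0" and \<epsilon>: "\<epsilon> > 0" and B: "\<And>x. \<bar>f (\<lambda>k\<in>{..<d}. x k)\<bar> \<le> B"
  shows "\<exists>g. trig_poly d (\<lambda>x. complex_of_real (g x)) \<and>
     (\<forall>x. \<bar>g x\<bar> \<le> B + \<epsilon>) \<and> (\<forall>x. (\<forall>k<d. \<bar>x k\<bar> \<le> R) \<longrightarrow> \<bar>f (\<lambda>k\<in>{..<d}. x k) - g x\<bar> \<le> \<epsilon>)"
proof -
  define w where "w = pi / (2 * R)"
  have w: "w > 0" using R by (simp add: w_def)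
  define S where "S = (\<Pi>\<^sub>E k\<in>{..<d}. {-1..1::real})"
  define H where "H = (\<lambda>s::nat \<Rightarrow> real. f (\<lambda>k\<in>{..<d}. arcsin (s k) / w))"
  have "S = (\<Pi>\<^sub>E k\<in>UNIV. if k < d then {-1..1} else {undefined})"
  proof (rule set_eqI)
    fix x :: "nat \<Rightarrow> real"
    have "x \<in> S \<longleftrightarrow> (\<forall>k. (k < d \<longrightarrow> x k \<in> {-1..1}) \<and> (\<not> k < d \<longrightarrow> x k = undefined))"
      unfolding S_def PiE_iff extensional_def mem_Collect_eq lessThan_iff Ball_def by blast
    also have "\<dots> \<longleftrightarrow> (\<forall>k. x k \<in> (if k < d then {-1..1} else {undefined}))"
      by (intro all_cong1) simp
    finally show "x \<in> S \<longleftrightarrow> x \<in> (\<Pi>\<^sub>E k\<in>UNIV. if k < d then {-1..1} else {undefined})"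
      by (simp only: PiE_UNIV_domain Pi_iff ball_UNIV)
  qed
  then have compS: "compact S"
    using compactin_PiE[of "\<lambda>_::nat. euclideanreal" UNIV "\<lambda>k. if k < d then {-1..1} else {undefined}"]
    by (simp add: euclidean_product_topology)
  have contk: "continuous_on S (\<lambda>s. s k)" for k
    by (intro continuous_on_product_coordinates continuous_on_subset[OF _ subset_UNIV] continuous_intros)
  have contH: "continuous_on S H"
  proof -
    have "continuous_map (top_of_set S) (product_topology (\<lambda>_. euclideanreal) {..<d})
       (\<lambda>s. \<lambda>k\<in>{..<d}. arcsin (s k) / w)"
      unfolding continuous_map_componentwise
    proof safe
      fix k assume "k < d"
      then have "continuous_on S (\<lambda>s. arcsin (s k) / w)"
        using w by (intro continuous_intros contk) (auto simp: S_def PiE_iff)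
      then show "continuous_map (top_of_set S) euclideanreal (\<lambda>s. (\<lambda>k\<in>{..<d}. arcsin (s k) / w) k)"
        using \<open>k < d\<close> by simp
    qed auto
    from continuous_map_compose[OF this f] show ?thesis
      by (simp add: H_def o_def)
  qed
  define Q where "Q = (\<lambda>g :: (nat \<Rightarrow> real) \<Rightarrow> real. continuous_on S g \<and>
     trig_poly d (\<lambda>x. complex_of_real (g (\<lambda>k\<in>{..<d}. sin (w * x k)))))"
  have "\<exists>g. Q g \<and> (\<forall>s\<in>S. \<bar>H s - g s\<bar> < \<epsilon>)"
  proof (rule Stone_Weierstrass_HOL)
    fix x y :: "nat \<Rightarrow> real" assume xy: "x \<in> S \<and> y \<in> S \<and> x \<noteq> y"
    then obtain k where k: "k < d" "x k \<noteq> y k"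
      unfolding S_def by (metis PiE_ext lessThan_iff)
    have "Q (\<lambda>s. s k)" using contk trig_poly_sin[OF k(1)] k(1) by (simp add: Q_def)
    with k show "\<exists>g. Q g \<and> g x \<noteq> g y" by blast
  next
    fix g h assume "Q g \<and> Q h"
    then show "Q (\<lambda>x. g x * h x)"
      using trig_poly_mult[of d "\<lambda>x. complex_of_real (g (\<lambda>k\<in>{..<d}. sin (w * x k)))"
          "\<lambda>x. complex_of_real (h (\<lambda>k\<in>{..<d}. sin (w * x k)))"]
      by (auto simp: Q_def intro: continuous_intros)
  next
    fix g h assume "Q g \<and> Q h"
    then show "Q (\<lambda>x. g x + h x)"
      using trig_poly.add[of d "\<lambda>x. complex_of_real (g (\<lambda>k\<in>{..<d}. sin (w * x k)))"
          "\<lambda>x. complex_of_real (h (\<lambda>k\<in>{..<d}. sin (w * x k)))"]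
      by (auto simp: Q_def intro: continuous_intros)
  qed (use compS contH \<epsilon> trig_poly_const in \<open>auto simp: Q_def\<close>)
  then obtain g where g: "Q g" "\<And>s. s \<in> S \<Longrightarrow> \<bar>H s - g s\<bar> < \<epsilon>" by blast
  define s where "s = (\<lambda>x :: nat \<Rightarrow> real. \<lambda>k\<in>{..<d}. sin (w * x k))"
  have s: "s x \<in> S" for x by (auto simp: s_def S_def)
  have HB: "\<bar>H t\<bar> \<le> B" for t using B[of "\<lambda>k. arcsin (t k) / w"] by (simp add: H_def)
  show ?thesis
  proof (intro exI[of _ "\<lambda>x. g (s x)"] conjI allI impI)
    show "trig_poly d (\<lambda>x. complex_of_real (g (s x)))"
      using g(1) by (simp add: Q_def s_def)
    fix x :: "nat \<Rightarrow> real"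
    show "\<bar>g (s x)\<bar> \<le> B + \<epsilon>" using g(2)[OF s[of x]] HB[of "s x"] by linarith
    assume x: "\<forall>k<d. \<bar>x k\<bar> \<le> R"
    have "arcsin (sin (w * x k)) / w = x k" if "k < d" for k
    proof -
      have "\<bar>w * x k\<bar> \<le> w * R" using x that w by (simp add: abs_mult)
      also have "w * R = pi / 2" using R by (simp add: w_def)
      finally show ?thesis using w by (subst arcsin_sin) auto
    qed
    then have "H (s x) = f (\<lambda>k\<in>{..<d}. x k)"
      unfolding H_def by (intro arg_cong[where f = f] ext) (auto simp: s_def)
    then show "\<bar>f (\<lambda>k\<in>{..<d}. x k) - g (s x)\<bar> \<le> \<epsilon>" using g(2)[OF s[of x]] by simp
  qed
qed

lemma measurable_continuous_map_coordinates:
  fixes f :: "(nat \<Rightarrow> real) \<Rightarrow> real"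
  assumes f: "continuous_map (product_topology (\<lambda>_. euclideanreal) {..<d}) euclideanreal f"
    and Y [measurable]: "\<And>k. k < d \<Longrightarrow> Y k \<in> borel_measurable M"
  shows "(\<lambda>\<omega>. f (\<lambda>k\<in>{..<d}. Y k \<omega>)) \<in> borel_measurable M"
proof -
  have "continuous_map euclidean (product_topology (\<lambda>_. euclideanreal) {..<d}) (\<lambda>x. \<lambda>k\<in>{..<d}. x k)"
    unfolding continuous_map_componentwise by auto
  from continuous_map_compose[OF this f]
  have "continuous_on UNIV (\<lambda>x. f (\<lambda>k\<in>{..<d}. x k))" by (simp add: o_def)
  then have [measurable]: "(\<lambda>x. f (\<lambda>k\<in>{..<d}. x k)) \<in> borel_measurable borel"
    by (rule borel_measurable_continuous_onI)
  have [measurable]: "(\<lambda>\<omega> k. if k < d then Y k \<omega> else 0) \<in> borel_measurable M"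
  proof (rule measurable_coordinatewise_then_product)
    fix i show "(\<lambda>\<omega>. if i < d then Y i \<omega> else 0) \<in> borel_measurable M"
      by (cases "i < d") auto
  qed
  have "(\<lambda>\<omega>. f (\<lambda>k\<in>{..<d}. (\<lambda>k. if k < d then Y k \<omega> else 0) k)) \<in> borel_measurable M"
    by measurable
  also have "(\<lambda>\<omega>. f (\<lambda>k\<in>{..<d}. (\<lambda>k. if k < d then Y k \<omega> else 0) k)) = (\<lambda>\<omega>. f (\<lambda>k\<in>{..<d}. Y k \<omega>))"
    by (intro ext arg_cong[where f = f]) auto
  finally show ?thesis .
qed

text \<open>Meant for a continuous upper bound \<open>D\<close> of the indicator of the complement of a large cube, inside which \<open>F\<close>
  and \<open>G\<close> differ by at most \<open>\<epsilon>\<close>.\<close>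

lemma (in prob_space) expectation_diff_le_tail:
  fixes F G D :: "'a \<Rightarrow> real"
  assumes [measurable]: "F \<in> borel_measurable M" and FB: "\<And>\<omega>. \<bar>F \<omega>\<bar> \<le> B"
    and G: "integrable M G" and D: "integrable M D"
    and close: "\<And>\<omega>. \<bar>F \<omega> - G \<omega>\<bar> \<le> \<epsilon> + c * D \<omega>"
    and D_le: "expectation D \<le> \<epsilon>" and c: "0 \<le> c"
  shows "\<bar>expectation F - expectation G\<bar> \<le> \<epsilon> + c * \<epsilon>"
proof -
  have F: "integrable M F"
    by (rule integrable_const_bound[where B = B]) (use FB in auto)
  have "\<bar>expectation F - expectation G\<bar> = \<bar>\<integral>\<omega>. F \<omega> - G \<omega> \<partial>M\<bar>"
    using F G by simp
  also have "\<dots> \<le> (\<integral>\<omega>. \<bar>F \<omega> - G \<omega>\<bar> \<partial>M)"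
    by (rule integral_abs_bound)
  also have "\<dots> \<le> (\<integral>\<omega>. \<epsilon> + c * D \<omega> \<partial>M)"
    using F G D close by (intro integral_mono) auto
  also have "\<dots> = \<epsilon> + c * expectation D"
    using D by (simp add: prob_space)
  also have "\<dots> \<le> \<epsilon> + c * \<epsilon>"
    using D_le c by (simp add: mult_left_mono)
  finally show ?thesis .
qed

text \<open>Tightness of each coordinate follows from the one-dimensional continuity theorem, so a large cube
  carries almost all the mass for every large \<open>n\<close>. On it \<open>f\<close> is replaced by a trigonometric polynomial,
  whose expectations converge by hypothesis.\<close>

lemma levy_continuity_multivariate:
  fixes M :: "nat \<Rightarrow> 'a measure" and P :: "'b measure" and f :: "(nat \<Rightarrow> real) \<Rightarrow> real"
  assumes M: "\<And>n. prob_space (M n)" and P: "prob_space P"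
    and Y [measurable]: "\<And>n k. k < d \<Longrightarrow> Y n k \<in> borel_measurable (M n)"
    and Z [measurable]: "\<And>k. k < d \<Longrightarrow> Z k \<in> borel_measurable P"
    and char_conv: "\<And>\<theta>. (\<lambda>n. \<integral>\<omega>. iexp (\<Sum>k<d. \<theta> k * Y n k \<omega>) \<partial>M n)
      \<longlonglongrightarrow> (\<integral>\<omega>. iexp (\<Sum>k<d. \<theta> k * Z k \<omega>) \<partial>P)"
    and f: "continuous_map (product_topology (\<lambda>_. euclideanreal) {..<d}) euclideanreal f"
    and bdd: "bounded (f ` (\<Pi>\<^sub>E k\<in>{..<d}. UNIV))"
  shows "(\<lambda>n. \<integral>\<omega>. f (\<lambda>k\<in>{..<d}. Y n k \<omega>) \<partial>M n) \<longlonglongrightarrow> (\<integral>\<omega>. f (\<lambda>k\<in>{..<d}. Z k \<omega>) \<partial>P)"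
proof (rule tendstoI)
  interpret M: prob_space "M n" for n by fact
  interpret P: prob_space P by fact
  fix e :: real assume e: "e > 0"
  obtain B where B: "B > 0" "\<And>x. x \<in> (\<Pi>\<^sub>E k\<in>{..<d}. UNIV) \<Longrightarrow> \<bar>f x\<bar> \<le> B"
    using bdd unfolding bounded_pos by auto
  have fB: "\<bar>f (\<lambda>k\<in>{..<d}. x k)\<bar> \<le> B" for x by (rule B(2)) auto
  define \<epsilon> where "\<epsilon> = min 1 (e / (4 * B + 6))"
  have \<epsilon>: "\<epsilon> > 0" "\<epsilon> \<le> 1"
    using e B(1) by (auto simp: \<epsilon>_def)
  have "\<epsilon> \<le> e / (4 * B + 6)" by (simp add: \<epsilon>_def)
  then have \<epsilon>_le: "\<epsilon> * (4 * B + 6) \<le> e"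
    using B(1) by (subst (asm) pos_le_divide_eq) auto
  \<comment> \<open>A continuous function that is at least 1 outside \<open>[-R, R]\<^sup>d\<close>, so that weak
    convergence of the coordinates applies to it directly.\<close>
  define D where "D = (\<lambda>R (x :: nat \<Rightarrow> real). \<Sum>k<d. min 1 (\<bar>x k\<bar> / R))"
  have D_nonneg: "D R x \<ge> 0" if "R > 0" for R x
    unfolding D_def using that by (intro sum_nonneg) auto
  have D_ge1: "D R x \<ge> 1" if "R > 0" "k < d" "\<bar>x k\<bar> > R" for R x k
  proof -
    have "1 = min 1 (\<bar>x k\<bar> / R)" using that by (simp add: min_def field_simps)
    also have "\<dots> \<le> D R x" unfolding D_def
      by (rule member_le_sum) (use that in auto)
    finally show ?thesis .
  qed
  have D_int_Y: "integrable (M n) (\<lambda>\<omega>. D R (\<lambda>k. Y n k \<omega>))" if "R > 0" for n R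
    unfolding D_def
    by (intro Bochner_Integration.integrable_sum M.integrable_const_bound[where B = 1]) (use that in auto)
  have D_int_Z: "integrable P (\<lambda>\<omega>. D R (\<lambda>k. Z k \<omega>))" if "R > 0" for R
    unfolding D_def
    by (intro Bochner_Integration.integrable_sum P.integrable_const_bound[where B = 1]) (use that in auto)
  have "(\<lambda>j. \<integral>\<omega>. D (real (Suc j)) (\<lambda>k. Z k \<omega>) \<partial>P) \<longlonglongrightarrow> (\<integral>\<omega>. 0 \<partial>P)"
  proof (rule integral_dominated_convergence[where w = "\<lambda>_. real d"])
    show "AE \<omega> in P. (\<lambda>j. D (real (Suc j)) (\<lambda>k. Z k \<omega>)) \<longlonglongrightarrow> 0"
    proof (rule AE_I2)
      fix \<omega>
      have "(\<lambda>j. \<Sum>k<d. min 1 (\<bar>Z k \<omega>\<bar> / real (Suc j))) \<longlonglongrightarrow> (\<Sum>k<d. min 1 0)"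
        by (intro tendsto_sum tendsto_min tendsto_const LIMSEQ_Suc[OF lim_const_over_n])
      then show "(\<lambda>j. D (real (Suc j)) (\<lambda>k. Z k \<omega>)) \<longlonglongrightarrow> 0" by (simp add: D_def)
    qed
    show "AE \<omega> in P. norm (D (real (Suc j)) (\<lambda>k. Z k \<omega>)) \<le> real d" for j
    proof (rule AE_I2)
      fix \<omega>
      have "D (real (Suc j)) (\<lambda>k. Z k \<omega>) \<le> (\<Sum>k<d. 1)" unfolding D_def by (intro sum_mono) auto
      then show "norm (D (real (Suc j)) (\<lambda>k. Z k \<omega>)) \<le> real d" using D_nonneg[of "real (Suc j)" "\<lambda>k. Z k \<omega>"] by simp
    qed
    show "(\<lambda>\<omega>. D (real (Suc j)) (\<lambda>k. Z k \<omega>)) \<in> borel_measurable P" for j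
      unfolding D_def by measurable
  qed auto
  then have "eventually (\<lambda>j. (\<integral>\<omega>. D (real (Suc j)) (\<lambda>k. Z k \<omega>) \<partial>P) < \<epsilon>) sequentially"
    using \<epsilon>(1) by (intro order_tendstoD(2)) auto
  then obtain j where "(\<integral>\<omega>. D (real (Suc j)) (\<lambda>k. Z k \<omega>) \<partial>P) < \<epsilon>"
    by (auto simp: eventually_sequentially)
  then obtain R :: real where R: "R > 0" "(\<integral>\<omega>. D R (\<lambda>k. Z k \<omega>) \<partial>P) < \<epsilon>"
    by (metis of_nat_0_less_iff zero_less_Suc)
  have weak: "weak_conv_m (\<lambda>n. distr (M n) borel (Y n k)) (distr P borel (Z k))" if k: "k < d" for k
  proof (rule levy_continuity)
    show "real_distribution (distr (M n) borel (Y n k))" for n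
      by (rule M.real_distribution_distr) (use k in measurable)
    show "real_distribution (distr P borel (Z k))"
      by (rule P.real_distribution_distr) (use k in measurable)
    fix t :: real
    note s = sum_single_coordinate[OF k]
    have "char (distr (M n) borel (Y n k)) t = (\<integral>\<omega>. iexp (t * Y n k \<omega>) \<partial>M n)" for n
      unfolding char_def using k by (subst integral_distr) auto
    moreover have "char (distr P borel (Z k)) t = (\<integral>\<omega>. iexp (t * Z k \<omega>) \<partial>P)"
      unfolding char_def using k by (subst integral_distr) auto
    ultimately show "(\<lambda>n. char (distr (M n) borel (Y n k)) t) \<longlonglongrightarrow> char (distr P borel (Z k)) t"
      using char_conv[of "\<lambda>j. if j = k then t else 0"] unfolding s by simp
  qed
  have "(\<lambda>n. \<integral>\<omega>. min 1 (\<bar>Y n k \<omega>\<bar> / R) \<partial>M n) \<longlonglongrightarrow> (\<integral>\<omega>. min 1 (\<bar>Z k \<omega>\<bar> / R) \<partial>P)" if k: "k < d" for k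
  proof -
    have "(\<lambda>n. \<integral>x. min 1 (\<bar>x\<bar> / R) \<partial>distr (M n) borel (Y n k)) \<longlonglongrightarrow> (\<integral>x. min 1 (\<bar>x\<bar> / R) \<partial>distr P borel (Z k))"
    proof (rule weak_conv_imp_integral_bdd_continuous_conv[where B = 1, OF _ _ weak[OF k]])
      show "real_distribution (distr (M n) borel (Y n k))" for n
        by (rule M.real_distribution_distr) (use k in measurable)
      show "real_distribution (distr P borel (Z k))"
        by (rule P.real_distribution_distr) (use k in measurable)
      show "isCont (\<lambda>x. min 1 (\<bar>x\<bar> / R)) x" for x
        using R(1) by (intro continuous_intros) auto
      show "norm (min 1 (\<bar>x\<bar> / R)) \<le> 1" for x
        using R(1) by simp
    qed
    then show ?thesis using k by (simp add: integral_distr)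
  qed
  then have "(\<lambda>n. \<Sum>k<d. \<integral>\<omega>. min 1 (\<bar>Y n k \<omega>\<bar> / R) \<partial>M n) \<longlonglongrightarrow> (\<Sum>k<d. \<integral>\<omega>. min 1 (\<bar>Z k \<omega>\<bar> / R) \<partial>P)"
    by (intro tendsto_sum) auto
  moreover have "(\<Sum>k<d. \<integral>\<omega>. min 1 (\<bar>Y n k \<omega>\<bar> / R) \<partial>M n) = (\<integral>\<omega>. D R (\<lambda>k. Y n k \<omega>) \<partial>M n)" for n
    unfolding D_def
    by (subst Bochner_Integration.integral_sum) (use R(1) in \<open>auto intro!: M.integrable_const_bound[where B = 1]\<close>)
  moreover have "(\<Sum>k<d. \<integral>\<omega>. min 1 (\<bar>Z k \<omega>\<bar> / R) \<partial>P) = (\<integral>\<omega>. D R (\<lambda>k. Z k \<omega>) \<partial>P)"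
    unfolding D_def
    by (subst Bochner_Integration.integral_sum) (use R(1) in \<open>auto intro!: P.integrable_const_bound[where B = 1]\<close>)
  ultimately have evD: "eventually (\<lambda>n. (\<integral>\<omega>. D R (\<lambda>k. Y n k \<omega>) \<partial>M n) < \<epsilon>) sequentially"
    using R(2) by (auto intro: order_tendstoD(2))
  obtain g where g: "trig_poly d (\<lambda>x. complex_of_real (g x))" "\<And>x. \<bar>g x\<bar> \<le> B + \<epsilon>"
    "\<And>x. (\<forall>k<d. \<bar>x k\<bar> \<le> R) \<Longrightarrow> \<bar>f (\<lambda>k\<in>{..<d}. x k) - g x\<bar> \<le> \<epsilon>"
    using continuous_map_trig_poly_approx[OF f R(1) \<epsilon>(1) fB] by blast
  have close: "\<bar>f (\<lambda>k\<in>{..<d}. x k) - g x\<bar> \<le> \<epsilon> + (2 * B + \<epsilon>) * D R x" for x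
  proof (cases "\<forall>k<d. \<bar>x k\<bar> \<le> R")
    case True
    then show ?thesis using g(3)[of x] D_nonneg[OF R(1), of x] B(1) \<epsilon>(1)
      by (smt (verit) mult_nonneg_nonneg)
  next
    case False
    then have "1 \<le> D R x" using D_ge1 R(1) by (meson not_le)
    then have "(2 * B + \<epsilon>) * 1 \<le> (2 * B + \<epsilon>) * D R x" using B(1) \<epsilon>(1) by (intro mult_left_mono) auto
    moreover have "\<bar>f (\<lambda>k\<in>{..<d}. x k) - g x\<bar> \<le> (2 * B + \<epsilon>) * 1" using fB[of x] g(2)[of x] abs_triangle_ineq4[of "f (\<lambda>k\<in>{..<d}. x k)" "g x"] by simp
    ultimately show ?thesis using \<epsilon>(1) by linarith
  qed
  have T: "(\<forall>n. integrable (M n) (\<lambda>\<omega>. complex_of_real (g (\<lambda>k. Y n k \<omega>)))) \<and>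
      integrable P (\<lambda>\<omega>. complex_of_real (g (\<lambda>k. Z k \<omega>))) \<and>
      (\<lambda>n. \<integral>\<omega>. complex_of_real (g (\<lambda>k. Y n k \<omega>)) \<partial>M n) \<longlonglongrightarrow> (\<integral>\<omega>. complex_of_real (g (\<lambda>k. Z k \<omega>)) \<partial>P)"
    by (rule trig_poly_expectation_tendsto[where g = "\<lambda>x. complex_of_real (g x)", OF M P _ _ _ g(1)])
      (use Y Z char_conv in simp_all)
  have gY: "integrable (M n) (\<lambda>\<omega>. g (\<lambda>k. Y n k \<omega>))" for n
    using T by (auto simp: complex_of_real_integrable_eq)
  have gZ: "integrable P (\<lambda>\<omega>. g (\<lambda>k. Z k \<omega>))"
    using T by (auto simp: complex_of_real_integrable_eq)
  have g_lim: "(\<lambda>n. \<integral>\<omega>. g (\<lambda>k. Y n k \<omega>) \<partial>M n) \<longlonglongrightarrow> (\<integral>\<omega>. g (\<lambda>k. Z k \<omega>) \<partial>P)"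
    using T by (auto simp: tendsto_of_real_iff)
  have aZ: "\<bar>(\<integral>\<omega>. f (\<lambda>k\<in>{..<d}. Z k \<omega>) \<partial>P) - (\<integral>\<omega>. g (\<lambda>k. Z k \<omega>) \<partial>P)\<bar> \<le> \<epsilon> + (2 * B + \<epsilon>) * \<epsilon>"
    by (rule P.expectation_diff_le_tail[OF _ fB gZ D_int_Z[OF R(1)] close less_imp_le[OF R(2)]])
      (use B \<epsilon> in \<open>auto intro!: measurable_continuous_map_coordinates[OF f]\<close>)
  have "eventually (\<lambda>n. dist (\<integral>\<omega>. g (\<lambda>k. Y n k \<omega>) \<partial>M n) (\<integral>\<omega>. g (\<lambda>k. Z k \<omega>) \<partial>P) < \<epsilon>) sequentially"
    using g_lim \<epsilon>(1) by (rule tendstoD)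
  with evD show "eventually (\<lambda>n. dist (\<integral>\<omega>. f (\<lambda>k\<in>{..<d}. Y n k \<omega>) \<partial>M n) (\<integral>\<omega>. f (\<lambda>k\<in>{..<d}. Z k \<omega>) \<partial>P) < e) sequentially"
  proof eventually_elim
    case (elim n)
    have aY: "\<bar>(\<integral>\<omega>. f (\<lambda>k\<in>{..<d}. Y n k \<omega>) \<partial>M n) - (\<integral>\<omega>. g (\<lambda>k. Y n k \<omega>) \<partial>M n)\<bar> \<le> \<epsilon> + (2 * B + \<epsilon>) * \<epsilon>"
      by (rule M.expectation_diff_le_tail[OF _ fB gY D_int_Y[OF R(1)] close less_imp_le[OF elim(1)]])
        (use B \<epsilon> in \<open>auto intro!: measurable_continuous_map_coordinates[OF f]\<close>)
    have "2 * (\<epsilon> + (2 * B + \<epsilon>) * \<epsilon>) + \<epsilon> \<le> 2 * (\<epsilon> + (2 * B + 1) * \<epsilon>) + \<epsilon>"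
      using \<epsilon>(1,2) by (simp add: mult_right_mono)
    also have "\<dots> < \<epsilon> * (4 * B + 6)" using \<epsilon>(1) by (simp add: algebra_simps)
    also note \<epsilon>_le
    finally show ?case using aY aZ elim(2) by (simp add: dist_real_def)
  qed
qed

section \<open>Convergence to the Karlin stable process\<close>

text \<open>Sandwich \<open>m ln (1 - x)\<close> between \<open>- m x - 2 m x\<^sup>2\<close> and \<open>- m x\<close>; note that \<open>m x\<^sup>2 \<longlonglongrightarrow> 0\<close>.\<close>

lemma power_one_minus_tendsto_exp:
  fixes x :: "nat \<Rightarrow> real" and m :: "nat \<Rightarrow> nat"
  assumes m: "filterlim (\<lambda>n. real (m n)) at_top sequentially"
    and x: "\<And>n. 0 \<le> x n" and lim: "(\<lambda>n. real (m n) * x n) \<longlonglongrightarrow> c"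
  shows "(\<lambda>n. (1 - x n) ^ m n) \<longlonglongrightarrow> exp (- c)"
proof -
  have "(\<lambda>n. inverse (real (m n)) * (real (m n) * x n)) \<longlonglongrightarrow> 0 * c"
    by (intro tendsto_mult lim tendsto_inverse_0_at_top m)
  moreover have ev_m: "\<forall>\<^sub>F n in sequentially. real (m n) > 0"
    using m unfolding filterlim_at_top_dense by blast
  then have "\<forall>\<^sub>F n in sequentially. inverse (real (m n)) * (real (m n) * x n) = x n"
    by eventually_elim simp
  ultimately have x0: "x \<longlonglongrightarrow> 0"
    by (auto intro: Lim_transform_eventually)
  have ev: "\<forall>\<^sub>F n in sequentially. x n < 1/2"
    using order_tendstoD(2)[OF x0, of "1/2"] by simp
  have "(\<lambda>n. real (m n) * ln (1 - x n)) \<longlonglongrightarrow> - c"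
  proof (rule tendsto_sandwich)
    show "\<forall>\<^sub>F n in sequentially. - (real (m n) * x n) - 2 * (real (m n) * x n) * x n \<le> real (m n) * ln (1 - x n)"
      using ev
    proof eventually_elim
      case (elim n)
      have "real (m n) * (- x n - 2 * (x n)\<^sup>2) \<le> real (m n) * ln (1 - x n)"
        using elim x[of n] by (intro mult_left_mono ln_one_minus_pos_lower_bound) auto
      then show ?case by (simp add: algebra_simps power2_eq_square)
    qed
    show "\<forall>\<^sub>F n in sequentially. real (m n) * ln (1 - x n) \<le> - (real (m n) * x n)"
      using ev
    proof eventually_elim
      case (elim n)
      have "real (m n) * ln (1 - x n) \<le> real (m n) * (- x n)"
        using elim x[of n] by (intro mult_left_mono ln_one_minus_pos_upper_bound) auto
      then show ?case by simp
    qed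
    have "(\<lambda>n. - (real (m n) * x n) - 2 * (real (m n) * x n) * x n) \<longlonglongrightarrow> - c - 2 * c * 0"
      by (intro tendsto_intros lim x0)
    then show "(\<lambda>n. - (real (m n) * x n) - 2 * (real (m n) * x n) * x n) \<longlonglongrightarrow> - c" by simp
    show "(\<lambda>n. - (real (m n) * x n)) \<longlonglongrightarrow> - c" by (intro tendsto_intros lim)
  qed
  then have "(\<lambda>n. exp (real (m n) * ln (1 - x n))) \<longlonglongrightarrow> exp (- c)"
    by (intro tendsto_intros)
  moreover have "\<forall>\<^sub>F n in sequentially. exp (real (m n) * ln (1 - x n)) = (1 - x n) ^ m n"
    using ev by eventually_elim (simp add: exp_of_nat_mult)
  ultimately show ?thesis by (rule Lim_transform_eventually)
qed

lemma poisson_parity_expectation: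
  assumes N: "std_poisson_process W N" and \<tau>: "\<And>k. k < d \<Longrightarrow> 0 \<le> \<tau> k" and \<alpha>: "\<alpha> > 0"
  shows "(\<integral>\<omega>. \<bar>\<Sum>k<d. \<theta> k * of_bool (odd (N (\<tau> k) \<omega>))\<bar> powr \<alpha> \<partial>W) =
    (\<Sum>e\<in>Pow {..<d} - {{}}. \<bar>\<Sum>k\<in>e. \<theta> k\<bar> powr \<alpha> * poisson_parity W N d \<tau> e)"
proof -
  interpret prob_space W using N by (simp add: std_poisson_process_def)
  define A where "A = (\<lambda>e. {\<omega> \<in> space W. parity_set d (\<lambda>k. N (\<tau> k) \<omega>) = e})"
  have A [measurable]: "A e \<in> sets W" for e
    unfolding A_def by (rule sets_parity_set_eq) (use std_poisson_process_measurable[OF N] \<tau> in auto)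
  have "(\<integral>\<omega>. \<bar>\<Sum>k<d. \<theta> k * of_bool (odd (N (\<tau> k) \<omega>))\<bar> powr \<alpha> \<partial>W) =
    (\<integral>\<omega>. (\<Sum>e\<in>Pow {..<d} - {{}}. \<bar>\<Sum>k\<in>e. \<theta> k\<bar> powr \<alpha> * indicator (A e) \<omega>) \<partial>W)"
  proof (intro Bochner_Integration.integral_cong refl)
    fix \<omega> assume w: "\<omega> \<in> space W"
    define e0 where "e0 = parity_set d (\<lambda>k. N (\<tau> k) \<omega>)"
    have "(\<Sum>k<d. \<theta> k * of_bool (odd (N (\<tau> k) \<omega>))) = (\<Sum>k\<in>e0. \<theta> k)"
      unfolding e0_def parity_set_def sum.inter_filter[OF finite_lessThan] by (intro sum.cong) auto
    moreover have "(\<Sum>e\<in>Pow {..<d} - {{}}. \<bar>\<Sum>k\<in>e. \<theta> k\<bar> powr \<alpha> * indicator (A e) \<omega>) =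
      (\<Sum>e\<in>Pow {..<d} - {{}}. if e = e0 then \<bar>\<Sum>k\<in>e. \<theta> k\<bar> powr \<alpha> else 0)"
      by (intro sum.cong refl) (use w in \<open>auto simp: A_def e0_def\<close>)
    moreover have "\<dots> = \<bar>\<Sum>k\<in>e0. \<theta> k\<bar> powr \<alpha>"
      using parity_set_subset[of d "\<lambda>k. N (\<tau> k) \<omega>"] \<alpha> by (auto simp: e0_def)
    ultimately show "\<bar>\<Sum>k<d. \<theta> k * of_bool (odd (N (\<tau> k) \<omega>))\<bar> powr \<alpha> =
      (\<Sum>e\<in>Pow {..<d} - {{}}. \<bar>\<Sum>k\<in>e. \<theta> k\<bar> powr \<alpha> * indicator (A e) \<omega>)" by simp
  qed
  also have "\<dots> = (\<Sum>e\<in>Pow {..<d} - {{}}. \<bar>\<Sum>k\<in>e. \<theta> k\<bar> powr \<alpha> * prob (A e))"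
    by (subst Bochner_Integration.integral_sum) (auto simp: less_top[symmetric])
  finally show ?thesis by (simp add: poisson_parity_def A_def)
qed

text \<open>The partial sum is the combination with \<open>d = 1\<close> and \<open>\<theta> = 1\<close>, a measurable function of the triples.\<close>

lemma aggregated_sum_measurable:
  assumes M: "prob_space M" and copies: "model_copies M Xs qs \<eta>s N X q \<eta>"
  shows "(\<lambda>\<omega>. aggregated_sum \<alpha>' m Xs qs \<eta>s n t \<omega>) \<in> borel_measurable M"
proof -
  interpret prob_space M by fact
  have Y: "(\<lambda>\<omega>. (Xs i \<omega>, qs i \<omega>, \<lambda>j\<in>{1..}. \<eta>s i j \<omega>)) \<in> M \<rightarrow>\<^sub>M borel \<Otimes>\<^sub>M borel \<Otimes>\<^sub>M eta_space"
    if "i \<in> {1..m n}" for i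
    using copies that unfolding model_copies_def iid_copies_def indep_vars_def by auto
  have "(\<lambda>\<omega>. \<Sum>i=1..m n. copy_contribution \<alpha>' 1 (\<lambda>_. 1) (\<lambda>k. nat \<lfloor>real n * t\<rfloor>) (Xs i \<omega>, qs i \<omega>, \<lambda>j\<in>{1..}. \<eta>s i j \<omega>) / 1) \<in> borel_measurable M"
    using measurable_compose[OF Y copy_contribution_measurable] by (intro borel_measurable_sum borel_measurable_divide) auto
  then show ?thesis
    unfolding aggregated_sum_eq_sum_contributions[where d = 1 and \<theta> = "\<lambda>_. 1" and t = "\<lambda>_. t" and a = 1, symmetric] by simp
qed

text \<open>The limit of \<open>m\<^sub>n D\<^sub>n\<close>: apply the scaling limit to each parity pattern \<open>e\<close> separately and reassemble the
  finitely many limits into the expectation over the Poisson process. The empty pattern is left out,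
  since its integral over \<open>u\<close> diverges while its value \<open>\<bar>0\<bar> powr \<alpha>\<close> vanishes.\<close>

lemma copies_times_defect_tendsto:
  fixes N :: "'b measure" and X q :: "'b \<Rightarrow> real" and t \<theta> :: "nat \<Rightarrow> real" and L :: "real \<Rightarrow> real"
    and m :: "nat \<Rightarrow> nat" and a :: "nat \<Rightarrow> real"
  assumes N: "prob_space N" and q: "q \<in> borel_measurable N" and X: "X \<in> borel_measurable N"
    and L: "slowly_varying L"
    and p_nonneg: "\<And>x. x \<in> {0<..<1} \<Longrightarrow> 0 \<le> x powr (-\<rho>) * L (1 / x)"
    and q_density:
      "distributed N lborel q
         (\<lambda>x. ennreal (if x \<in> {0<..<1} then x powr (-\<rho>) * L (1 / x) else 0))"
    and \<alpha>: "\<alpha> > 0" and \<alpha>': "\<alpha>' > 0" and \<beta>: "\<beta> = \<alpha> / \<alpha>' - 1 + \<rho>" "0 < \<beta>" "\<beta> < 1"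
    and defect_lim: "((\<lambda>s. char_defect N X s / \<bar>s\<bar> powr \<alpha>) \<longlongrightarrow> l) (at 0)"
    and m_pos: "\<And>n. n \<ge> 1 \<Longrightarrow> m n > 0"
    and m_growth: "filterlim (\<lambda>n. real (m n) * L (real n) / real n powr (1 - \<rho>)) at_top sequentially"
    and C: "C > 0" and a_def: "\<And>n. n \<ge> 1 \<Longrightarrow> a n = (C * real n powr \<beta> * real (m n) * L (real n)) powr (1 / \<alpha>)"
    and pois: "std_poisson_process W Npois" and t: "\<And>k. k < d \<Longrightarrow> 0 \<le> t k \<and> t k \<le> 1"
  shows "(\<lambda>n. real (m n) * (\<Sum>e\<in>Pow {..<d} - {{}}.
      (\<integral>\<omega>. char_defect N X ((\<Sum>k\<in>e. \<theta> k) / (q \<omega> powr (1 / \<alpha>') * a n)) *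
        bernoulli_parity d (\<lambda>k. nat \<lfloor>real n * t k\<rfloor>) n (q \<omega>) e \<partial>N)))
    \<longlonglongrightarrow> l / C * (LBINT u:{0<..}. (\<integral>\<omega>. \<bar>\<Sum>k<d. \<theta> k * of_bool (odd (Npois (t k * u) \<omega>))\<bar> powr \<alpha> \<partial>W) * u powr (-\<beta> - 1))"
proof -
  interpret prob_space N by fact
  let ?P = "Pow {..<d} - {{}}"
  let ?g = "\<lambda>e u. poisson_parity W Npois d (\<lambda>k. t k * u) e * u powr (-\<beta> - 1)"
  let ?E = "\<lambda>u. \<integral>\<omega>. \<bar>\<Sum>k<d. \<theta> k * of_bool (odd (Npois (t k * u) \<omega>))\<bar> powr \<alpha> \<partial>W"
  define \<Psi> where "\<Psi> = char_defect N X"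
  have \<Psi>_meas [measurable]: "\<Psi> \<in> borel_measurable borel" unfolding \<Psi>_def using X by measurable
  obtain K where K: "K > 0" "\<And>s. \<Psi> s \<le> K * \<bar>s\<bar> powr \<alpha>"
    using char_defect_le_powr[OF X \<alpha> defect_lim] unfolding \<Psi>_def by blast
  \<comment> \<open>Measurability of \<open>p\<close> on all of \<open>(0, 1)\<close> comes from its being a density; slow variation
    gives measurability of \<open>L\<close> only near infinity.\<close>
  define p where "p = (\<lambda>x. if x \<in> {0<..<1} then x powr (-\<rho>) * L (1 / x) else 0)"
  have p0: "0 \<le> p x" for x using p_nonneg by (auto simp: p_def)
  have dist: "distributed N lborel q (\<lambda>x. ennreal (p x))" using q_density by (simp add: p_def)
  have p_int: "integrable lborel p"
    using distributed_integrable[OF dist, of "\<lambda>_. 1"] p0 by simp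
  define Q where "Q = (\<lambda>e n x. bernoulli_parity d (\<lambda>k. nat \<lfloor>real n * t k\<rfloor>) n x e)"
  define I where "I = (\<lambda>e. LBINT u:{0<..}. ?g e u)"
  have Q_meas [measurable]: "Q e n \<in> borel_measurable borel" for e n
    unfolding Q_def bernoulli_parity_def by (intro borel_measurable_continuous_onI continuous_intros)
  have floor_le: "nat \<lfloor>real n * t k\<rfloor> \<le> n" if "k < d" for n k
  proof -
    have "real n * t k \<le> real n * 1" using t[OF that] by (intro mult_left_mono) auto
    then show ?thesis by linarith
  qed
  have Q_props: "0 \<le> x \<Longrightarrow> x \<le> 1 \<Longrightarrow> 0 \<le> Q e n x" "0 \<le> x \<Longrightarrow> x \<le> 1 \<Longrightarrow> Q e n x \<le> 1" for e n x
    unfolding Q_def by (auto intro: bernoulli_parity_nonneg bernoulli_parity_le_1)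
  have Q_le: "0 \<le> x \<Longrightarrow> x \<le> 1 \<Longrightarrow> Q e n x \<le> real n * x" if "e \<noteq> {}" for e n x
    unfolding Q_def using that floor_le by (intro bernoulli_parity_le) auto
  have Q_lim: "(\<lambda>n. Q e n (u / real n)) \<longlonglongrightarrow> poisson_parity W Npois d (\<lambda>k. t k * u) e"
    if "u > 0" "e \<subseteq> {..<d}" for e u
    unfolding Q_def using that t by (intro bernoulli_parity_tendsto[OF pois]) auto
  define y where "y = (\<lambda>e. \<Sum>k\<in>e. \<theta> k)"
  have summand_lim: "(\<lambda>n. real (m n) * (\<integral>\<omega>. \<Psi> (y e / (q \<omega> powr (1 / \<alpha>') * a n)) * Q e n (q \<omega>) \<partial>N)) \<longlonglongrightarrow>
      l / C * (\<bar>y e\<bar> powr \<alpha> * I e)" if e: "e \<in> ?P" for e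
  proof (cases "y e = 0")
    case True
    then show ?thesis using \<alpha> by (simp add: \<Psi>_def char_defect_def)
  next
    case False
    have "(\<lambda>n. real (m n) * (\<integral>x. p x * (\<Psi> (y e / (x powr (1 / \<alpha>') * a n)) * Q e n x) \<partial>lborel)) \<longlonglongrightarrow>
       \<bar>y e\<bar> powr \<alpha> * l / C * (LBINT u:{0<..}. ?g e u)"
    proof (rule mixture_integral_tendsto[where B = 2 and K = K and \<rho> = \<rho> and L = L, OF L _ p0 p_int _ \<alpha> \<alpha>' \<beta> \<Psi>_meas])
      show "((\<lambda>s. \<Psi> s / \<bar>s\<bar> powr \<alpha>) \<longlongrightarrow> l) (at 0)" using defect_lim by (simp add: \<Psi>_def)
      show "0 \<le> \<Psi> s" "\<Psi> s \<le> 2" for s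
        using char_defect_nonneg[OF X] char_defect_le_2[OF X] by (auto simp: \<Psi>_def)
    qed (use K Q_props Q_le Q_lim e m_pos m_growth C a_def False in \<open>auto simp: p_def\<close>)
    moreover have "(\<integral>\<omega>. \<Psi> (y e / (q \<omega> powr (1 / \<alpha>') * a n)) * Q e n (q \<omega>) \<partial>N) =
       (\<integral>x. p x * (\<Psi> (y e / (x powr (1 / \<alpha>') * a n)) * Q e n x) \<partial>lborel)" for n
      by (rule distributed_integral[OF dist, symmetric]) (use p0 in auto)
    ultimately show ?thesis by (simp add: I_def mult_ac)
  qed
  have "(\<lambda>n. \<Sum>e\<in>?P. real (m n) * (\<integral>\<omega>. \<Psi> (y e / (q \<omega> powr (1 / \<alpha>') * a n)) * Q e n (q \<omega>) \<partial>N)) \<longlonglongrightarrow>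
      (\<Sum>e\<in>?P. l / C * (\<bar>y e\<bar> powr \<alpha> * I e))"
    by (intro tendsto_sum summand_lim)
  also have "(\<Sum>e\<in>?P. l / C * (\<bar>y e\<bar> powr \<alpha> * I e)) = l / C * (\<Sum>e\<in>?P. \<bar>y e\<bar> powr \<alpha> * I e)"
    by (simp only: sum_distrib_left)
  also have "(\<Sum>e\<in>?P. \<bar>y e\<bar> powr \<alpha> * I e) =
      (LBINT u:{0<..}. (\<Sum>e\<in>?P. \<bar>y e\<bar> powr \<alpha> * ?g e u))"
  proof -
    have int: "set_integrable lborel {0<..} (\<lambda>u. ?g e u)"
      if e: "e \<in> ?P" for e
      by (rule mixture_limit_integrable[where Q = "Q e", OF \<beta>(2,3)])
        (use Q_props Q_le Q_lim e in auto)
    have "(LBINT u:{0<..}. (\<Sum>e\<in>?P. \<bar>y e\<bar> powr \<alpha> * ?g e u)) =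
      (\<integral>u. (\<Sum>e\<in>?P. \<bar>y e\<bar> powr \<alpha> *
        (indicator {0<..} u *\<^sub>R ?g e u)) \<partial>lborel)"
      unfolding set_lebesgue_integral_def
      by (intro Bochner_Integration.integral_cong refl) (simp add: sum_distrib_left mult.left_commute)
    also have "\<dots> = (\<Sum>e\<in>?P. \<bar>y e\<bar> powr \<alpha> * I e)"
      unfolding I_def set_lebesgue_integral_def
      by (subst Bochner_Integration.integral_sum)
        (use int in \<open>auto simp only: set_integrable_def integral_mult_right_zero intro!: integrable_mult_right\<close>)
    finally show ?thesis ..
  qed
  also have "\<dots> = (LBINT u:{0<..}. ?E u * u powr (-\<beta> - 1))"
  proof (rule set_lebesgue_integral_cong)
    show "\<forall>u. u \<in> {0<..} \<longrightarrow> (\<Sum>e\<in>?P. \<bar>y e\<bar> powr \<alpha> * ?g e u) =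
       ?E u * u powr (-\<beta> - 1)"
    proof (intro allI impI)
      fix u :: real assume "u \<in> {0<..}"
      then have "?E u =
        (\<Sum>e\<in>?P. \<bar>y e\<bar> powr \<alpha> * poisson_parity W Npois d (\<lambda>k. t k * u) e)"
        unfolding y_def by (intro poisson_parity_expectation[OF pois _ \<alpha>]) (use t in auto)
      then show "(\<Sum>e\<in>?P. \<bar>y e\<bar> powr \<alpha> * ?g e u) =
       ?E u * u powr (-\<beta> - 1)"
        by (simp only: sum_distrib_right mult.assoc)
    qed
  qed simp
  finally show ?thesis
    by (simp only: sum_distrib_left \<Psi>_def y_def Q_def)
qed

theorem theorem1p1:
  fixes N :: "'b measure" and X q :: "'b \<Rightarrow> real" and \<eta> :: "nat \<Rightarrow> 'b \<Rightarrow> nat"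
    and M :: "'a measure" and Xs qs :: "nat \<Rightarrow> 'a \<Rightarrow> real" and \<eta>s :: "nat \<Rightarrow> nat \<Rightarrow> 'a \<Rightarrow> nat"
    and W :: "'w measure" and Npois :: "real \<Rightarrow> 'w \<Rightarrow> nat"
    and P :: "'z measure" and \<zeta> :: "real \<Rightarrow> 'z \<Rightarrow> real"
    and L :: "real \<Rightarrow> real" and \<rho> \<alpha> \<alpha>' \<beta> \<gamma> CX :: real
    and m :: "nat \<Rightarrow> nat" and a :: "nat \<Rightarrow> real"
  assumes model: "single_model N X q \<eta>"
    and q_range: "\<And>\<omega>. \<omega> \<in> space N \<Longrightarrow> q \<omega> \<in> {0<..<1}"
    and rho: "\<rho> < 1"
    and L_slow: "slowly_varying L"
    and p_nonneg: "\<And>x. x \<in> {0<..<1} \<Longrightarrow> 0 \<le> x powr (-\<rho>) * L (1 / x)"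
    and q_density:
      "distributed N lborel q
         (\<lambda>x. ennreal (if x \<in> {0<..<1} then x powr (-\<rho>) * L (1 / x) else 0))"
    and X_sym: "symmetric_rv N X"
    and X_cond:
      "(\<alpha> = 2 \<and> integrable N (\<lambda>\<omega>. (X \<omega>)\<^sup>2) \<and> CX = (\<integral>\<omega>. (X \<omega>)\<^sup>2 \<partial>N)) \<or>
       (0 < \<alpha> \<and> \<alpha> < 2 \<and>
         (\<lambda>x. measure N {\<omega> \<in> space N. \<bar>X \<omega>\<bar> > x}) \<sim>[at_top] (\<lambda>x. CX * x powr (-\<alpha>)))"
    and CX_pos: "CX > 0"
    and alpha': "\<alpha>' > 0"
    and gamma: "\<gamma> = \<alpha> / \<alpha>'"
    and beta: "\<beta> = \<gamma> - 1 + \<rho>" "0 < \<beta>" "\<beta> < 1"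
    and m_pos: "\<And>n. n \<ge> 1 \<Longrightarrow> m n > 0"
    and m_incr: "mono_on {1..} m"
    and m_growth:
      "filterlim (\<lambda>n. real (m n) * L (real n) / real n powr (1 - \<rho>)) at_top sequentially"
    and a_def:
      "\<And>n. n \<ge> 1 \<Longrightarrow> a n =
         (CX * (Gamma (1 - \<beta>) / \<beta>) * real n powr \<beta> * real (m n) * L (real n)) powr (1 / \<alpha>)"
    and M: "prob_space M"
    and copies: "model_copies M Xs qs \<eta>s N X q \<eta>"
    and pois: "std_poisson_process W Npois"
    and karlin: "karlin_stable_process W Npois \<alpha> \<beta> P \<zeta>"
  shows "fdd_converges M (\<lambda>n t \<omega>. aggregated_sum \<alpha>' m Xs qs \<eta>s n t \<omega> / a n) P \<zeta> {0..1}"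
  unfolding fdd_converges_def
proof (intro allI impI)
  fix d :: nat and t :: "nat \<Rightarrow> real" and f :: "(nat \<Rightarrow> real) \<Rightarrow> real"
  assume t: "\<forall>k<d. t k \<in> {0..1}"
    and f: "continuous_map (product_topology (\<lambda>_. euclideanreal) {..<d}) euclideanreal f"
    and bdd: "bounded (f ` (\<Pi>\<^sub>E k\<in>{..<d}. UNIV))"
  let ?J = "\<lambda>\<theta>. LBINT u:{0<..}. (\<integral>\<omega>. \<bar>\<Sum>k<d. \<theta> k * of_bool (odd (Npois (t k * u) \<omega>))\<bar> powr \<alpha> \<partial>W) * u powr (-\<beta> - 1)"
  let ?S = "\<lambda>n t \<omega>. aggregated_sum \<alpha>' m Xs qs \<eta>s n t \<omega> / a n"
  let ?\<kappa> = "\<lambda>n k. nat \<lfloor>real n * t k\<rfloor>"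
  have N: "prob_space N" and X_meas: "X \<in> borel_measurable N" and q_meas: "q \<in> borel_measurable N"
    and \<eta>: "cond_iid_bernoulli N q \<eta>"
    using model by (auto simp: single_model_def)
  have P: "prob_space P" and \<zeta>_meas: "\<And>t. t \<ge> 0 \<Longrightarrow> \<zeta> t \<in> borel_measurable P"
    and \<zeta>_char: "\<And>\<theta>. (\<integral>\<omega>. iexp (\<Sum>k<d. \<theta> k * \<zeta> (t k) \<omega>) \<partial>P) =
        complex_of_real (exp (- (\<beta> / (Gamma (1 - \<beta>) * C_stable \<alpha>)) *
          ?J \<theta>))"
    using karlin t by (auto simp: karlin_stable_process_def)
  have \<alpha>: "\<alpha> > 0" using X_cond by auto
  have defect_lim: "((\<lambda>s. char_defect N X s / \<bar>s\<bar> powr \<alpha>) \<longlongrightarrow> CX / C_stable \<alpha>) (at 0)"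
    using X_cond
  proof (elim disjE conjE)
    assume "\<alpha> = 2" "integrable N (\<lambda>\<omega>. (X \<omega>)\<^sup>2)" "CX = (\<integral>\<omega>. (X \<omega>)\<^sup>2 \<partial>N)"
    moreover have "\<bar>s\<bar> powr 2 = s\<^sup>2" for s :: real
      by (cases "s = 0") (simp_all add: powr_numeral)
    ultimately show ?thesis
      using prob_space.char_defect_asymp_finite_variance[OF N X_meas] by (simp add: C_stable_def)
  next
    assume "0 < \<alpha>" "\<alpha> < 2" "(\<lambda>x. measure N {\<omega> \<in> space N. \<bar>X \<omega>\<bar> > x}) \<sim>[at_top] (\<lambda>x. CX * x powr (-\<alpha>))"
    then show ?thesis using prob_space.char_defect_asymp_heavy_tail[OF N X_meas] CX_pos by blast
  qed
  define C where "C = CX * (Gamma (1 - \<beta>) / \<beta>)"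
  have Gamma_pos: "Gamma (1 - \<beta>) > 0" using beta by (intro Gamma_real_pos) simp
  have C: "C > 0" using CX_pos beta Gamma_pos by (simp add: C_def)
  have m_top: "filterlim (\<lambda>n. real (m n)) at_top sequentially"
  proof (rule filterlim_at_top_mono[OF m_growth])
    \<comment> \<open>The factor \<open>L n / n powr (1 - \<rho>)\<close> vanishes, so the growth condition forces \<open>m\<^sub>n\<close> itself to
      tend to infinity.\<close>
    have "((\<lambda>x. L x * x powr (- (1 - \<rho>))) \<longlongrightarrow> 0) at_top"
      using slowly_varying_powr_limits(1)[OF L_slow, of "1 - \<rho>"] rho by simp
    then have "(\<lambda>n. L (real n) * real n powr (- (1 - \<rho>))) \<longlonglongrightarrow> 0"
      by (rule filterlim_compose[OF _ filterlim_real_sequentially])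
    then have "\<forall>\<^sub>F n in sequentially. L (real n) * real n powr (- (1 - \<rho>)) < 1"
      by (rule order_tendstoD) simp
    then show "\<forall>\<^sub>F n in sequentially. real (m n) * L (real n) / real n powr (1 - \<rho>) \<le> real (m n)"
    proof eventually_elim
      case (elim n)
      have "real (m n) * (L (real n) * real n powr (- (1 - \<rho>))) \<le> real (m n) * 1"
        using elim by (intro mult_left_mono) auto
      then show ?case using powr_minus_divide[of "real n" "1 - \<rho>"] by simp
    qed
  qed
  have floor_le: "nat \<lfloor>real n * t k\<rfloor> \<le> n" if "k < d" for n k
  proof -
    have "real n * t k \<le> real n * 1" using t that by (intro mult_left_mono) auto
    then show ?thesis by linarith
  qed
  have Z_meas: "(\<lambda>\<omega>. (X \<omega>, q \<omega>, \<lambda>j\<in>{1..}. \<eta> j \<omega>)) \<in> N \<rightarrow>\<^sub>M borel \<Otimes>\<^sub>M borel \<Otimes>\<^sub>M eta_space"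
    using \<eta> by (intro measurable_Pair X_meas q_meas measurable_restrict) (simp add: cond_iid_bernoulli_def)
  show "(\<lambda>n. \<integral>\<omega>. f (\<lambda>k\<in>{..<d}. ?S n (t k) \<omega>) \<partial>M)
          \<longlonglongrightarrow> (\<integral>\<omega>. f (\<lambda>k\<in>{..<d}. \<zeta> (t k) \<omega>) \<partial>P)"
  proof (rule levy_continuity_multivariate[where M = "\<lambda>_. M", OF M P _ _ _ f bdd])
    show "(\<lambda>\<omega>. ?S n (t k) \<omega>) \<in> borel_measurable M" for n k
      by (intro borel_measurable_divide aggregated_sum_measurable[OF M copies]) auto
    show "\<zeta> (t k) \<in> borel_measurable P" if "k < d" for k
      using \<zeta>_meas t that by simp
    fix \<theta> :: "nat \<Rightarrow> real"
    define D where "D = (\<lambda>n. \<Sum>e\<in>Pow {..<d} - {{}}.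
      (\<integral>\<omega>. char_defect N X ((\<Sum>k\<in>e. \<theta> k) / (q \<omega> powr (1 / \<alpha>') * a n)) *
        bernoulli_parity d (?\<kappa> n) n (q \<omega>) e \<partial>N))"
    have "(\<integral>\<omega>. iexp (\<Sum>k<d. \<theta> k * ?S n (t k) \<omega>) \<partial>M) =
      complex_of_real ((1 - D n) ^ m n)" for n
    proof -
      define V where "V = (\<lambda>z. copy_contribution \<alpha>' d \<theta> (?\<kappa> n) z / a n)"
      have V: "V \<in> borel_measurable (borel \<Otimes>\<^sub>M borel \<Otimes>\<^sub>M eta_space)"
        unfolding V_def by measurable
      have "(\<integral>\<omega>. iexp (\<Sum>k<d. \<theta> k * ?S n (t k) \<omega>) \<partial>M) =
        (\<integral>\<omega>. iexp (\<Sum>i=1..m n. V (Xs i \<omega>, qs i \<omega>, \<lambda>j\<in>{1..}. \<eta>s i j \<omega>)) \<partial>M)"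
        unfolding aggregated_sum_eq_sum_contributions V_def ..
      also have "\<dots> = (\<integral>\<omega>. iexp (V (X \<omega>, q \<omega>, \<lambda>j\<in>{1..}. \<eta> j \<omega>)) \<partial>N) ^ m n"
        by (rule iid_copies_char_sum[OF M copies[unfolded model_copies_def] Z_meas V])
      also have "\<dots> = complex_of_real (1 - D n) ^ m n"
        unfolding V_def D_def by (subst single_model_char[OF model q_range X_sym floor_le]) auto
      finally show ?thesis by simp
    qed
    moreover have "(\<lambda>n. (1 - D n) ^ m n) \<longlonglongrightarrow> exp (- (CX / C_stable \<alpha> / C * ?J \<theta>))"
    proof (rule power_one_minus_tendsto_exp[OF m_top])
      show "0 \<le> D n" for n
        unfolding D_def
      proof (intro sum_nonneg integral_nonneg_AE AE_I2 mult_nonneg_nonneg)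
        fix \<omega> e assume "\<omega> \<in> space N"
        then show "0 \<le> bernoulli_parity d (?\<kappa> n) n (q \<omega>) e"
          using q_range[of \<omega>] by (intro bernoulli_parity_nonneg) auto
      qed (rule prob_space.char_defect_nonneg[OF N X_meas])
      show "(\<lambda>n. real (m n) * D n) \<longlonglongrightarrow> CX / C_stable \<alpha> / C * ?J \<theta>"
        unfolding D_def
        by (rule copies_times_defect_tendsto[OF N q_meas X_meas L_slow p_nonneg q_density \<alpha> alpha' _ beta(2,3) defect_lim m_pos m_growth C _ pois])
          (use a_def t beta gamma in \<open>auto simp: C_def\<close>)
    qed
    moreover have "CX / C_stable \<alpha> / C = \<beta> / (Gamma (1 - \<beta>) * C_stable \<alpha>)"
      using CX_pos beta Gamma_pos by (simp add: C_def divide_simps)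
    ultimately show "(\<lambda>n. \<integral>\<omega>. iexp (\<Sum>k<d. \<theta> k * ?S n (t k) \<omega>) \<partial>M)
      \<longlonglongrightarrow> (\<integral>\<omega>. iexp (\<Sum>k<d. \<theta> k * \<zeta> (t k) \<omega>) \<partial>P)"
      unfolding \<zeta>_char by (simp only: tendsto_of_real_iff mult_minus_left)
  qed
qed

end
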